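(* Let $A$ be a finite abelian group and let $G = A \rtimes_{-1} C_2$. Then $$\mathsf{D}_o(G) = \mathsf{d}(G)+1 = \mathsf{d}(A)+2.$$ Moreover, $\mathsf{D}_o(G)=\beta(G)$, where $\beta(G)$ is the Noether number of $G$ over a field $\mathbb{F}$ with $\operatorname{char}(\mathbb{F})\nmid |G|$.
   Context: Groups are written multiplicatively with identity $1$. $A \rtimes_{-1} C_2$ is the semidirect product in which the generator $h$ of $C_2$ (of order $2$) acts on $A$ by inversion: $hah^{-1}=a^{-1}$ for all $a\in A$. A sequence over a finite group $G$ is a finite unordered multiset of elements of $G$ (an element of the free abelian monoid $\mathcal{F}(G)$ on $G$), and its length $|S|$ is the number of terms counted with multiplicity. For $S=g_1\cdot g_2\cdots g_\ell$, $\pi(S)=\{\prod_{i=1}^{\ell} g_{\sigma(i)} : \sigma\in\mathfrak{S}_\ell\}$ is the set of products of all terms in all orders, and $\Pi(S)=\bigcup_{T\mid S,\ |T|\ge 1}\pi(T)$, the union over nonempty subsequences (sub-multisets) $T$ of $S$. The small Davenport constant is $\mathsf{d}(G)=\sup\{|S| : S\in\mathcal{F}(G),\ 1\notin\Pi(S)\}$ (the empty sequence is allowed, so the trivial group has $\mathsf{d}=0$). An ordered sequence over $G$ is a finite tuple $S^*=(g_1,\dots,g_\ell)$ of elements of $G$; an ordered subsequence is $(g_{i_1},\dots,g_{i_k})$ with $1\le i_1<\dots<i_k\le \ell$; its product is $\pi(S^* )=g_1g_2\cdots g_\ell$ in the given order; $\Pi(S^* )$ is the set of products of all nonempty ordered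 subsequences of $S^*$. The ordered Davenport constant $\mathsf{D}_o(G)$ is the least $k\in\mathbb{N}$ such that every ordered sequence $S^*$ over $G$ with $|S^*|\ge k$ satisfies $1\in\Pi(S^* )$. Noether number: for a finite-dimensional $G$-module $V$ over a field $\mathbb{F}$ with $\operatorname{char}(\mathbb{F})\nmid|G|$, let $\mathbb{F}[V]^G=\{f\in\mathbb{F}[V]: f^g=f\ \forall g\in G\}$ be the ring of polynomial invariants and let $\beta(G,V)$ be the smallest positive integer $d$ such that $\mathbb{F}[V]^G$ is generated (as an $\mathbb{F}$-algebra) by elements of degree $\le d$. Then $\beta(G)=\sup\{\beta(G,V): V \text{ a finite-dimensional } G\text{-module over }\mathbb{F}\}$. *)

theory Defs
  imports
    "HOL-Algebra.Elementary_Groups"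
    "HOL-Library.Sublist"
    "HOL-Library.Multiset"
    "HOL-Library.Extended_Nat"
    "HOL-Library.Poly_Mapping"
    "HOL-Computational_Algebra.Primes"
    "Jordan_Normal_Form.Matrix"
begin

section \<open>Generalized dihedral groups\<close>

definition semidirect_product ::
  "('a, 'm) monoid_scheme \<Rightarrow> ('b, 'n) monoid_scheme \<Rightarrow> ('b \<Rightarrow> 'a \<Rightarrow> 'a) \<Rightarrow> ('a \<times> 'b) monoid" where
  "semidirect_product N H \<phi> =
    \<lparr>carrier = carrier N \<times> carrier H,
     monoid.mult = (\<lambda>(a, x) (b, y). (a \<otimes>\<^bsub>N\<^esub> \<phi> x b, x \<otimes>\<^bsub>H\<^esub> y)),
     one = (\<one>\<^bsub>N\<^esub>, \<one>\<^bsub>H\<^esub>)\<rparr>"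

text \<open>The factor \<open>C\<^sub>2\<close> is the additive group of integers modulo 2, with carrier \<open>{0, 1}\<close>;
  its generator \<open>1\<close> acts by inversion.\<close>

definition gen_dihedral :: "('a, 'm) monoid_scheme \<Rightarrow> ('a \<times> int) monoid" where
  "gen_dihedral A =
    semidirect_product A (integer_mod_group 2) (\<lambda>x a. if x = 0 then a else inv\<^bsub>A\<^esub> a)"

lemma carrier_gen_dihedral: "carrier (gen_dihedral A) = carrier A \<times> {0, 1}"
  by (auto simp: gen_dihedral_def semidirect_product_def carrier_integer_mod_group)

lemma one_gen_dihedral: "\<one>\<^bsub>gen_dihedral A\<^esub> = (\<one>\<^bsub>A\<^esub>, 0)"
  by (simp add: gen_dihedral_def semidirect_product_def)

lemma mult_gen_dihedral:
  "(a, x) \<otimes>\<^bsub>gen_dihedral A\<^esub> (b, y) = (a \<otimes>\<^bsub>A\<^esub> (if x = 0 then b else inv\<^bsub>A\<^esub> b), (x + y) mod 2)"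
  by (simp add: gen_dihedral_def semidirect_product_def)

lemma group_gen_dihedral:
  assumes "comm_group A"
  shows "group (gen_dihedral A)"
proof -
  interpret comm_group A by fact
  show ?thesis
  proof (rule groupI)
    fix u assume "u \<in> carrier (gen_dihedral A)"
    then obtain a x where u: "u = (a, x)" "a \<in> carrier A" "x = 0 \<or> x = 1"
      by (auto simp: carrier_gen_dihedral)
    then show "\<exists>v\<in>carrier (gen_dihedral A). v \<otimes>\<^bsub>gen_dihedral A\<^esub> u = \<one>\<^bsub>gen_dihedral A\<^esub>"
      by (intro bexI[of _ "(if x = 0 then inv\<^bsub>A\<^esub> a else a, x)"])
        (auto simp: carrier_gen_dihedral one_gen_dihedral mult_gen_dihedral)
  qed (auto simp: carrier_gen_dihedral one_gen_dihedral mult_gen_dihedral m_assoc inv_mult)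
qed

lemma gen_dihedral_conj:
  assumes "comm_group A" and "a \<in> carrier A"
  shows "(\<one>\<^bsub>A\<^esub>, 1) \<otimes>\<^bsub>gen_dihedral A\<^esub> (a, 0) \<otimes>\<^bsub>gen_dihedral A\<^esub> inv\<^bsub>gen_dihedral A\<^esub> (\<one>\<^bsub>A\<^esub>, 1)
    = (inv\<^bsub>A\<^esub> a, 0)"
proof -
  interpret comm_group A by fact
  interpret G: group "gen_dihedral A" by (rule group_gen_dihedral) fact
  have "inv\<^bsub>gen_dihedral A\<^esub> (\<one>\<^bsub>A\<^esub>, 1) = (\<one>\<^bsub>A\<^esub>, 1)"
    by (rule G.inv_equality)
      (auto simp: carrier_gen_dihedral one_gen_dihedral mult_gen_dihedral)
  with assms(2) show ?thesis
    by (simp add: mult_gen_dihedral)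
qed


section \<open>Davenport constants\<close>

definition list_product :: "('a, 'm) monoid_scheme \<Rightarrow> 'a list \<Rightarrow> 'a" where
  "list_product G xs = foldr (\<otimes>\<^bsub>G\<^esub>) xs \<one>\<^bsub>G\<^esub>"

definition products :: "('a, 'm) monoid_scheme \<Rightarrow> 'a multiset \<Rightarrow> 'a set" where
  "products G S = {list_product G xs |xs. mset xs = S}"

definition subsequence_products :: "('a, 'm) monoid_scheme \<Rightarrow> 'a multiset \<Rightarrow> 'a set" where
  "subsequence_products G S = (\<Union>T\<in>{T. T \<subseteq># S \<and> size T \<ge> 1}. products G T)"

definition small_davenport :: "('a, 'm) monoid_scheme \<Rightarrow> enat" where
  "small_davenport G =
    (SUP S\<in>{S. set_mset S \<subseteq> carrier G \<and> \<one>\<^bsub>G\<^esub> \<notin> subsequence_products G S}. enat (size S))"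

definition ordered_subsequence_products :: "('a, 'm) monoid_scheme \<Rightarrow> 'a list \<Rightarrow> 'a set" where
  "ordered_subsequence_products G xs = {list_product G ys |ys. subseq ys xs \<and> ys \<noteq> []}"

text \<open>Least elements of sets of natural numbers are taken as infima in \<^typ>\<open>enat\<close>, so that the
  value is \<open>\<infinity>\<close> if there is no such number.\<close>

definition ordered_davenport :: "('a, 'm) monoid_scheme \<Rightarrow> enat" where
  "ordered_davenport G =
    (INF k\<in>{k. \<forall>xs. set xs \<subseteq> carrier G \<and> length xs \<ge> k
               \<longrightarrow> \<one>\<^bsub>G\<^esub> \<in> ordered_subsequence_products G xs}. enat k)"


section \<open>Polynomial invariants and the Noether number\<close>

text \<open>A monomial is a finitely supported exponent function on the variable indices, and
  \<open>F[x\<^sub>0, x\<^sub>1, \<dots>]\<close> is the corresponding monoid algebra, with the convolution product of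
  \<^theory>\<open>HOL-Library.Poly_Mapping\<close>.\<close>

type_synonym 'f mpoly = "(nat \<Rightarrow>\<^sub>0 nat) \<Rightarrow>\<^sub>0 'f"

definition mconst :: "'f::field \<Rightarrow> 'f mpoly" where
  "mconst c = Poly_Mapping.single 0 c"

definition mvar :: "nat \<Rightarrow> 'f::field mpoly" where
  "mvar i = Poly_Mapping.single (Poly_Mapping.single i 1) 1"

definition polys_in :: "nat \<Rightarrow> 'f::field mpoly set" where
  "polys_in n = {f. \<forall>m\<in>Poly_Mapping.keys f. Poly_Mapping.keys m \<subseteq> {..<n}}"

definition mono_degree :: "(nat \<Rightarrow>\<^sub>0 nat) \<Rightarrow> nat" where
  "mono_degree m = (\<Sum>i\<in>Poly_Mapping.keys m. Poly_Mapping.lookup m i)"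

definition degree_le :: "nat \<Rightarrow> 'f::field mpoly set" where
  "degree_le d = {f. \<forall>m\<in>Poly_Mapping.keys f. mono_degree m \<le> d}"

definition msubst :: "(nat \<Rightarrow> 'f::field mpoly) \<Rightarrow> 'f mpoly \<Rightarrow> 'f mpoly" where
  "msubst \<sigma> f =
    (\<Sum>m\<in>Poly_Mapping.keys f. mconst (Poly_Mapping.lookup f m) *
       (\<Prod>i\<in>Poly_Mapping.keys m. \<sigma> i ^ Poly_Mapping.lookup m i))"

text \<open>After a choice of basis, an \<open>n\<close>-dimensional \<open>G\<close>-module over \<open>F\<close> is a homomorphism
  from \<open>G\<close> to \<open>GL\<^sub>n(F)\<close>.\<close>

definition general_linear :: "'f::field itself \<Rightarrow> nat \<Rightarrow> 'f mat monoid" where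
  "general_linear F n = units_of (ring_mat F n ())"

definition matrix_modules :: "('a, 'm) monoid_scheme \<Rightarrow> nat \<Rightarrow> ('a \<Rightarrow> 'f::field mat) set" where
  "matrix_modules G n = hom G (general_linear TYPE('f) n)"

text \<open>With \<open>x\<^sub>0, \<dots>, x\<^sub>n\<^sub>-\<^sub>1\<close> the coordinate functions on \<open>V = F\<^sup>n\<close>, the polynomial
  \<^term>\<open>mat_act n M f\<close> is the composite of \<open>f\<close> with the linear map \<open>v \<mapsto> M v\<close>. Thus
  \<open>f\<^sup>g(v) = f(g v)\<close>, which is a right action.\<close>

definition mat_act :: "nat \<Rightarrow> 'f::field mat \<Rightarrow> 'f mpoly \<Rightarrow> 'f mpoly" where
  "mat_act n M = msubst (\<lambda>i. \<Sum>j<n. mconst (M $$ (i, j)) * mvar j)"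

definition invariants ::
  "('a, 'm) monoid_scheme \<Rightarrow> nat \<Rightarrow> ('a \<Rightarrow> 'f::field mat) \<Rightarrow> 'f mpoly set" where
  "invariants G n \<rho> = {f \<in> polys_in n. \<forall>g\<in>carrier G. mat_act n (\<rho> g) f = f}"

inductive_set generated_algebra :: "'f::field mpoly set \<Rightarrow> 'f mpoly set"
  for B :: "'f mpoly set" where
  gen: "f \<in> B \<Longrightarrow> f \<in> generated_algebra B"
| const: "mconst c \<in> generated_algebra B"
| add: "f \<in> generated_algebra B \<Longrightarrow> g \<in> generated_algebra B \<Longrightarrow> f + g \<in> generated_algebra B"
| mult: "f \<in> generated_algebra B \<Longrightarrow> g \<in> generated_algebra B \<Longrightarrow> f * g \<in> generated_algebra B"

definition module_noether_number ::
  "('a, 'm) monoid_scheme \<Rightarrow> nat \<Rightarrow> ('a \<Rightarrow> 'f::field mat) \<Rightarrow> enat" where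
  "module_noether_number G n \<rho> =
    (INF d\<in>{d. d > 0 \<and> (\<exists>B \<subseteq> invariants G n \<rho> \<inter> degree_le d.
                         generated_algebra B = invariants G n \<rho>)}. enat d)"

definition noether_number :: "'f::field itself \<Rightarrow> ('a, 'm) monoid_scheme \<Rightarrow> enat" where
  "noether_number F G =
    (SUP (n, \<rho>)\<in>{(n, \<rho> :: 'a \<Rightarrow> 'f mat). \<rho> \<in> matrix_modules G n}. module_noether_number G n \<rho>)"

end

theory Submission
  imports "HOL-Algebra.Algebraic_Closure_Type" "HOL-Algebra.Multiplicative_Group" Defs
begin

hide_const (open) Polynomial.order Divisibility.prime

text \<open>
  Let \<open>D = d(A) + 1\<close>, and let \<open>h\<close> be the reflection \<open>(1, 1)\<close>. Appending \<open>h\<close> to a product-one free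
  sequence over \<open>A\<close> gives \<open>d(G) \<ge> D\<close>. Conversely, in an ordered sequence of length \<open>D + 1\<close> that
  contains a reflection, products of consecutive reflections telescope, so that the rotations among
  the ordered products contain all subset products of a sequence of length \<open>D\<close> over \<open>A\<close>.

  For the Noether number, pass to the algebraic closure \<open>K\<close>, where \<open>A\<close> is isomorphic to its character
  group. It is enough to show that the product of \<open>D + 1\<close> eigenforms \<open>v\<^sub>i\<close> of \<open>A\<close> lies in the ideal
  generated by the invariants of positive degree at most \<open>D + 1\<close>. If the weights of the \<open>v\<^sub>i\<close>,
  \<open>i \<in> U\<close>, have product one, then \<open>\<Prod>\<^sub>U v\<^sub>i + \<Prod>\<^sub>U h v\<^sub>i\<close> is invariant, so replacing these \<open>v\<^sub>i\<close> by
  \<open>h v\<^sub>i\<close> changes the sign of the product modulo the ideal. The same result is reached by one such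
  replacement and by two of them, so the product is congruent to its own negative, and the
  characteristic is not 2. The lower bound comes from the invariant obtained by symmetrizing
  \<open>x\<^sub>1 \<cdots> x\<^sub>D z\<close>, where the weights of the \<open>x\<^sub>i\<close> form a minimal product-one sequence and \<open>z\<close> spans the
  sign representation.
\<close>

section \<open>Davenport constants of generalized dihedral groups\<close>

text \<open>Reducing to products of D + 1 eigenforms rests on three facts. Linear forms are sums of
  eigenforms, so by multilinearity the claim passes to all products of D + 1 variables. The
  cofactors that occur have smaller degree than the product itself. The Reynolds operator turns such
  an expression of an invariant into one with invariant cofactors, so induction on the degree
  applies. Both averages divide by group orders that are nonzero in the field; as |G| is even, the
  same hypothesis excludes characteristic 2.

  The length D + 1 is dictated by the second flip. It has to miss an index used by the first one,
  since otherwise the two flips could cancel, so a product-one set must exist among only D weights,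
  and D exceeds d(A).

  Over F the obstacle is that roots of unity may be missing, so A may have too few characters with
  values in F. Upper bounds descend from K because averaging is defined over F. A lower bound needs
  a module that is itself defined over F, and the K-module with the wanted weights need not be;
  hence the use of regular representations, which exist over every field.\<close>

lemma list_product_Nil [simp]: "list_product G [] = \<one>\<^bsub>G\<^esub>"
  by (simp add: list_product_def)

lemma list_product_Cons [simp]: "list_product G (x # xs) = x \<otimes>\<^bsub>G\<^esub> list_product G xs"
  by (simp add: list_product_def)

lemma (in monoid) list_product_closed [intro]:
  "set xs \<subseteq> carrier G \<Longrightarrow> list_product G xs \<in> carrier G"
  by (induction xs) auto

lemma (in monoid) list_product_append:
  "set xs \<subseteq> carrier G \<Longrightarrow> set ys \<subseteq> carrier G \<Longrightarrow>
    list_product G (xs @ ys) = list_product G xs \<otimes> list_product G ys"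
  by (induction xs) (auto simp: m_assoc list_product_closed)

lemma (in comm_monoid) list_product_eq_finprod:
  "distinct us \<Longrightarrow> c \<in> set us \<rightarrow> carrier G \<Longrightarrow>
    list_product G (map c us) = finprod G c (set us)"
  by (induction us) (auto simp: Pi_def)

lemma (in comm_monoid) list_product_mset_cong:
  assumes "mset xs = mset ys" "set xs \<subseteq> carrier G"
  shows "list_product G xs = list_product G ys"
  using assms
proof (induction xs arbitrary: ys)
  case (Cons x xs)
  then have "x \<in> set ys"
    by (metis list.set_intros(1) set_mset_mset)
  then obtain as bs where ys: "ys = as @ x # bs"
    by (auto simp: in_set_conv_decomp)
  have sub: "set as \<subseteq> carrier G" "set bs \<subseteq> carrier G" "x \<in> carrier G"
    using Cons.prems(2) mset_eq_setD[OF Cons.prems(1)] by (auto simp: ys)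
  have "list_product G xs = list_product G (as @ bs)"
    using Cons.prems by (intro Cons.IH) (auto simp: ys)
  then show ?case
    using sub by (simp add: ys list_product_append list_product_closed m_lcomm)
qed simp

lemma subseteq_add_mset_notin:
  assumes "T \<subseteq># add_mset y M" "y \<notin># T"
  shows "T \<subseteq># M"
proof (rule mset_subset_eqI)
  fix x
  show "count T x \<le> count M x"
    using mset_subset_eq_count[OF assms(1), of x] assms(2)
    by (cases "x = y") (auto simp: not_in_iff)
qed

lemma subseq_of_submultiset:
  "T \<subseteq># mset ys \<Longrightarrow> \<exists>zs. subseq zs ys \<and> mset zs = T"
proof (induction ys arbitrary: T)
  case (Cons y ys)
  show ?case
  proof (cases "y \<in># T")
    case True
    then have "T - {#y#} \<subseteq># mset ys"
      using Cons.prems by (simp add: subset_eq_diff_conv)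
    then obtain zs where "subseq zs ys" "mset zs = T - {#y#}"
      using Cons.IH by blast
    then show ?thesis
      using True by (intro exI[of _ "y # zs"]) auto
  next
    case False
    then have "T \<subseteq># mset ys"
      using Cons.prems subseteq_add_mset_notin by force
    then show ?thesis
      using Cons.IH by (metis list_emb_Cons)
  qed
qed simp

lemma mset_subseq: "subseq xs ys \<Longrightarrow> mset xs \<subseteq># mset ys"
  by (induction rule: list_emb.induct) (auto intro: subset_mset.order_trans)

lemma set_subseq: "subseq xs ys \<Longrightarrow> set xs \<subseteq> set ys"
  using set_mset_mono[OF mset_subseq] by simp

text \<open>Commutativity makes the order of the factors irrelevant, so unordered product-one
  subsequences can be looked for inside any one listing. This carries
  \<open>small_davenport\<close>, which is about multisets, over to lists.\<close>

lemma (in comm_group) one_in_subsequence_products_mset: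
  assumes "set xs \<subseteq> carrier G"
  shows "\<one> \<in> subsequence_products G (mset xs) \<longleftrightarrow>
    (\<exists>ys. subseq ys xs \<and> ys \<noteq> [] \<and> list_product G ys = \<one>)"
proof
  assume "\<one> \<in> subsequence_products G (mset xs)"
  then obtain zs where zs: "mset zs \<subseteq># mset xs" "size (mset zs) \<ge> 1" "list_product G zs = \<one>"
    by (auto simp: subsequence_products_def products_def)
  then obtain ys where ys: "subseq ys xs" "mset ys = mset zs"
    using subseq_of_submultiset by blast
  then have "list_product G ys = list_product G zs"
    using assms mset_subset_eqD[OF zs(1)] by (intro list_product_mset_cong) (auto dest: mset_eq_setD)
  with ys zs show "\<exists>ys. subseq ys xs \<and> ys \<noteq> [] \<and> list_product G ys = \<one>"
    by (intro exI[of _ ys]) auto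
next
  assume "\<exists>ys. subseq ys xs \<and> ys \<noteq> [] \<and> list_product G ys = \<one>"
  then obtain ys where "subseq ys xs" "ys \<noteq> []" "list_product G ys = \<one>"
    by blast
  then show "\<one> \<in> subsequence_products G (mset xs)"
    unfolding subsequence_products_def products_def
    by (auto intro!: exI[of _ "mset ys"] exI[of _ ys] mset_subseq simp: Suc_le_eq)
qed

lemma (in comm_group) product_one_subseq:
  assumes "set xs \<subseteq> carrier G" "small_davenport G < enat (length xs)"
  obtains ys where "subseq ys xs" "ys \<noteq> []" "list_product G ys = \<one>"
proof -
  have "\<one> \<in> subsequence_products G (mset xs)"
  proof (rule ccontr)
    assume "\<one> \<notin> subsequence_products G (mset xs)"
    then have "enat (size (mset xs)) \<le> small_davenport G"
      unfolding small_davenport_def using assms(1) by (intro SUP_upper) auto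
    with assms(2) show False by simp
  qed
  with that show thesis
    using one_in_subsequence_products_mset[OF assms(1)] by blast
qed

text \<open>Index sets rather than lists, because equal weights may occur at several positions and
  the flipping argument forms differences and unions of the chosen positions.\<close>

lemma (in comm_group) finprod_one_subset:
  assumes "finite J" "c \<in> J \<rightarrow> carrier G" "small_davenport G < enat (card J)"
  obtains U where "U \<subseteq> J" "U \<noteq> {}" "finprod G c U = \<one>"
proof -
  obtain js where js: "set js = J" "distinct js"
    using finite_distinct_list[OF assms(1)] by blast
  have "length (map c js) = card J"
    using js distinct_card by fastforce
  with product_one_subseq[of "map c js"] obtain ys where
    ys: "subseq ys (map c js)" "ys \<noteq> []" "list_product G ys = \<one>"
    using assms js by (auto simp: Pi_iff)
  obtain N where "ys = nths (map c js) N"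
    using ys(1) by (auto simp: subseq_conv_nths)
  then have ys_eq: "ys = map c (nths js N)"
    by (simp add: nths_map)
  have sub: "set (nths js N) \<subseteq> J"
    using js set_nths_subset by fastforce
  show thesis
  proof (rule that[of "set (nths js N)"])
    show "finprod G c (set (nths js N)) = \<one>"
      using ys(3) sub assms(2) js
      by (subst list_product_eq_finprod[symmetric]) (auto simp: ys_eq Pi_iff)
  qed (use sub ys ys_eq in auto)
qed

text \<open>Pigeonhole on the \<open>order G + 1\<close> prefix products: two of them agree, and the
  segment between the two cut points has product one.\<close>

lemma (in comm_group) product_one_subseq_order:
  assumes "finite (carrier G)" "set xs \<subseteq> carrier G" "order G \<le> length xs"
  shows "\<exists>ys. subseq ys xs \<and> ys \<noteq> [] \<and> list_product G ys = \<one>"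
proof -
  define p where "p i = list_product G (take i xs)" for i
  have sub: "set (take i xs) \<subseteq> carrier G" "set (drop i xs) \<subseteq> carrier G" for i
    using assms(2) set_take_subset set_drop_subset by fastforce+
  have "p ` {..order G} \<subseteq> carrier G"
    using sub by (auto simp: p_def)
  then have "card (p ` {..order G}) < card {..order G}"
    using card_mono[OF assms(1), of "p ` {..order G}"] by (simp add: Coset.order_def)
  then have "\<not> inj_on p {..order G}"
    by (rule pigeonhole)
  then obtain i j where ij: "i < j" "j \<le> order G" "p i = p j"
    by (metis atMost_iff inj_onI linorder_neqE_nat)
  define ys where "ys = take (j - i) (drop i xs)"
  have "take j xs = take i xs @ ys"
    using ij(1) by (simp add: ys_def flip: take_add)
  moreover have sub_ys: "set ys \<subseteq> carrier G"
    using sub(2)[of i] set_take_subset unfolding ys_def by fast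
  ultimately have "p j = p i \<otimes> list_product G ys"
    using sub by (simp add: p_def list_product_append)
  moreover have "p j \<in> carrier G"
    using sub by (auto simp: p_def)
  ultimately have "list_product G ys = \<one>"
    using ij(3) sub_ys by (metis l_cancel_one list_product_closed)
  moreover have "ys \<noteq> []"
    using ij assms(3) by (simp add: ys_def)
  moreover have "subseq ys xs"
  proof -
    have "xs = take i xs @ ys @ drop (j - i) (drop i xs)"
      by (simp add: ys_def del: drop_drop)
    then have "sublist ys xs"
      unfolding sublist_def by metis
    then show ?thesis
      by (rule sublist_imp_subseq)
  qed
  ultimately show ?thesis by blast
qed

text \<open>The pigeonhole bound leaves only finitely many possible lengths, so the supremum in
  \<open>enat\<close> is finite and is a maximum.\<close>

lemma (in comm_group) small_davenport_attained:
  assumes "finite (carrier G)"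
  obtains xs where "set xs \<subseteq> carrier G" "small_davenport G = enat (length xs)"
    "\<And>ys. subseq ys xs \<Longrightarrow> ys \<noteq> [] \<Longrightarrow> list_product G ys \<noteq> \<one>"
proof -
  define M where "M = {S. set_mset S \<subseteq> carrier G \<and> \<one> \<notin> subsequence_products G S}"
  have bound: "size S < order G" if S: "S \<in> M" for S
  proof (rule ccontr)
    assume ge: "\<not> size S < order G"
    obtain xs where xs: "S = mset xs"
      using ex_mset by metis
    with S have sub: "set xs \<subseteq> carrier G"
      by (simp add: M_def)
    have "\<one> \<in> subsequence_products G (mset xs)"
      unfolding one_in_subsequence_products_mset[OF sub]
      using sub ge xs by (intro product_one_subseq_order[OF assms]) auto
    with S show False by (simp add: M_def xs)
  qed
  have "(\<lambda>S. enat (size S)) ` M \<subseteq> enat ` {..<order G}"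
    using bound by auto
  then have fin: "finite ((\<lambda>S. enat (size S)) ` M)"
    using finite_surj by blast
  have "{#} \<in> M"
    by (auto simp: M_def subsequence_products_def)
  then have ne: "(\<lambda>S. enat (size S)) ` M \<noteq> {}"
    by blast
  have "small_davenport G = Max ((\<lambda>S. enat (size S)) ` M)"
    unfolding small_davenport_def M_def[symmetric] using fin ne by (simp add: Max_Sup)
  then have "small_davenport G \<in> (\<lambda>S. enat (size S)) ` M"
    using Max_in[OF fin ne] by simp
  then obtain S where S: "S \<in> M" "small_davenport G = enat (size S)"
    by blast
  obtain xs where xs: "S = mset xs"
    using ex_mset by metis
  show thesis
  proof (rule that[of xs])
    show sub: "set xs \<subseteq> carrier G"
      using S by (simp add: M_def xs)
    show "list_product G ys \<noteq> \<one>" if "subseq ys xs" "ys \<noteq> []" for ys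
      using S one_in_subsequence_products_mset[OF sub] that by (auto simp: M_def xs)
  qed (use S xs in simp)
qed

text \<open>Append the inverse of the total product to a longest product-one free sequence. If a
  proper nonempty subset had product one, so would its complement, and one of the two avoids the
  appended index \<open>d\<close>.\<close>

lemma (in comm_group) minimal_product_one_sequence:
  assumes "finite (carrier G)"
  obtains d c where "small_davenport G = enat d" "c \<in> {..d} \<rightarrow> carrier G"
    "finprod G c {..d} = \<one>"
    "\<And>U. U \<subseteq> {..d} \<Longrightarrow> U \<noteq> {} \<Longrightarrow> finprod G c U = \<one> \<Longrightarrow> U = {..d}"
proof -
  obtain xs where xs: "set xs \<subseteq> carrier G" "small_davenport G = enat (length xs)"
    and free: "\<And>ys. subseq ys xs \<Longrightarrow> ys \<noteq> [] \<Longrightarrow> list_product G ys \<noteq> \<one>"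
    using small_davenport_attained[OF assms] by blast
  define d where "d = length xs"
  define c where "c i = (if i < d then xs ! i else inv (list_product G xs))" for i
  have c_closed: "c i \<in> carrier G" for i
    using xs(1) list_product_closed[OF xs(1)] nth_mem by (auto simp: c_def d_def)
  have nth_c: "map c [0..<d] = xs"
    by (rule nth_equalityI) (auto simp: c_def d_def)
  have free': "finprod G c U \<noteq> \<one>" if U: "U \<subseteq> {..<d}" "U \<noteq> {}" for U
  proof -
    define us where "us = nths [0..<d] U"
    have set_us: "set us = U"
      using U by (force simp: us_def set_nths subset_iff)
    have "map c us = nths xs U"
      using nth_c by (metis nths_map us_def)
    then have "subseq (map c us) xs"
      by (auto simp: subseq_conv_nths)
    moreover have "map c us \<noteq> []"
      using set_us U by auto
    ultimately have "list_product G (map c us) \<noteq> \<one>"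
      by (rule free)
    moreover have "distinct us"
      by (simp add: us_def)
    ultimately show ?thesis
      using list_product_eq_finprod[of us c] c_closed set_us by auto
  qed
  have insert_d: "{..d} = insert d {..<d}"
    by auto
  have "finprod G c {..<d} = list_product G xs"
    using list_product_eq_finprod[of "[0..<d]" c] c_closed
    by (simp add: nth_c atLeast0LessThan Pi_def)
  then have prod_d: "finprod G c {..d} = \<one>"
    unfolding insert_d using c_closed list_product_closed[OF xs(1)]
    by (subst finprod_insert) (simp_all add: Pi_def, simp add: c_def)
  show thesis
  proof (rule that[of d c])
    fix U assume U: "U \<subseteq> {..d}" "U \<noteq> {}" "finprod G c U = \<one>"
    show "U = {..d}"
    proof (rule ccontr)
      assume ne: "U \<noteq> {..d}"
      have "finprod G c ({..d} - U) = \<one>"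
      proof -
        have "finprod G c {..d} = finprod G c U \<otimes> finprod G c ({..d} - U)"
          using U c_closed by (subst finprod_Un_disjoint[symmetric])
            (auto intro!: arg_cong[where f = "finprod G c"] finite_subset[OF U(1)])
        then show ?thesis
          using prod_d U(3) c_closed by (simp add: Pi_def)
      qed
      moreover have "{..d} - U \<subseteq> {..<d}" if "d \<in> U"
        using that by (auto simp: order_le_less)
      moreover have "U \<subseteq> {..<d}" if "d \<notin> U"
        using that U by (metis atMost_iff lessThan_iff order_le_less subset_eq)
      moreover have "{..d} - U \<noteq> {}"
        using U ne by blast
      ultimately show False
        using free' U by blast
    qed
  qed (use c_closed xs prod_d d_def in auto)
qed

section \<open>Ordered sequences over the generalized dihedral group\<close>

lemma order_gen_dihedral: "order (gen_dihedral A) = 2 * order A"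
  by (simp add: Coset.order_def carrier_gen_dihedral card_cartesian_product)

context comm_group
begin

abbreviation "DG \<equiv> gen_dihedral G"

lemma list_product_gen_dihedral_rotations:
  assumes "set xs \<subseteq> carrier G \<times> {0}" "subseq zs (map fst xs)"
  shows "\<exists>ws. subseq ws xs \<and> (zs \<noteq> [] \<longrightarrow> ws \<noteq> []) \<and> list_product DG ws = (list_product G zs, 0)"
proof -
  obtain N where "zs = map fst (nths xs N)"
    using assms(2) by (auto simp: subseq_conv_nths nths_map)
  moreover have "list_product DG ws = (list_product G (map fst ws), 0)"
    if "set ws \<subseteq> carrier G \<times> {0}" for ws
    using that by (induction ws) (auto simp: one_gen_dihedral mult_gen_dihedral)
  moreover have "set (nths xs N) \<subseteq> carrier G \<times> {0}"
    using assms(1) set_nths_subset by fast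
  ultimately show ?thesis
    by (intro exI[of _ "nths xs N"]) (auto simp: subseq_conv_nths)
qed

text \<open>The gaps between consecutive reflections telescope: with a new reflection \<open>g\<close> in front of
  \<open>xs\<close>, the product \<open>g r\<close> is the new rotation, and \<open>g\<close> replaces the reflection \<open>r\<close>.\<close>

lemma subsequence_products_of_reflections:
  assumes "set xs \<subseteq> carrier DG" "\<exists>x\<in>set xs. snd x = 1"
  shows "\<exists>ys r. set ys \<subseteq> carrier G \<and> length xs = Suc (length ys) \<and> r \<in> carrier G \<and>
    (\<forall>zs. subseq zs ys \<longrightarrow>
      (\<exists>ws. subseq ws xs \<and> (zs \<noteq> [] \<longrightarrow> ws \<noteq> []) \<and> list_product DG ws = (list_product G zs, 0)) \<and>
      (\<exists>ws. subseq ws xs \<and> list_product DG ws = (r \<otimes> inv (list_product G zs), 1)))"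
  using assms
proof (induction xs)
  case (Cons x xs)
  obtain a e where x: "x = (a, e)" "a \<in> carrier G" "e = 0 \<or> e = 1"
    using Cons.prems by (auto simp: carrier_gen_dihedral)
  show ?case
  proof (cases "\<exists>x\<in>set xs. snd x = 1")
    case True
    with Cons obtain ys r where ys: "set ys \<subseteq> carrier G" "length xs = Suc (length ys)" "r \<in> carrier G"
      and rot: "\<And>zs. subseq zs ys \<Longrightarrow>
        \<exists>ws. subseq ws xs \<and> (zs \<noteq> [] \<longrightarrow> ws \<noteq> []) \<and> list_product DG ws = (list_product G zs, 0)"
      and ref: "\<And>zs. subseq zs ys \<Longrightarrow>
        \<exists>ws. subseq ws xs \<and> list_product DG ws = (r \<otimes> inv (list_product G zs), 1)"
      by auto
    \<comment> \<open>In both cases \<open>r' = r \<otimes> b\<close>. A selection that avoids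
      \<open>b\<close> gets its reflection from \<open>x\<close> together with an old product. For
      one that starts with \<open>b\<close>, the two copies of \<open>b\<close> in
      \<open>r' \<otimes> inv (list_product G zs)\<close> cancel and the old reflection serves
      unchanged.\<close>
    define b where "b = (if e = 0 then a else a \<otimes> inv r)"
    define r' where "r' = (if e = 0 then a \<otimes> r else a)"
    have closed: "b \<in> carrier G" "r' \<in> carrier G"
      using x ys by (auto simp: b_def r'_def)
    have "(\<exists>ws. subseq ws (x # xs) \<and> (zs \<noteq> [] \<longrightarrow> ws \<noteq> []) \<and>
          list_product DG ws = (list_product G zs, 0)) \<and>
        (\<exists>ws. subseq ws (x # xs) \<and> list_product DG ws = (r' \<otimes> inv (list_product G zs), 1))"
      if zs: "subseq zs (b # ys)" for zs
    proof (cases "subseq zs ys")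
      case sub: True
      obtain ws where ws: "subseq ws xs" "zs \<noteq> [] \<longrightarrow> ws \<noteq> []"
          "list_product DG ws = (list_product G zs, 0)"
        using rot[OF sub] by blast
      obtain vs where vs: "subseq vs xs"
          "list_product DG vs = (r \<otimes> inv (list_product G zs), 1)"
        using ref[OF sub] by blast
      have "list_product G zs \<in> carrier G"
        using set_subseq[OF sub] ys by (intro list_product_closed) auto
      then have "list_product DG (x # (if e = 0 then vs else ws)) = (r' \<otimes> inv (list_product G zs), 1)"
        using x ws vs ys by (auto simp: mult_gen_dihedral r'_def m_assoc)
      then show ?thesis
        using ws vs by (intro conjI[OF exI[of _ ws] exI[of _ "x # (if e = 0 then vs else ws)"]]) auto
    next
      case False
      then obtain zs' where zs': "zs = b # zs'" "subseq zs' ys"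
        using zs by (cases zs) (auto split: if_splits)
      obtain ws where ws: "subseq ws xs" "list_product DG ws = (list_product G zs', 0)"
        using rot[OF zs'(2)] by blast
      obtain vs where vs: "subseq vs xs"
          "list_product DG vs = (r \<otimes> inv (list_product G zs'), 1)"
        using ref[OF zs'(2)] by blast
      have p: "list_product G zs' \<in> carrier G"
        using set_subseq[OF zs'(2)] ys by (intro list_product_closed) auto
      have "list_product DG (x # (if e = 0 then ws else vs)) = (list_product G zs, 0)"
        using x ws vs ys zs' p by (auto simp: mult_gen_dihedral b_def m_assoc inv_mult)
      moreover have "r' \<otimes> inv (list_product G zs) = r \<otimes> inv (list_product G zs')"
      proof -
        have "r' = r \<otimes> b"
          using x ys by (auto simp: r'_def b_def m_comm[of a] m_assoc[symmetric])
        moreover have "b \<otimes> (inv b \<otimes> inv (list_product G zs')) = inv (list_product G zs')"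
          using p closed by (simp flip: m_assoc)
        ultimately show ?thesis
          using p closed ys by (simp add: zs' inv_mult m_assoc)
      qed
      ultimately show ?thesis
        using ws vs zs' by (intro conjI[OF exI[of _ "x # (if e = 0 then ws else vs)"] exI[of _ vs]]) auto
    qed
    then show ?thesis
      using ys closed by (intro exI[of _ "b # ys"] exI[of _ r']) auto
  next
    case False
    then have xs: "set xs \<subseteq> carrier G \<times> {0}"
      using Cons.prems by (fastforce simp: carrier_gen_dihedral)
    have e: "e = 1"
      using Cons.prems False x by auto
    have "(\<exists>ws. subseq ws (x # xs) \<and> (zs \<noteq> [] \<longrightarrow> ws \<noteq> []) \<and>
          list_product DG ws = (list_product G zs, 0)) \<and>
        (\<exists>ws. subseq ws (x # xs) \<and> list_product DG ws = (a \<otimes> inv (list_product G zs), 1))"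
      if zs: "subseq zs (map fst xs)" for zs
    proof -
      obtain ws where ws: "subseq ws xs" "zs \<noteq> [] \<longrightarrow> ws \<noteq> []"
          "list_product DG ws = (list_product G zs, 0)"
        using list_product_gen_dihedral_rotations[OF xs zs] by blast
      then have "list_product DG (x # ws) = (a \<otimes> inv (list_product G zs), 1)"
        using x e by (simp add: mult_gen_dihedral)
      with ws show ?thesis
        by (metis list_emb_Cons subseq_Cons2)
    qed
    then show ?thesis
      using xs x by (intro exI[of _ "map fst xs"] exI[of _ a]) auto
  qed
qed simp

text \<open>Three bounds close a circle: \<open>d + 2\<close> is at most
  \<open>small_davenport DG + 1\<close>, which is at most \<open>ordered_davenport DG\<close>, which
  is at most \<open>d + 2\<close>.\<close>

lemma davenport_gen_dihedral:
  assumes "finite (carrier G)"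
  shows "ordered_davenport DG = small_davenport DG + 1"
    and "small_davenport DG + 1 = small_davenport G + 2"
proof -
  obtain xs where xs: "set xs \<subseteq> carrier G" "small_davenport G = enat (length xs)"
    and free: "\<And>ys. subseq ys xs \<Longrightarrow> ys \<noteq> [] \<Longrightarrow> list_product G ys \<noteq> \<one>"
    using small_davenport_attained[OF assms] by blast
  define d where "d = length xs"
  have lower: "enat (d + 1) \<le> small_davenport DG"
  proof -
    define S where "S = add_mset (\<one>, 1 :: int) (mset (map (\<lambda>a. (a, 0)) xs))"
    have snd_product: "snd (list_product DG ws) = (\<Sum>x\<leftarrow>ws. snd x) mod 2" for ws
      by (induction ws) (auto simp: one_gen_dihedral gen_dihedral_def semidirect_product_def
          integer_mod_group_def case_prod_beta integer_group_def mod_simps)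
    have fst_product: "fst (list_product DG ws) = list_product G (map fst ws)"
      if "\<forall>x\<in>set ws. snd x = 0" for ws
      using that by (induction ws) (auto simp: one_gen_dihedral gen_dihedral_def
          semidirect_product_def case_prod_beta)
    have "\<one>\<^bsub>DG\<^esub> \<notin> subsequence_products DG S"
    proof
      assume "\<one>\<^bsub>DG\<^esub> \<in> subsequence_products DG S"
      then obtain ws where ws: "mset ws \<subseteq># S" "ws \<noteq> []" "list_product DG ws = (\<one>, 0)"
        unfolding subsequence_products_def products_def one_gen_dihedral by force
      show False
      \<comment> \<open>The reflection occurs only once in \<open>S\<close>, so a product that uses
        it has second component 1 and is not the identity.\<close>
      proof (cases "(\<one>, 1) \<in> set ws")
        case True
        then obtain us vs where "ws = us @ (\<one>, 1) # vs"
          by (auto simp: in_set_conv_decomp)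
        moreover from this ws have "mset (us @ vs) \<subseteq># mset (map (\<lambda>a. (a, 0)) xs)"
          by (simp add: S_def)
        then have "\<forall>x\<in>set (us @ vs). snd x = 0"
          by (force dest: mset_subset_eqD)
        then have "sum_list (map snd us) = 0" "sum_list (map snd vs) = 0"
          by (auto intro!: sum_list_0 simp: sum_list_eq_0_iff map_idI cong: map_cong)
        ultimately have "snd (list_product DG ws) = 1"
          by (simp add: snd_product)
        then show False using ws by simp
      next
        case False
        then have sub: "mset ws \<subseteq># mset (map (\<lambda>a. (a, 0)) xs)"
          using subseteq_add_mset_notin[OF ws(1)[unfolded S_def]] by simp
        then have "mset (map fst ws) \<subseteq># mset xs"
          using image_mset_subseteq_mono[OF sub, of fst] by (simp add: multiset.map_comp o_def)
        then obtain zs where zs: "subseq zs xs" "mset zs = mset (map fst ws)"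
          using subseq_of_submultiset by blast
        have "\<forall>x\<in>set ws. snd x = 0"
          using sub by (force dest: mset_subset_eqD)
        then have "list_product G (map fst ws) = \<one>"
          using fst_product ws by (metis fst_conv)
        moreover have "set zs \<subseteq> carrier G"
          using xs set_subseq[OF zs(1)] by auto
        ultimately have "list_product G zs = \<one>"
          using list_product_mset_cong[OF zs(2)] by simp
        moreover have "zs \<noteq> []"
          using zs ws by auto
        ultimately show False
          using free zs by blast
      qed
    qed
    then have "enat (size S) \<le> small_davenport DG"
      unfolding small_davenport_def using xs
      by (intro SUP_upper) (auto simp: S_def carrier_gen_dihedral)
    then show ?thesis
      by (simp add: S_def d_def)
  qed
  have middle: "small_davenport DG + 1 \<le> ordered_davenport DG"
    unfolding ordered_davenport_def
  proof (rule INF_greatest)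
    fix k
    assume "k \<in> {k. \<forall>xs. set xs \<subseteq> carrier DG \<and> length xs \<ge> k
      \<longrightarrow> \<one>\<^bsub>DG\<^esub> \<in> ordered_subsequence_products DG xs}"
    then have k: "\<And>xs. set xs \<subseteq> carrier DG \<Longrightarrow> length xs \<ge> k \<Longrightarrow>
        \<one>\<^bsub>DG\<^esub> \<in> ordered_subsequence_products DG xs"
      by blast
    \<comment> \<open>Testing the empty sequence excludes \<open>k = 0\<close>, so that
      \<open>k - 1\<close> below is a genuine predecessor.\<close>
    from k[of "[]"] have "k > 0"
      by (cases k) (auto simp: ordered_subsequence_products_def)
    have "small_davenport DG \<le> enat (k - 1)"
      unfolding small_davenport_def
    proof (rule SUP_least)
      fix S assume S: "S \<in> {S. set_mset S \<subseteq> carrier DG \<and> \<one>\<^bsub>DG\<^esub> \<notin> subsequence_products DG S}"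
      obtain ws where ws: "S = mset ws"
        using ex_mset by metis
      have "size S < k"
      proof (rule ccontr)
        assume "\<not> size S < k"
        with S k[of ws] obtain ys where ys: "\<one>\<^bsub>DG\<^esub> = list_product DG ys" "subseq ys ws" "ys \<noteq> []"
          by (auto simp: ordered_subsequence_products_def ws)
        then have "\<one>\<^bsub>DG\<^esub> \<in> subsequence_products DG S"
          unfolding subsequence_products_def products_def ws
          by (auto intro!: exI[of _ "mset ys"] exI[of _ ys] mset_subseq simp: Suc_le_eq)
        with S show False by blast
      qed
      then show "enat (size S) \<le> enat (k - 1)"
        by simp
    qed
    then have "small_davenport DG + 1 \<le> enat (k - 1) + 1"
      by (rule add_right_mono)
    also have "\<dots> = enat k"
      using \<open>k > 0\<close> by (simp add: one_enat_def)
    finally show "small_davenport DG + 1 \<le> enat k" .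
  qed
  have upper: "ordered_davenport DG \<le> enat (d + 2)"
    unfolding ordered_davenport_def
  proof (intro INF_lower CollectI allI impI)
    fix gs assume gs: "set gs \<subseteq> carrier DG \<and> length gs \<ge> d + 2"
    \<comment> \<open>Telescoping costs one term: \<open>length gs \<ge> d + 2\<close> yields a list
      of length at least \<open>d + 1\<close> over the abelian group, just above
      \<open>small_davenport G\<close>. A sequence without reflections loses nothing.\<close>
    have "\<exists>ys. set ys \<subseteq> carrier G \<and> d < length ys \<and> (\<forall>zs. subseq zs ys \<longrightarrow>
      (\<exists>ws. subseq ws gs \<and> (zs \<noteq> [] \<longrightarrow> ws \<noteq> []) \<and> list_product DG ws = (list_product G zs, 0)))"
    proof (cases "\<exists>x\<in>set gs. snd x = 1")
      case True
      then obtain ys where "set ys \<subseteq> carrier G" "length gs = Suc (length ys)"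
        "\<forall>zs. subseq zs ys \<longrightarrow>
          (\<exists>ws. subseq ws gs \<and> (zs \<noteq> [] \<longrightarrow> ws \<noteq> []) \<and> list_product DG ws = (list_product G zs, 0))"
        using subsequence_products_of_reflections[of gs] gs by auto
      then show ?thesis
        using gs by (intro exI[of _ ys]) auto
    next
      case False
      then have "set gs \<subseteq> carrier G \<times> {0}"
        using gs by (fastforce simp: carrier_gen_dihedral)
      then show ?thesis
        using gs list_product_gen_dihedral_rotations[of gs]
        by (intro exI[of _ "map fst gs"]) auto
    qed
    then obtain ys where ys: "set ys \<subseteq> carrier G" "d < length ys"
      "\<And>zs. subseq zs ys \<Longrightarrow>
        \<exists>ws. subseq ws gs \<and> (zs \<noteq> [] \<longrightarrow> ws \<noteq> []) \<and> list_product DG ws = (list_product G zs, 0)"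
      by blast
    have "small_davenport G < enat (length ys)"
      using ys(2) xs(2) by (simp add: d_def)
    then obtain zs where "subseq zs ys" "zs \<noteq> []" "list_product G zs = \<one>"
      by (rule product_one_subseq[OF ys(1)])
    moreover from this ys(3)[of zs] obtain ws where
      "subseq ws gs" "ws \<noteq> []" "list_product DG ws = (list_product G zs, 0)"
      by auto
    ultimately show "\<one>\<^bsub>DG\<^esub> \<in> ordered_subsequence_products DG gs"
      unfolding ordered_subsequence_products_def one_gen_dihedral
      by (intro CollectI exI[of _ ws]) auto
  qed
  have "enat (d + 2) = enat (d + 1) + 1"
    by (simp add: one_enat_def)
  also have "\<dots> \<le> small_davenport DG + 1"
    using lower by (rule add_right_mono)
  finally have "enat (d + 2) \<le> small_davenport DG + 1" .
  moreover have "small_davenport G + 2 = enat (d + 2)"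
    by (simp add: xs(2) d_def numeral_eq_enat)
  ultimately show "ordered_davenport DG = small_davenport DG + 1"
    "small_davenport DG + 1 = small_davenport G + 2"
    using middle upper by auto
qed

end


section \<open>Pairings on finite abelian groups\<close>

text \<open>With t the order of the product, raise x^t y^t = 1 to the power \<open>ord y\<close>:
  the second factor disappears, so \<open>ord x\<close> divides t times \<open>ord y\<close> and, by
  coprimality, t. The roles are then exchanged.\<close>

lemma (in comm_group) ord_mult_coprime:
  assumes "x \<in> carrier G" "y \<in> carrier G" "coprime (ord x) (ord y)"
  shows "ord x * ord y dvd ord (x \<otimes> y)"
proof (rule divides_mult)
  define t where "t = ord (x \<otimes> y)"
  have xy: "x [^] t \<otimes> y [^] t = \<one>"
    using assms unfolding t_def by (simp flip: pow_mult_distrib add: m_comm)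
  have "x [^] (t * ord y) \<otimes> y [^] (t * ord y) = (x [^] t \<otimes> y [^] t) [^] ord y"
    using assms(1,2) by (simp add: pow_mult_distrib m_comm nat_pow_pow)
  moreover have "y [^] (t * ord y) = \<one>"
    using assms(1,2) by (simp add: pow_eq_id)
  ultimately have "x [^] (t * ord y) = \<one>"
    using assms(1,2) xy by simp
  then have "ord x dvd t * ord y"
    using assms by (simp add: pow_eq_id)
  then show "ord x dvd ord (x \<otimes> y)"
    using assms(3) by (simp add: t_def coprime_dvd_mult_left_iff)
  have "x [^] (t * ord x) \<otimes> y [^] (t * ord x) = (x [^] t \<otimes> y [^] t) [^] ord x"
    using assms(1,2) by (simp add: pow_mult_distrib m_comm nat_pow_pow)
  moreover have "x [^] (t * ord x) = \<one>"
    using assms(1,2) by (simp add: pow_eq_id)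
  ultimately have "y [^] (t * ord x) = \<one>"
    using assms(1,2) xy by simp
  then have "ord y dvd t * ord x"
    using assms by (simp add: pow_eq_id)
  then show "ord y dvd ord (x \<otimes> y)"
    using assms(3) by (simp add: t_def coprime_dvd_mult_left_iff coprime_commute)
qed (use assms in simp)

text \<open>Take \<open>g\<close> of maximal order. If some prime power in \<open>ord x\<close>
  exceeded the one in \<open>ord g\<close>, the product of the p-part of \<open>x\<close> and the
  prime-to-p part of \<open>g\<close> would have larger order.\<close>

lemma (in comm_group) exponent_attained:
  assumes "finite (carrier G)"
  obtains g where "g \<in> carrier G" "\<And>x. x \<in> carrier G \<Longrightarrow> ord x dvd ord g"
proof -
  have pos: "ord x > 0" if "x \<in> carrier G" for x
    using ord_ge_1[OF assms that] by simp
  have "Max (ord ` carrier G) \<in> ord ` carrier G"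
    using assms by (intro Max_in) auto
  then obtain g where g: "g \<in> carrier G" "ord g = Max (ord ` carrier G)"
    by auto
  then have max: "ord x \<le> ord g" if "x \<in> carrier G" for x
    using assms that by simp
  show thesis
  proof (rule that[OF g(1)])
    fix x assume x: "x \<in> carrier G"
    show "ord x dvd ord g"
    proof (rule ccontr)
      assume "\<not> ord x dvd ord g"
      then obtain p where p: "prime p" "multiplicity p (ord g) < multiplicity p (ord x)"
        using multiplicity_le_imp_dvd[of "ord x" "ord g"] pos[OF x] by (metis not_gr0 not_le)
      define j k where "j = multiplicity p (ord g)" and "k = multiplicity p (ord x)"
      define m n where "m = ord x div p ^ k" and "n = ord g div p ^ j"
      have ord_x: "ord x = p ^ k * m" and ord_g: "ord g = p ^ j * n"
        by (simp_all add: m_def n_def j_def k_def multiplicity_dvd)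
      have "m \<noteq> 0" "n \<noteq> 0"
        using ord_x ord_g pos[OF x] pos[OF g(1)] by auto
      have "\<not> p dvd n"
        unfolding n_def j_def using pos[OF g(1)] p(1)
        by (intro multiplicity_decompose) (auto simp: prime_nat_iff)
      then have "coprime (p ^ k) n"
        using p(1) by (simp add: prime_imp_coprime)
      moreover have "ord (x [^] m) = p ^ k"
        using x ord_x \<open>m \<noteq> 0\<close> by (simp add: ord_pow)
      moreover have "ord (g [^] p ^ j) = n"
        using g(1) ord_g p(1) by (simp add: ord_pow prime_gt_0_nat)
      ultimately have "p ^ k * n dvd ord (x [^] m \<otimes> g [^] p ^ j)"
        using ord_mult_coprime[of "x [^] m" "g [^] p ^ j"] x g(1) by simp
      then have "p ^ k * n \<le> ord (x [^] m \<otimes> g [^] p ^ j)"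
        using pos x g(1) by (intro dvd_imp_le) auto
      also have "\<dots> \<le> p ^ j * n"
        using max[of "x [^] m \<otimes> g [^] p ^ j"] x g(1) ord_g by simp
      finally have "p ^ k \<le> p ^ j"
        using \<open>n \<noteq> 0\<close> by simp
      moreover have "p ^ j < p ^ k"
        using p prime_gt_1_nat by (simp add: j_def k_def)
      ultimately show False by simp
    qed
  qed
qed

section \<open>Roots of unity in an algebraically closed field\<close>

lemma degree_monom_diff_one: "n > 0 \<Longrightarrow> degree (monom 1 n - 1 :: 'b :: comm_ring_1 poly) = n"
  using degree_add_eq_left[of "- 1 :: 'b poly" "monom 1 n"] by (simp add: degree_monom_eq)

text \<open>The polynomial X^n - 1 splits, and a repeated root would be a zero of its derivative n
  X^(n-1). As n is nonzero in the field, that zero is 0, which is not a root of unity.\<close>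

lemma card_roots_of_unity:
  assumes "of_nat n \<noteq> (0 :: 'k :: alg_closed_field)"
  shows "card {z :: 'k :: alg_closed_field. z ^ n = 1} = n"
proof -
  define P :: "'k poly" where "P = monom 1 n - 1"
  have n: "n > 0"
    using assms by (cases n) auto
  have deg: "degree P = n"
    using n unfolding P_def by (rule degree_monom_diff_one)
  then have "P \<noteq> 0"
    using n by auto
  then obtain A c where A: "size A = n" "c \<noteq> 0" "P = smult c (\<Prod>x\<in>#A. [:-x, 1:])"
    using alg_closed_imp_factorization[of P] deg by (metis leading_coeff_0_iff)
  have roots: "poly P z = 0 \<longleftrightarrow> z ^ n = 1" for z
    by (simp add: P_def poly_monom)
  have "count A a \<le> 1" for a
  proof (rule ccontr)
    assume "\<not> count A a \<le> 1"
    then have "{#a, a#} \<subseteq># A"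
      by (intro mset_subset_eqI) auto
    then obtain B where "A = {#a, a#} + B"
      by (auto simp: subset_mset.le_iff_add)
    then have "P = smult c ([:-a, 1:] * ([:-a, 1:] * (\<Prod>x\<in>#B. [:-x, 1:])))"
      using A(3) by simp
    then obtain Q where Q: "P = [:-a, 1:] * ([:-a, 1:] * Q)"
      by (metis mult_smult_right)
    have deriv: "poly (pderiv (L * (L * Q))) a = 0" if "poly L a = 0" for L
      using that by (simp add: pderiv_mult)
    have "poly (pderiv P) a = 0"
      unfolding Q by (rule deriv) simp
    then have "of_nat n * a ^ (n - 1) = 0"
      by (simp add: P_def pderiv_diff pderiv_monom poly_monom)
    then have "a = 0"
      using assms by simp
    moreover have "poly P a = 0"
      by (simp add: Q)
    ultimately show False
      using n roots by (simp add: power_0_left)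
  qed
  then have count_le: "count A a \<le> 1" for a .
  have "A = mset_set (set_mset A)"
  proof (rule multiset_eqI)
    fix a
    show "count A a = count (mset_set (set_mset A)) a"
    proof (cases "a \<in># A")
      case True
      then have "count A a > 0" by simp
      with count_le[of a] have "count A a = 1" by linarith
      then show ?thesis using True by simp
    qed (simp add: not_in_iff)
  qed
  then have "card (set_mset A) = n"
    using A(1) by (metis size_mset_set)
  moreover have "set_mset A = {z. z ^ n = 1}"
  proof -
    have "poly P z = c * (\<Prod>x\<in>#A. z - x)" for z
      by (simp add: A(3) poly_prod_mset)
    then have "poly P z = 0 \<longleftrightarrow> z \<in># A" for z
      using A(2) by (auto simp: prod_mset_zero_iff)
    then show ?thesis
      using roots by auto
  qed
  ultimately show ?thesis by simp
qed

text \<open>Choose in the group of n-th roots of unity an element whose order m is a multiple of all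
  element orders. Then all n roots are zeros of X^m - 1, so n is at most m.\<close>

lemma primitive_root_of_unity:
  assumes "of_nat n \<noteq> (0 :: 'k :: alg_closed_field)"
  obtains z :: "'k :: alg_closed_field" where "\<And>t. z ^ t = 1 \<longleftrightarrow> n dvd t"
proof -
  define M :: "'k monoid" where "M = \<lparr>carrier = {z. z ^ n = 1}, monoid.mult = (*), one = 1\<rparr>"
  have n: "n > 0"
    using assms by (cases n) auto
  have nz: "z \<noteq> 0" if "z ^ n = 1" for z :: 'k
    using that n by (auto simp: zero_power)
  interpret M: comm_group M
  proof (rule comm_groupI)
    fix z assume "z \<in> carrier M"
    then show "\<exists>y\<in>carrier M. y \<otimes>\<^bsub>M\<^esub> z = \<one>\<^bsub>M\<^esub>"
      using nz by (intro bexI[of _ "inverse z"]) (auto simp: M_def power_inverse)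
  qed (auto simp: M_def power_mult_distrib)
  have pow: "z [^]\<^bsub>M\<^esub> t = z ^ t" for z and t :: nat
    by (induction t) (simp_all add: M_def)
  have card: "card (carrier M) = n"
    using card_roots_of_unity[OF assms] by (simp add: M_def)
  then have fin: "finite (carrier M)"
    using n by (metis card.infinite not_gr0)
  obtain g where g: "g \<in> carrier M" "\<And>x. x \<in> carrier M \<Longrightarrow> M.ord x dvd M.ord g"
    using M.exponent_attained[OF fin] by blast
  define m where "m = M.ord g"
  have "m > 0"
    using M.ord_ge_1[OF fin g(1)] by (simp add: m_def)
  have roots: "carrier M \<subseteq> {z. poly (monom 1 m - 1) z = 0}"
  proof
    fix z assume z: "z \<in> carrier M"
    then have "z [^]\<^bsub>M\<^esub> m = \<one>\<^bsub>M\<^esub>"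
      using g(2) by (simp add: M.pow_eq_id m_def)
    then show "z \<in> {z. poly (monom 1 m - 1) z = 0}"
      by (simp add: pow poly_monom) (simp add: M_def)
  qed
  have deg: "degree (monom 1 m - 1 :: 'k poly) = m"
    using \<open>m > 0\<close> by (rule degree_monom_diff_one)
  then have nz_poly: "monom 1 m - 1 \<noteq> (0 :: 'k poly)"
    using \<open>m > 0\<close> by (metis degree_0 less_irrefl)
  have "card (carrier M) \<le> card {z. poly (monom 1 m - 1 :: 'k poly) z = 0}"
    by (rule card_mono[OF poly_roots_finite[OF nz_poly] roots])
  also have "\<dots> \<le> m"
    using card_poly_roots_bound[OF nz_poly] deg by simp
  finally have "n \<le> m"
    by (simp add: card)
  moreover have "m dvd n"
    using M.ord_dvd_group_order[OF g(1)] card by (simp add: m_def Coset.order_def)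
  ultimately have "m = n"
    using n by (meson dvd_imp_le le_antisym)
  show thesis
  proof (rule that[of g])
    show "g ^ t = 1 \<longleftrightarrow> n dvd t" for t
      using M.pow_eq_id[OF g(1), of t] pow \<open>m = n\<close> by (simp add: m_def) (simp add: M_def)
  qed
qed

section \<open>Splitting off a cyclic factor of maximal order\<close>

lemma (in group) subgroup_nat_pow_closed:
  "subgroup H G \<Longrightarrow> a \<in> H \<Longrightarrow> a [^] (k :: nat) \<in> H"
  using subgroup_int_pow_closed[of H a "int k"] by (simp add: int_pow_int)

text \<open>Take \<open>B\<close> maximal among the subgroups that meet the cyclic group C of
  \<open>g\<close> trivially. If CB were proper, there would be x outside CB with x^p in CB for a
  prime p. As \<open>ord g\<close> is a multiple of all orders, x can be corrected by a power of
  \<open>g\<close> to some y with y^p in \<open>B\<close>, and adjoining y to \<open>B\<close>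
  contradicts maximality.\<close>

lemma (in comm_group) cyclic_complement:
  assumes "finite (carrier G)" "g \<in> carrier G" "\<And>x. x \<in> carrier G \<Longrightarrow> ord x dvd ord g"
  obtains B where "subgroup B G" "generate G {g} \<inter> B = {\<one>}" "generate G {g} <#> B = carrier G"
proof -
  define C where "C = generate G {g}"
  have C: "subgroup C G"
    unfolding C_def using assms(2) by (intro generate_is_subgroup) auto
  have C_eq: "C = range (\<lambda>k :: int. g [^] k)"
    unfolding C_def by (subst generate_pow[OF assms(2)]) auto
  define F where "F = {B. subgroup B G \<and> C \<inter> B = {\<one>}}"
  have "F \<subseteq> Pow (carrier G)"
    by (auto simp: F_def dest: subgroup.mem_carrier)
  then have "finite F"
    using assms(1) finite_subset by blast
  moreover have "{\<one>} \<in> F"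
    using C by (auto simp: F_def triv_subgroup subgroup.one_closed)
  ultimately obtain B where B: "B \<in> F" "\<And>B'. B' \<in> F \<Longrightarrow> B \<subseteq> B' \<Longrightarrow> B = B'"
    using finite_has_maximal[of F] by blast
  have sub_B: "subgroup B G" and C_B: "C \<inter> B = {\<one>}"
    using B by (auto simp: F_def)
  define E where "E = C <#> B"
  have E: "subgroup E G"
    unfolding E_def using C sub_B by (rule mult_subgroups)
  have C_E: "C \<subseteq> E" and B_E: "B \<subseteq> E"
    using subgroup.one_closed[OF C] subgroup.one_closed[OF sub_B]
      subgroup.mem_carrier[OF C] subgroup.mem_carrier[OF sub_B]
    by (force simp: E_def set_mult_def)+
  have pow_E: "a [^] (i :: int) \<in> E" if "a \<in> E" for a i
    using subgroup_int_pow_closed[OF E that] .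
  have "carrier G \<subseteq> E"
  proof
    fix x0 assume x0: "x0 \<in> carrier G"
    show "x0 \<in> E"
    proof (rule ccontr)
      assume "x0 \<notin> E"
      \<comment> \<open>\<open>n\<close> is the order of \<open>x0\<close> modulo \<open>E\<close>.
        The power \<open>n div p\<close> produces an element \<open>x\<close> whose order modulo
        \<open>E\<close> is the prime \<open>p\<close>.\<close>
      define n where "n = (LEAST n. n > 0 \<and> x0 [^] (n :: nat) \<in> E)"
      have ord_x0: "ord x0 > 0" "x0 [^] ord x0 \<in> E"
        using ord_ge_1[OF assms(1) x0] x0 subgroup.one_closed[OF E] by auto
      have n: "n > 0" "x0 [^] n \<in> E"
        using LeastI[of "\<lambda>n. n > 0 \<and> x0 [^] n \<in> E" "ord x0"] ord_x0 unfolding n_def by auto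
      have least: "x0 [^] m \<notin> E" if "0 < m" "m < n" for m
        using not_less_Least[of m "\<lambda>n. n > 0 \<and> x0 [^] n \<in> E"] that unfolding n_def by auto
      have dvd: "n dvd m" if m: "x0 [^] m \<in> E" for m :: nat
      proof -
        have "x0 [^] m = x0 [^] (m mod n) \<otimes> (x0 [^] n) [^] (m div n)"
          using x0 by (simp add: nat_pow_pow nat_pow_mult)
        then have "x0 [^] (m mod n) = x0 [^] m \<otimes> inv ((x0 [^] n) [^] (m div n))"
          using x0 by (simp add: inv_solve_right)
        moreover have "\<dots> \<in> E"
          using subgroup.m_closed[OF E m subgroup.m_inv_closed[OF E subgroup_nat_pow_closed[OF E n(2)]]] .
        ultimately show ?thesis
          using least[of "m mod n"] n(1) by (metis mod_less_divisor mod_greater_zero_iff_not_dvd)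
      qed
      have "n \<noteq> 1"
        using n(2) x0 \<open>x0 \<notin> E\<close> by auto
      then obtain p where p: "prime p" "p dvd n"
        using prime_factor_nat by blast
      define x where "x = x0 [^] (n div p)"
      have x: "x \<in> carrier G"
        using x0 by (simp add: x_def)
      have "x [^] p \<in> E"
        using n(2) p x0 by (simp add: x_def nat_pow_pow)
      have "x \<notin> E"
        unfolding x_def using n(1) p prime_gt_1_nat[OF p(1)]
        by (intro least) (auto simp: div_greater_zero_iff dvd_imp_le)
      define N where "N = ord g"
      have "N > 0"
        using ord_ge_1[OF assms(1,2)] by (simp add: N_def)
      have pow_N: "y [^] N = \<one>" if "y \<in> carrier G" for y
        using assms(3)[OF that] that by (simp add: N_def pow_eq_id)
      have "n dvd N"
        using dvd pow_N[OF x0] subgroup.one_closed[OF E] by simp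
      with p have "p dvd N"
        by auto
      obtain k :: int and b where kb: "x [^] p = g [^] k \<otimes> b" "b \<in> B"
        using \<open>x [^] p \<in> E\<close> by (auto simp: E_def set_mult_def C_eq)
      have b: "b \<in> carrier G"
        using subgroup.mem_carrier[OF sub_B kb(2)] .
      \<comment> \<open>All orders divide \<open>N = p * q\<close>, so raising
        \<open>x [^] p = g [^] k \<otimes> b\<close> to the power \<open>q\<close> gives the
        identity. This puts \<open>g [^] (k * int q)\<close> into the trivial group
        \<open>C \<inter> B\<close> and forces \<open>p\<close> to divide \<open>k\<close>.\<close>
      define q where "q = N div p"
      have N_eq: "N = p * q"
        using \<open>p dvd N\<close> by (simp add: q_def)
      have "\<one> = (x [^] p) [^] q"
        using pow_N[OF x] x by (simp add: nat_pow_pow N_eq)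
      also have "\<dots> = g [^] (k * int q) \<otimes> b [^] q"
      proof -
        have "(g [^] k \<otimes> b) [^] q = (g [^] k) [^] q \<otimes> b [^] q"
          using b assms(2) by (intro pow_mult_distrib) (simp_all add: m_comm)
        moreover have "(g [^] k) [^] q = g [^] (k * int q)"
          using int_pow_pow[OF assms(2), of k "int q"] by (simp add: int_pow_int)
        ultimately show ?thesis by (simp add: kb)
      qed
      finally have "g [^] (k * int q) = inv (b [^] q)"
        using b assms(2) by (intro inv_equality[symmetric]) auto
      then have "g [^] (k * int q) \<in> C \<inter> B"
      proof (intro IntI)
        show "g [^] (k * int q) \<in> C"
          by (simp add: C_eq)
        assume eq: "g [^] (k * int q) = inv (b [^] q)"
        show "g [^] (k * int q) \<in> B"
          unfolding eq using kb(2) sub_B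
          by (intro subgroup.m_inv_closed subgroup_nat_pow_closed)
      qed
      then have "g [^] (k * int q) = \<one>"
        by (simp add: C_B)
      then have "int (p * q) dvd k * int q"
        using assms(2) N_eq by (simp add: int_pow_eq_id N_def)
      then have "int p dvd k"
        using N_eq \<open>N > 0\<close> by auto
      then obtain l where l: "k = int p * l"
        by auto
      define y where "y = x \<otimes> inv (g [^] l)"
      have y: "y \<in> carrier G"
        using x assms(2) by (simp add: y_def)
      have "y [^] p = x [^] p \<otimes> inv (g [^] k)"
      proof -
        have "y [^] p = x [^] p \<otimes> inv (g [^] l) [^] p"
          unfolding y_def using x assms(2) by (intro pow_mult_distrib) (simp_all add: m_comm)
        moreover have "(g [^] l) [^] p = g [^] k"
          using int_pow_pow[OF assms(2), of l "int p"] l by (simp add: int_pow_int mult.commute)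
        ultimately show ?thesis
          using assms(2) by (simp add: nat_pow_inv)
      qed
      then have y_p: "y [^] p = b"
        using b assms(2) by (simp add: kb m_comm[of "g [^] k" b] m_assoc)
      have "y \<notin> E"
      proof
        assume "y \<in> E"
        moreover have "g [^] l \<in> E"
          using C_E C_eq by auto
        ultimately have "y \<otimes> g [^] l \<in> E"
          using E by (simp add: subgroup.m_closed)
        then show False
          using \<open>x \<notin> E\<close> x assms(2) by (simp add: y_def m_assoc)
      qed
      define Y where "Y = generate G {y}"
      have Y: "subgroup Y G"
        unfolding Y_def using y by (intro generate_is_subgroup) auto
      have Y_eq: "Y = range (\<lambda>k :: int. y [^] k)"
        unfolding Y_def by (subst generate_pow[OF y]) auto
      define B' where "B' = Y <#> B"
      have B': "subgroup B' G"
        unfolding B'_def using Y sub_B by (rule mult_subgroups)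
      \<comment> \<open>If y^j b' lies in \<open>C\<close>, then y^j lies in \<open>E\<close>. Were
        j prime to p, Bezout together with y^p = b would put \<open>y\<close> itself into
        \<open>E\<close>. Hence p divides j, y^j is a power of \<open>b\<close>, and the element
        lies in \<open>C \<inter> B\<close>.\<close>
      have "C \<inter> B' \<subseteq> {\<one>}"
      proof
        fix w assume w: "w \<in> C \<inter> B'"
        then obtain j :: int and b' where jb: "w = y [^] j \<otimes> b'" "b' \<in> B"
          by (auto simp: B'_def set_mult_def Y_eq)
        have b': "b' \<in> carrier G"
          using subgroup.mem_carrier[OF sub_B jb(2)] .
        have "y [^] j = w \<otimes> inv b'"
          using jb y b' by (simp add: m_assoc)
        moreover have "w \<in> E" "b' \<in> E"
          using w C_E B_E jb(2) by auto
        ultimately have y_j: "y [^] j \<in> E"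
          using E by (simp add: subgroup.m_closed subgroup.m_inv_closed)
        have "int p dvd j"
        proof (rule ccontr)
          assume "\<not> int p dvd j"
          then have "coprime (int p) j"
            using p(1) by (simp add: prime_imp_coprime)
          then obtain u v where uv: "u * int p + v * j = 1"
            using coprime_iff_gcd_eq_1 bezout_int by (metis)
          have "y [^] int p \<in> E"
            using y_p kb(2) B_E by (auto simp: int_pow_int)
          then have "(y [^] int p) [^] u \<otimes> (y [^] j) [^] v \<in> E"
            using subgroup.m_closed[OF E pow_E pow_E[OF y_j]] by blast
          also have "(y [^] int p) [^] u \<otimes> (y [^] j) [^] v = y [^] (u * int p + v * j)"
            by (simp only: int_pow_pow[OF y] int_pow_mult[OF y] mult.commute[of "int p" u]
              mult.commute[of j v])
          finally show False
            using uv y \<open>y \<notin> E\<close> by (simp add: int_pow_1)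
        qed
        then obtain i where "j = int p * i" by auto
        then have "y [^] j = b [^] i"
          using y y_p by (metis int_pow_int int_pow_pow)
        then have "w \<in> B"
          using jb kb(2) sub_B by (simp add: subgroup.m_closed subgroup_int_pow_closed)
        with w C_B show "w \<in> {\<one>}" by blast
      qed
      then have "B' \<in> F"
        using C B' by (auto simp: F_def subgroup.one_closed)
      moreover have "B \<subseteq> B'"
        using subgroup.one_closed[OF Y] subgroup.mem_carrier[OF sub_B]
        by (force simp: B'_def set_mult_def)
      ultimately have "B = B'"
        by (rule B(2))
      moreover have "y \<in> B'"
      proof -
        have "y [^] (1 :: int) \<otimes> \<one> \<in> B'"
          unfolding B'_def set_mult_def Y_eq using subgroup.one_closed[OF sub_B] by blast
        then show ?thesis
          using y by (simp add: int_pow_1)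
      qed
      ultimately show False
        using \<open>y \<notin> E\<close> B_E by blast
    qed
  qed
  moreover have "E \<subseteq> carrier G"
    using E subgroup.subset by blast
  ultimately show thesis
    using that[OF sub_B] C_B by (simp add: C_def E_def)
qed

text \<open>Pairings make \<open>A\<close> and its character group isomorphic, in a form that needs no character
  group.\<close>

definition perfect_pairing :: "('a, 'm) monoid_scheme \<Rightarrow> ('a \<Rightarrow> 'a \<Rightarrow> 'k :: field) \<Rightarrow> bool" where
  "perfect_pairing A \<beta> \<longleftrightarrow>
    (\<forall>x\<in>carrier A. \<forall>y\<in>carrier A. \<forall>z\<in>carrier A. \<beta> (x \<otimes>\<^bsub>A\<^esub> y) z = \<beta> x z * \<beta> y z) \<and>
    (\<forall>x\<in>carrier A. \<forall>y\<in>carrier A. \<beta> x y = \<beta> y x \<and> \<beta> x y \<noteq> 0) \<and>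
    (\<forall>x\<in>carrier A. x \<noteq> \<one>\<^bsub>A\<^esub> \<longrightarrow> (\<exists>y\<in>carrier A. \<beta> x y \<noteq> 1))"

section \<open>Existence and calculus of perfect pairings\<close>

text \<open>Induction on the order. Split the group into a cyclic factor generated by
  \<open>g\<close>, whose order \<open>N\<close> is the exponent, and a complement \<open>B\<close>.
  Exponents of \<open>g\<close> are paired through a primitive \<open>N\<close>-th root of unity,
  components in \<open>B\<close> by the induction hypothesis, and the two values are
  multiplied.\<close>

lemma perfect_pairing_exists:
  fixes A :: "('a, 'm) monoid_scheme"
  assumes "comm_group A" "finite (carrier A)" "of_nat (order A) \<noteq> (0 :: 'k :: alg_closed_field)"
  shows "\<exists>\<beta> :: 'a \<Rightarrow> 'a \<Rightarrow> 'k :: alg_closed_field. perfect_pairing A \<beta>"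
  using assms
proof (induction "order A" arbitrary: A rule: less_induct)
  case less
  interpret comm_group A by fact
  note fin = less.prems(2)
  obtain g where g: "g \<in> carrier A" "\<And>x. x \<in> carrier A \<Longrightarrow> ord x dvd ord g"
    using exponent_attained[OF fin] by blast
  define N where "N = ord g"
  show ?case
  proof (cases "g = \<one>\<^bsub>A\<^esub>")
    case True
    then have "x = \<one>\<^bsub>A\<^esub>" if "x \<in> carrier A" for x
      using g(2)[OF that] ord_eq_1[OF that] by simp
    then show ?thesis
      by (intro exI[of _ "\<lambda>_ _. 1"]) (auto simp: perfect_pairing_def)
  next
    case False
    obtain B where B: "subgroup B A" "generate A {g} \<inter> B = {\<one>\<^bsub>A\<^esub>}" "generate A {g} <#>\<^bsub>A\<^esub> B = carrier A"
      using cyclic_complement[OF fin g] by blast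
    interpret B: subgroup B A by fact
    have gen: "generate A {g} = range (\<lambda>k :: int. g [^]\<^bsub>A\<^esub> k)"
      by (subst generate_pow[OF g(1)]) auto
    have "N > 0"
      using ord_ge_1[OF fin g(1)] by (simp add: N_def)
    have "\<exists>k :: nat. \<exists>b\<in>B. x = g [^]\<^bsub>A\<^esub> k \<otimes>\<^bsub>A\<^esub> b" if x: "x \<in> carrier A" for x
    proof -
      obtain k :: int and b where "x = g [^]\<^bsub>A\<^esub> k \<otimes>\<^bsub>A\<^esub> b" "b \<in> B"
        using x unfolding B(3)[symmetric] by (auto simp: set_mult_def gen)
      moreover have "g [^]\<^bsub>A\<^esub> k = g [^]\<^bsub>A\<^esub> nat (k mod int N)"
        using \<open>N > 0\<close> g(1) by (simp add: int_pow_eq N_def flip: int_pow_int)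
          (metis dvd_minus_mod minus_diff_eq dvd_minus_iff)
      ultimately show ?thesis by metis
    qed
    \<comment> \<open>\<open>e x\<close> is an arbitrary choice among exponents congruent modulo
      \<open>N\<close>. It enters only through powers of \<open>\<zeta>\<close>, and
      \<open>\<zeta>_cong\<close> makes these independent of the choice.\<close>
    then obtain e b where eb: "\<And>x. x \<in> carrier A \<Longrightarrow> b x \<in> B \<and> x = g [^]\<^bsub>A\<^esub> (e x :: nat) \<otimes>\<^bsub>A\<^esub> b x"
      by metis
    have unique: "g [^]\<^bsub>A\<^esub> i = g [^]\<^bsub>A\<^esub> j \<and> c = d"
      if "g [^]\<^bsub>A\<^esub> i \<otimes>\<^bsub>A\<^esub> c = g [^]\<^bsub>A\<^esub> j \<otimes>\<^bsub>A\<^esub> d" "c \<in> B" "d \<in> B" for i j :: nat and c d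
    proof -
      have cd: "c \<in> carrier A" "d \<in> carrier A"
        using that by auto
      have "inv\<^bsub>A\<^esub> (g [^]\<^bsub>A\<^esub> j) \<otimes>\<^bsub>A\<^esub> g [^]\<^bsub>A\<^esub> i = d \<otimes>\<^bsub>A\<^esub> inv\<^bsub>A\<^esub> c"
        using that(1) cd g(1)
        by (metis inv_closed inv_solve_left inv_solve_right m_assoc m_closed nat_pow_closed)
      moreover have "inv\<^bsub>A\<^esub> (g [^]\<^bsub>A\<^esub> j) \<otimes>\<^bsub>A\<^esub> g [^]\<^bsub>A\<^esub> i = g [^]\<^bsub>A\<^esub> (int i - int j)"
        using g(1) by (simp add: int_pow_diff int_pow_int m_comm)
      ultimately have "d \<otimes>\<^bsub>A\<^esub> inv\<^bsub>A\<^esub> c \<in> generate A {g} \<inter> B"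
        using that rangeI[of "\<lambda>k :: int. g [^]\<^bsub>A\<^esub> k" "int i - int j"]
        by (simp add: gen)
      then have "d \<otimes>\<^bsub>A\<^esub> inv\<^bsub>A\<^esub> c = \<one>\<^bsub>A\<^esub>"
        using B(2) by blast
      then have "d = c"
        using cd by (metis inv_equality inv_inv inv_closed)
      then show ?thesis
        using that(1) cd g(1) by simp
    qed
    have "N dvd order A"
      using ord_dvd_group_order[OF g(1)] by (simp add: N_def)
    then have "of_nat N \<noteq> (0 :: 'k)"
      using less.prems(3) by (metis dvd_def mult_zero_left of_nat_mult)
    then obtain \<zeta> :: 'k where \<zeta>: "\<And>t. \<zeta> ^ t = 1 \<longleftrightarrow> N dvd t"
      using primitive_root_of_unity by blast
    have "\<zeta> \<noteq> 0"
      using \<zeta>[of N] \<open>N > 0\<close> by (auto simp: zero_power)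
    have \<zeta>_cong: "\<zeta> ^ i = \<zeta> ^ j" if eq: "g [^]\<^bsub>A\<^esub> i = g [^]\<^bsub>A\<^esub> j" for i j :: nat
    proof -
      have "int N dvd int j - int i"
        using eq g(1) by (simp add: int_pow_eq N_def flip: int_pow_int)
      then have "int j mod int N = int i mod int N"
        by (simp add: mod_eq_dvd_iff)
      then have "i mod N = j mod N"
        by (simp flip: zmod_int)
      moreover have "\<zeta> ^ t = \<zeta> ^ (t mod N)" for t
      proof -
        have "\<zeta> ^ t = \<zeta> ^ (N * (t div N)) * \<zeta> ^ (t mod N)"
          by (simp flip: power_add)
        also have "\<zeta> ^ (N * (t div N)) = 1"
          by (simp add: \<zeta>)
        finally show ?thesis by simp
      qed
      ultimately show ?thesis by metis
    qed
    define B' where "B' = A\<lparr>carrier := B\<rparr>"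
    have "comm_group B'"
      unfolding B'_def using subgroup_imp_group[OF B(1)]
      by (rule group.group_comm_groupI) (auto simp: m_comm)
    moreover have "finite (carrier B')"
      using fin B.subset by (auto simp: B'_def intro: finite_subset)
    moreover have "order B' < order A"
    proof -
      have "g \<in> generate A {g}"
        by (rule generate.incl) simp
      then have "g \<notin> B"
        using B(2) False by blast
      then show ?thesis
        using g(1) fin B.subset by (auto simp: B'_def Coset.order_def intro!: psubset_card_mono)
    qed
    moreover have "order B' dvd order A"
    proof -
      have "order B' = card B"
        by (simp add: B'_def Coset.order_def)
      then show ?thesis
        using dvd_triv_right[of "card B" "card (rcosets\<^bsub>A\<^esub> B)"] by (simp add: lagrange[OF B(1)])
    qed
    then have "of_nat (order B') \<noteq> (0 :: 'k)"
      using less.prems(3) by (metis dvd_def mult_zero_left of_nat_mult)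
    ultimately obtain \<gamma> :: "'a \<Rightarrow> 'a \<Rightarrow> 'k" where "perfect_pairing B' \<gamma>"
      using less.hyps[of B'] by blast
    then have mult: "\<And>x y z. x \<in> B \<Longrightarrow> y \<in> B \<Longrightarrow> z \<in> B \<Longrightarrow> \<gamma> (x \<otimes>\<^bsub>A\<^esub> y) z = \<gamma> x z * \<gamma> y z"
      and sym: "\<And>x y. x \<in> B \<Longrightarrow> y \<in> B \<Longrightarrow> \<gamma> x y = \<gamma> y x"
      and nz: "\<And>x y. x \<in> B \<Longrightarrow> y \<in> B \<Longrightarrow> \<gamma> x y \<noteq> 0"
      and nondeg: "\<And>x. x \<in> B \<Longrightarrow> x \<noteq> \<one>\<^bsub>A\<^esub> \<Longrightarrow> \<exists>y\<in>B. \<gamma> x y \<noteq> 1"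
      unfolding perfect_pairing_def B'_def by auto
    define \<beta> where "\<beta> x y = \<zeta> ^ (e x * e y) * \<gamma> (b x) (b y)" for x y
    have \<beta>_mult: "\<beta> (x \<otimes>\<^bsub>A\<^esub> y) z = \<beta> x z * \<beta> y z"
      if xyz: "x \<in> carrier A" "y \<in> carrier A" "z \<in> carrier A" for x y z
    proof -
      have [simp]: "b x \<in> carrier A" "b y \<in> carrier A"
        using eb xyz by auto
      have "g [^]\<^bsub>A\<^esub> e (x \<otimes>\<^bsub>A\<^esub> y) \<otimes>\<^bsub>A\<^esub> b (x \<otimes>\<^bsub>A\<^esub> y) =
          (g [^]\<^bsub>A\<^esub> e x \<otimes>\<^bsub>A\<^esub> b x) \<otimes>\<^bsub>A\<^esub> (g [^]\<^bsub>A\<^esub> e y \<otimes>\<^bsub>A\<^esub> b y)"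
        using eb[of x] eb[of y] eb[of "x \<otimes>\<^bsub>A\<^esub> y"] xyz by simp
      also have "\<dots> = g [^]\<^bsub>A\<^esub> (e x + e y) \<otimes>\<^bsub>A\<^esub> (b x \<otimes>\<^bsub>A\<^esub> b y)"
        using g(1) by (simp add: m_assoc m_lcomm flip: nat_pow_mult)
      finally have *: "g [^]\<^bsub>A\<^esub> e (x \<otimes>\<^bsub>A\<^esub> y) = g [^]\<^bsub>A\<^esub> (e x + e y) \<and> b (x \<otimes>\<^bsub>A\<^esub> y) = b x \<otimes>\<^bsub>A\<^esub> b y"
        by (rule unique) (use eb[of "x \<otimes>\<^bsub>A\<^esub> y"] eb[of x] eb[of y] xyz in auto)
      then have "\<zeta> ^ e (x \<otimes>\<^bsub>A\<^esub> y) = \<zeta> ^ (e x + e y)"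
        using \<zeta>_cong by blast
      then show ?thesis
        using * mult eb xyz by (simp add: \<beta>_def power_mult power_add power_mult_distrib)
    qed
    have \<beta>_sym: "\<beta> x y = \<beta> y x" and \<beta>_nonzero: "\<beta> x y \<noteq> 0" if "x \<in> carrier A" "y \<in> carrier A" for x y
      using that eb sym nz \<open>\<zeta> \<noteq> 0\<close> by (simp_all add: \<beta>_def mult.commute)
    \<comment> \<open>If the component of \<open>x\<close> in \<open>B\<close> is nontrivial, the
      induction hypothesis provides a partner in \<open>B\<close>, for which the power of
      \<open>\<zeta>\<close> is 1. Otherwise \<open>x\<close> is a power of \<open>g\<close> with
      exponent not divisible by \<open>N\<close>, and \<open>g\<close> itself detects it.\<close>
    have \<beta>_nondegenerate: "\<exists>y\<in>carrier A. \<beta> x y \<noteq> 1" if x: "x \<in> carrier A" "x \<noteq> \<one>\<^bsub>A\<^esub>" for x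
    proof (cases "b x = \<one>\<^bsub>A\<^esub>")
      case False
      then obtain y where y: "y \<in> B" "\<gamma> (b x) y \<noteq> 1"
        using nondeg eb x by blast
      have "g [^]\<^bsub>A\<^esub> e y \<otimes>\<^bsub>A\<^esub> b y = g [^]\<^bsub>A\<^esub> (0 :: nat) \<otimes>\<^bsub>A\<^esub> y"
        using eb[of y] y(1) by simp
      then have *: "g [^]\<^bsub>A\<^esub> e y = g [^]\<^bsub>A\<^esub> (0 :: nat) \<and> b y = y"
        using eb[of y] y(1) by (intro unique) auto
      then have "\<zeta> ^ e y = 1"
        using \<zeta>_cong[of "e y" 0] by simp
      then have "\<beta> x y = \<gamma> (b x) y"
        using * by (simp add: \<beta>_def power_mult mult.commute[of "e x"])
      with y show ?thesis
        by (intro bexI[of _ y]) auto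
    next
      case True
      then have "x = g [^]\<^bsub>A\<^esub> e x"
        using eb[OF x(1)] g(1) by simp
      then have "\<not> N dvd e x"
        using x(2) g(1) by (metis N_def pow_eq_id)
      have "g [^]\<^bsub>A\<^esub> e g \<otimes>\<^bsub>A\<^esub> b g = g [^]\<^bsub>A\<^esub> (1 :: nat) \<otimes>\<^bsub>A\<^esub> \<one>\<^bsub>A\<^esub>"
        using eb[OF g(1)] g(1) by simp
      then have *: "g [^]\<^bsub>A\<^esub> e g = g [^]\<^bsub>A\<^esub> (1 :: nat) \<and> b g = \<one>\<^bsub>A\<^esub>"
        using eb[OF g(1)] by (intro unique) auto
      then have "\<zeta> ^ e g = \<zeta>"
        using \<zeta>_cong[of "e g" 1] by simp
      moreover have "\<gamma> \<one>\<^bsub>A\<^esub> \<one>\<^bsub>A\<^esub> = 1"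
        using mult[of "\<one>\<^bsub>A\<^esub>" "\<one>\<^bsub>A\<^esub>" "\<one>\<^bsub>A\<^esub>"] nz[of "\<one>\<^bsub>A\<^esub>" "\<one>\<^bsub>A\<^esub>"] by simp
      ultimately have "\<beta> x g = \<zeta> ^ e x"
        using * True by (simp add: \<beta>_def power_mult mult.commute[of "e x"])
      then show ?thesis
        using \<open>\<not> N dvd e x\<close> \<zeta> g(1) by (intro bexI[of _ g]) auto
    qed
    show ?thesis
      unfolding perfect_pairing_def
      by (intro exI[of _ \<beta>] conjI ballI impI)
        (simp_all add: \<beta>_mult \<beta>_nonzero \<beta>_nondegenerate, rule \<beta>_sym)
  qed
qed

context
  fixes A :: "('a, 'm) monoid_scheme" (structure) and \<beta> :: "'a \<Rightarrow> 'a \<Rightarrow> 'k :: field"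
  assumes comm_group: "comm_group A" and pairing: "perfect_pairing A \<beta>"
begin

interpretation comm_group A by (rule comm_group)

lemma perfect_pairing_mult:
  "x \<in> carrier A \<Longrightarrow> y \<in> carrier A \<Longrightarrow> z \<in> carrier A \<Longrightarrow> \<beta> (x \<otimes> y) z = \<beta> x z * \<beta> y z"
  using pairing unfolding perfect_pairing_def by blast

lemma perfect_pairing_sym: "x \<in> carrier A \<Longrightarrow> y \<in> carrier A \<Longrightarrow> \<beta> x y = \<beta> y x"
  using pairing unfolding perfect_pairing_def by blast

lemma perfect_pairing_mult_right:
  "x \<in> carrier A \<Longrightarrow> y \<in> carrier A \<Longrightarrow> z \<in> carrier A \<Longrightarrow> \<beta> x (y \<otimes> z) = \<beta> x y * \<beta> x z"
  by (metis m_closed perfect_pairing_mult perfect_pairing_sym)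

lemma perfect_pairing_nonzero: "x \<in> carrier A \<Longrightarrow> y \<in> carrier A \<Longrightarrow> \<beta> x y \<noteq> 0"
  using pairing unfolding perfect_pairing_def by blast

lemma perfect_pairing_nondegenerate:
  assumes "x \<in> carrier A" "x \<noteq> \<one>"
  obtains y where "y \<in> carrier A" "\<beta> x y \<noteq> 1"
  using pairing assms unfolding perfect_pairing_def by blast

lemma perfect_pairing_one: "y \<in> carrier A \<Longrightarrow> \<beta> \<one> y = 1"
  using perfect_pairing_mult[of \<one> \<one> y] perfect_pairing_nonzero[of \<one> y] by simp

lemma perfect_pairing_one_right: "x \<in> carrier A \<Longrightarrow> \<beta> x \<one> = 1"
  using perfect_pairing_one[of x] perfect_pairing_sym[of x \<one>] by simp

lemma perfect_pairing_finprod: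
  assumes "y \<in> carrier A" "finite U" "c \<in> U \<rightarrow> carrier A"
  shows "\<beta> (finprod A c U) y = (\<Prod>t\<in>U. \<beta> (c t) y)"
  using assms(2,3)
proof (induction U rule: finite_induct)
  case empty
  then show ?case using assms(1) by (simp add: perfect_pairing_one)
next
  case (insert t U)
  then have "finprod A c U \<in> carrier A" "c t \<in> carrier A" "c \<in> U \<rightarrow> carrier A"
    by (auto intro: finprod_closed)
  with insert show ?case
    using assms(1) by (simp add: perfect_pairing_mult)
qed

text \<open>This is how the reflection comes to carry weight \<open>c\<close> to weight
  \<open>inv c\<close>: it conjugates a rotation to its inverse, and the inversion moves across the
  pairing.\<close>

lemma perfect_pairing_inv:
  assumes "x \<in> carrier A" "y \<in> carrier A"
  shows "\<beta> (inv x) y = \<beta> x (inv y)"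
proof -
  have "\<beta> (inv x) y * \<beta> x y = 1"
    using assms perfect_pairing_mult[of "inv x" x y] by (simp add: perfect_pairing_one)
  moreover have "\<beta> x (inv y) * \<beta> x y = 1"
    using assms perfect_pairing_mult_right[of x "inv y" y] by (simp add: perfect_pairing_one_right)
  ultimately show ?thesis
    using perfect_pairing_nonzero[OF assms] by (metis mult_right_cancel)
qed

text \<open>Translating the summation variable by \<open>y\<close> multiplies the sum by
  \<open>\<beta> y a\<close>. For \<open>a\<close> other than the identity, nondegeneracy and
  symmetry supply a \<open>y\<close> for which this factor is not 1.\<close>

lemma perfect_pairing_orthogonality:
  assumes "a \<in> carrier A"
  shows "(\<Sum>c\<in>carrier A. \<beta> c a) = (if a = \<one> then of_nat (order A) else 0)"
proof (cases "a = \<one>")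
  case True
  then show ?thesis
    by (simp add: Coset.order_def perfect_pairing_one_right)
next
  case False
  then obtain y where y: "y \<in> carrier A" "\<beta> a y \<noteq> 1"
    using perfect_pairing_nondegenerate assms by blast
  have "\<beta> y a * (\<Sum>c\<in>carrier A. \<beta> c a) = (\<Sum>c\<in>carrier A. \<beta> (y \<otimes> c) a)"
    using y assms by (simp add: sum_distrib_left perfect_pairing_mult)
  also have "\<dots> = (\<Sum>c\<in>carrier A. \<beta> c a)"
    using y by (intro sum.reindex_bij_witness[of _ "\<lambda>c. inv y \<otimes> c" "\<lambda>c. y \<otimes> c"])
      (simp_all add: m_assoc[symmetric])
  finally have "(\<beta> y a - 1) * (\<Sum>c\<in>carrier A. \<beta> c a) = 0"
    by (simp add: left_diff_distrib)
  then show ?thesis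
    using y assms False perfect_pairing_sym[of a y] by simp
qed

end


section \<open>Polynomial rings and linear substitutions\<close>

text \<open>Supports change under addition and may shrink by cancellation; over a common finite
  superset the sums can be added term by term.\<close>

lemma sum_keys_superset:
  assumes "finite S" "Poly_Mapping.keys f \<subseteq> S" "\<And>m. h m 0 = 0"
  shows "(\<Sum>m\<in>Poly_Mapping.keys f. h m (Poly_Mapping.lookup f m)) = (\<Sum>m\<in>S. h m (Poly_Mapping.lookup f m))"
  using assms by (intro sum.mono_neutral_left) (auto simp: in_keys_iff)

lemma prod_keys_superset:
  assumes "finite S" "Poly_Mapping.keys f \<subseteq> S" "\<And>m. h m 0 = 1"
  shows "(\<Prod>m\<in>Poly_Mapping.keys f. h m (Poly_Mapping.lookup f m)) = (\<Prod>m\<in>S. h m (Poly_Mapping.lookup f m))"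
  using assms by (intro prod.mono_neutral_left) (auto simp: in_keys_iff)

lemma poly_mapping_sum_singles:
  fixes f :: "'a \<Rightarrow>\<^sub>0 'b :: comm_monoid_add"
  shows "(\<Sum>m\<in>Poly_Mapping.keys f. Poly_Mapping.single m (Poly_Mapping.lookup f m)) = f"
proof (rule poly_mapping_eqI)
  fix k
  have "(\<Sum>m\<in>Poly_Mapping.keys f. Poly_Mapping.lookup (Poly_Mapping.single m (Poly_Mapping.lookup f m)) k)
      = (\<Sum>m\<in>Poly_Mapping.keys f. if m = k then Poly_Mapping.lookup f m else 0)"
    by (intro sum.cong) (auto simp: lookup_single)
  also have "\<dots> = Poly_Mapping.lookup f k"
    by (auto simp: in_keys_iff)
  finally show "Poly_Mapping.lookup
      (\<Sum>m\<in>Poly_Mapping.keys f. Poly_Mapping.single m (Poly_Mapping.lookup f m)) k = Poly_Mapping.lookup f k"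
    by (simp add: lookup_sum)
qed

text \<open>Used on two levels: for polynomials, whose singles are monomials with a coefficient, and
  for exponent functions, whose singles are powers of one variable.\<close>

lemma poly_mapping_singles_induct [case_names single add]:
  fixes f :: "'a \<Rightarrow>\<^sub>0 'b :: comm_monoid_add"
  assumes "\<And>m a. P (Poly_Mapping.single m a)" "\<And>f g. P f \<Longrightarrow> P g \<Longrightarrow> P (f + g)"
  shows "P f"
proof -
  have "P (\<Sum>m\<in>S. Poly_Mapping.single m (Poly_Mapping.lookup f m))" if "finite S" for S
    using that
  proof (induction S rule: finite_induct)
    case empty
    show ?case using assms(1)[of _ 0] by simp
  next
    case (insert m S)
    then show ?case using assms by simp
  qed
  from this[of "Poly_Mapping.keys f"] show ?thesis
    by (simp add: poly_mapping_sum_singles)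
qed

text \<open>One interface for coefficient embeddings, substitutions, group actions and scalar
  extension, so that compositions of such maps can be compared on constants and variables
  alone.\<close>

locale unital_hom =
  fixes h :: "'a :: comm_ring_1 \<Rightarrow> 'b :: comm_ring_1"
  assumes hom_one [simp]: "h 1 = 1"
    and hom_add [simp]: "h (a + b) = h a + h b"
    and hom_mult [simp]: "h (a * b) = h a * h b"
begin

lemma hom_zero [simp]: "h 0 = 0"
  using hom_add[of 0 0] by (simp del: hom_add)

lemma hom_uminus [simp]: "h (- a) = - h a"
  using hom_add[of a "- a"] by (simp add: eq_neg_iff_add_eq_0 add.commute del: hom_add)

lemma hom_sum: "h (sum u I) = (\<Sum>i\<in>I. h (u i))"
  by (induction I rule: infinite_finite_induct) auto

lemma hom_prod: "h (prod u I) = (\<Prod>i\<in>I. h (u i))"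
  by (induction I rule: infinite_finite_induct) auto

lemma hom_power [simp]: "h (a ^ k) = h a ^ k"
  by (induction k) auto

lemma hom_of_nat [simp]: "h (of_nat k) = of_nat k"
  by (induction k) auto

end

lemma unital_hom_ident: "unital_hom (\<lambda>x. x)"
  by (simp add: unital_hom_def)

lemma unital_hom_comp: "unital_hom h \<Longrightarrow> unital_hom k \<Longrightarrow> unital_hom (\<lambda>x. h (k x))"
  by (auto simp: unital_hom_def)

section \<open>Evaluation homomorphisms\<close>

definition mono_eval :: "(nat \<Rightarrow> 'r :: comm_ring_1) \<Rightarrow> (nat \<Rightarrow>\<^sub>0 nat) \<Rightarrow> 'r" where
  "mono_eval \<sigma> m = (\<Prod>i\<in>Poly_Mapping.keys m. \<sigma> i ^ Poly_Mapping.lookup m i)"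

text \<open>The coefficient map \<open>c\<close> is a parameter so that substitution over a field
  and passage to its algebraic closure are instances of one construction.\<close>

definition mpoly_eval :: "('f :: field \<Rightarrow> 'r :: comm_ring_1) \<Rightarrow> (nat \<Rightarrow> 'r) \<Rightarrow> 'f mpoly \<Rightarrow> 'r" where
  "mpoly_eval c \<sigma> f = (\<Sum>m\<in>Poly_Mapping.keys f. c (Poly_Mapping.lookup f m) * mono_eval \<sigma> m)"

lemma msubst_eq_mpoly_eval: "msubst \<sigma> = mpoly_eval mconst \<sigma>"
  by (intro ext) (simp add: msubst_def mpoly_eval_def mono_eval_def)

lemma mono_eval_superset:
  "finite S \<Longrightarrow> Poly_Mapping.keys m \<subseteq> S \<Longrightarrow> mono_eval \<sigma> m = (\<Prod>i\<in>S. \<sigma> i ^ Poly_Mapping.lookup m i)"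
  unfolding mono_eval_def by (rule prod_keys_superset) auto

lemma mono_eval_0 [simp]: "mono_eval \<sigma> 0 = 1"
  by (simp add: mono_eval_def)

lemma mono_eval_add: "mono_eval \<sigma> (a + b) = mono_eval \<sigma> a * mono_eval \<sigma> b"
proof -
  let ?S = "Poly_Mapping.keys a \<union> Poly_Mapping.keys b"
  have "mono_eval \<sigma> (a + b) = (\<Prod>i\<in>?S. \<sigma> i ^ Poly_Mapping.lookup (a + b) i)"
    using keys_add[of a b] by (intro mono_eval_superset) auto
  also have "\<dots> = (\<Prod>i\<in>?S. \<sigma> i ^ Poly_Mapping.lookup a i) * (\<Prod>i\<in>?S. \<sigma> i ^ Poly_Mapping.lookup b i)"
    by (simp add: lookup_add power_add prod.distrib)
  also have "\<dots> = mono_eval \<sigma> a * mono_eval \<sigma> b"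
    by (simp flip: mono_eval_superset)
  finally show ?thesis .
qed

lemma mono_eval_single [simp]: "mono_eval \<sigma> (Poly_Mapping.single i k) = \<sigma> i ^ k"
  by (cases "k = 0") (simp_all add: mono_eval_def)

lemma (in unital_hom) hom_mono_eval: "h (mono_eval \<sigma> m) = mono_eval (\<lambda>i. h (\<sigma> i)) m"
  by (simp add: mono_eval_def hom_prod)

lemma mono_eval_mvar: "mono_eval mvar m = Poly_Mapping.single m (1 :: 'f :: field)"
proof (induction m rule: poly_mapping_singles_induct)
  case (single i k)
  have "mvar i ^ k = Poly_Mapping.single (Poly_Mapping.single i k) (1 :: 'f)"
    by (induction k) (simp_all add: mvar_def mult_single flip: single_add)
  then show ?case by simp
next
  case (add f g)
  then show ?case by (simp add: mono_eval_add mult_single)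
qed

lemma mconst_unital_hom: "unital_hom (mconst :: 'f :: field \<Rightarrow> 'f mpoly)"
  by standard (simp_all add: mconst_def single_add mult_single)

global_interpretation mconst: unital_hom "mconst :: 'f :: field \<Rightarrow> 'f mpoly"
  by (rule mconst_unital_hom)

lemma mconst_mult_single: "mconst a * Poly_Mapping.single m b = Poly_Mapping.single m (a * b)"
  by (simp add: mconst_def mult_single)

lemma lookup_mconst_mult [simp]: "Poly_Mapping.lookup (mconst a * f) m = a * Poly_Mapping.lookup f m"
proof (induction f rule: poly_mapping_singles_induct)
  case (single m' b)
  then show ?case by (simp add: mconst_mult_single lookup_single when_def)
next
  case (add f g)
  then show ?case by (simp add: distrib_left lookup_add)
qed

lemma mpoly_eval_unital_hom:
  fixes c :: "'f :: field \<Rightarrow> 'r :: comm_ring_1"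
  assumes "unital_hom c"
  shows "unital_hom (mpoly_eval c \<sigma>)"
    and "mpoly_eval c \<sigma> (Poly_Mapping.single m a) = c a * mono_eval \<sigma> m"
proof -
  interpret c: unital_hom c by fact
  show eval_single: "mpoly_eval c \<sigma> (Poly_Mapping.single m a) = c a * mono_eval \<sigma> m" for m a
    by (cases "a = 0") (simp_all add: mpoly_eval_def)
  have superset: "mpoly_eval c \<sigma> f = (\<Sum>m\<in>S. c (Poly_Mapping.lookup f m) * mono_eval \<sigma> m)"
    if "finite S" "Poly_Mapping.keys f \<subseteq> S" for S f
    unfolding mpoly_eval_def using that by (intro sum_keys_superset) auto
  have add: "mpoly_eval c \<sigma> (f + g) = mpoly_eval c \<sigma> f + mpoly_eval c \<sigma> g" for f g
  proof -
    let ?S = "Poly_Mapping.keys f \<union> Poly_Mapping.keys g"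
    have "mpoly_eval c \<sigma> (f + g) = (\<Sum>m\<in>?S. c (Poly_Mapping.lookup (f + g) m) * mono_eval \<sigma> m)"
      using keys_add[of f g] by (intro superset) auto
    also have "\<dots> = mpoly_eval c \<sigma> f + mpoly_eval c \<sigma> g"
      by (simp add: lookup_add distrib_right sum.distrib superset[of ?S f] superset[of ?S g])
    finally show ?thesis .
  qed
  show "unital_hom (mpoly_eval c \<sigma>)"
  proof
    show "mpoly_eval c \<sigma> 1 = 1"
      using eval_single[of 0 1] by (simp flip: single_one)
    fix f g
    show "mpoly_eval c \<sigma> (f * g) = mpoly_eval c \<sigma> f * mpoly_eval c \<sigma> g"
    proof (induction f rule: poly_mapping_singles_induct)
      case fst: (single m a)
      show ?case
      proof (induction g rule: poly_mapping_singles_induct)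
        case (single m' b)
        then show ?case by (simp add: eval_single mult_single mono_eval_add mult_ac)
      qed (simp add: add distrib_left)
    qed (simp add: add distrib_right)
  qed (rule add)
qed

lemma mpoly_eval_mconst [simp]: "unital_hom c \<Longrightarrow> mpoly_eval c \<sigma> (mconst a) = c a"
  by (simp add: mconst_def mpoly_eval_unital_hom)

lemma mpoly_eval_mvar [simp]: "unital_hom c \<Longrightarrow> mpoly_eval c \<sigma> (mvar i) = \<sigma> i"
  by (simp add: mvar_def mpoly_eval_unital_hom unital_hom_def)

lemma mpoly_sum_monomials:
  "(\<Sum>m\<in>Poly_Mapping.keys f. mconst (Poly_Mapping.lookup f m) * mono_eval mvar m) = f"
  by (simp add: mono_eval_mvar mconst_mult_single poly_mapping_sum_singles)

text \<open>Uniqueness in the universal property of the polynomial ring. The restriction to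
  \<open>polys_in n\<close> matters: for \<open>i \<ge> n\<close> the entries
  \<open>M $$ (i, j)\<close> read by \<open>mat_act\<close> lie outside the matrix.\<close>

lemma unital_hom_eq_on_polys_in:
  assumes "unital_hom h" "unital_hom k" "\<And>a. h (mconst a) = k (mconst a)"
    "\<And>i. i < n \<Longrightarrow> h (mvar i) = k (mvar i)" "f \<in> polys_in n"
  shows "h f = k f"
proof -
  interpret h: unital_hom h by fact
  interpret k: unital_hom k by fact
  have "h (mono_eval mvar m) = k (mono_eval mvar m)" if "m \<in> Poly_Mapping.keys f" for m
  proof -
    have "mono_eval (\<lambda>i. h (mvar i)) m = mono_eval (\<lambda>i. k (mvar i)) m"
      unfolding mono_eval_def using that assms(4,5)
      by (intro prod.cong refl arg_cong[where f = "\<lambda>x. x ^ _"]) (auto simp: polys_in_def)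
    then show ?thesis
      by (simp add: h.hom_mono_eval k.hom_mono_eval)
  qed
  then have "h (\<Sum>m\<in>Poly_Mapping.keys f. mconst (Poly_Mapping.lookup f m) * mono_eval mvar m) =
      k (\<Sum>m\<in>Poly_Mapping.keys f. mconst (Poly_Mapping.lookup f m) * mono_eval mvar m)"
    by (simp add: h.hom_sum k.hom_sum assms(3))
  then show ?thesis
    by (simp only: mpoly_sum_monomials)
qed

section \<open>Degrees and variable bounds\<close>

lemma mono_degree_superset:
  "finite S \<Longrightarrow> Poly_Mapping.keys m \<subseteq> S \<Longrightarrow> mono_degree m = (\<Sum>i\<in>S. Poly_Mapping.lookup m i)"
  unfolding mono_degree_def by (rule sum_keys_superset) auto

lemma mono_degree_add: "mono_degree (a + b) = mono_degree a + mono_degree b"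
proof -
  let ?S = "Poly_Mapping.keys a \<union> Poly_Mapping.keys b"
  have "mono_degree (a + b) = (\<Sum>i\<in>?S. Poly_Mapping.lookup (a + b) i)"
    using keys_add[of a b] by (intro mono_degree_superset) auto
  then show ?thesis
    by (simp add: lookup_add sum.distrib mono_degree_superset[of ?S a] mono_degree_superset[of ?S b])
qed

lemma mono_degree_0 [simp]: "mono_degree 0 = 0"
  by (simp add: mono_degree_def)

lemma mono_degree_single [simp]: "mono_degree (Poly_Mapping.single i k) = k"
  by (cases "k = 0") (simp_all add: mono_degree_def)

lemma keys_mconst_subset: "Poly_Mapping.keys (mconst c) \<subseteq> {0}"
  by (simp add: mconst_def)

lemma polys_in_mconst [simp]: "mconst c \<in> polys_in n"
  using keys_mconst_subset by (fastforce simp: polys_in_def)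

lemma polys_in_one [simp]: "1 \<in> polys_in n"
  using polys_in_mconst[of 1] by simp

lemma polys_in_mvar: "i < n \<Longrightarrow> mvar i \<in> polys_in n"
  by (simp add: polys_in_def mvar_def)

lemma polys_in_add: "f \<in> polys_in n \<Longrightarrow> g \<in> polys_in n \<Longrightarrow> f + g \<in> polys_in n"
  using keys_add[of f g] by (fastforce simp: polys_in_def)

lemma polys_in_mult: "f \<in> polys_in n \<Longrightarrow> g \<in> polys_in n \<Longrightarrow> f * g \<in> polys_in n"
proof -
  assume *: "f \<in> polys_in n" "g \<in> polys_in n"
  show ?thesis
    unfolding polys_in_def
  proof (intro CollectI ballI)
    fix m assume "m \<in> Poly_Mapping.keys (f * g)"
    then obtain a b where "m = a + b" "a \<in> Poly_Mapping.keys f" "b \<in> Poly_Mapping.keys g"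
      using keys_mult[of f g] by blast
    then show "Poly_Mapping.keys m \<subseteq> {..<n}"
      using * keys_add[of a b] by (fastforce simp: polys_in_def)
  qed
qed

lemma polys_in_zero [simp]: "0 \<in> polys_in n"
  by (simp add: polys_in_def)

lemma polys_in_sum: "(\<And>i. i \<in> I \<Longrightarrow> u i \<in> polys_in n) \<Longrightarrow> sum u I \<in> polys_in n"
  by (induction I rule: infinite_finite_induct) (auto intro: polys_in_add)

lemma polys_in_prod: "(\<And>i. i \<in> I \<Longrightarrow> u i \<in> polys_in n) \<Longrightarrow> prod u I \<in> polys_in n"
  by (induction I rule: infinite_finite_induct) (auto intro: polys_in_mult)

lemma polys_in_power: "f \<in> polys_in n \<Longrightarrow> f ^ k \<in> polys_in n"
  by (induction k) (auto intro: polys_in_mult)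

lemma degree_le_mono: "f \<in> degree_le d \<Longrightarrow> d \<le> e \<Longrightarrow> f \<in> degree_le e"
  by (fastforce simp: degree_le_def)

lemma degree_le_mconst [simp]: "mconst c \<in> degree_le d"
  using keys_mconst_subset[of c] by (auto simp: degree_le_def)

lemma degree_le_one [simp]: "1 \<in> degree_le d"
  using degree_le_mconst[of 1] by simp

lemma degree_le_mvar: "mvar i \<in> degree_le 1"
  by (simp add: degree_le_def mvar_def)

lemma degree_le_add: "f \<in> degree_le d \<Longrightarrow> g \<in> degree_le d \<Longrightarrow> f + g \<in> degree_le d"
  using keys_add[of f g] by (fastforce simp: degree_le_def)

lemma degree_le_mult: "f \<in> degree_le d \<Longrightarrow> g \<in> degree_le e \<Longrightarrow> f * g \<in> degree_le (d + e)"
proof -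
  assume *: "f \<in> degree_le d" "g \<in> degree_le e"
  show ?thesis
    unfolding degree_le_def
  proof (intro CollectI ballI)
    fix m assume "m \<in> Poly_Mapping.keys (f * g)"
    then obtain a b where "m = a + b" "a \<in> Poly_Mapping.keys f" "b \<in> Poly_Mapping.keys g"
      using keys_mult[of f g] by blast
    then show "mono_degree m \<le> d + e"
      using * by (auto simp: degree_le_def mono_degree_add intro: add_mono)
  qed
qed

lemma degree_le_zero [simp]: "0 \<in> degree_le d"
  by (simp add: degree_le_def)

lemma degree_le_sum: "(\<And>i. i \<in> I \<Longrightarrow> u i \<in> degree_le d) \<Longrightarrow> sum u I \<in> degree_le d"
  by (induction I rule: infinite_finite_induct) (auto intro: degree_le_add)

lemma degree_le_prod:
  "finite I \<Longrightarrow> (\<And>i. i \<in> I \<Longrightarrow> u i \<in> degree_le (e i)) \<Longrightarrow> prod u I \<in> degree_le (sum e I)"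
  by (induction I rule: finite_induct) (auto intro: degree_le_mult)

lemma degree_le_power: "f \<in> degree_le d \<Longrightarrow> f ^ k \<in> degree_le (k * d)"
  by (induction k) (auto intro: degree_le_mult)

lemma degree_le_mono_eval:
  assumes "\<And>i. \<sigma> i \<in> degree_le 1"
  shows "mono_eval \<sigma> m \<in> degree_le (mono_degree m)"
  unfolding mono_eval_def mono_degree_def
  using degree_le_power[OF assms] by (intro degree_le_prod) auto

lemma degree_le_mpoly_eval:
  assumes "\<And>i. \<sigma> i \<in> degree_le 1" "f \<in> degree_le d"
  shows "mpoly_eval (\<lambda>a. mconst (c a)) \<sigma> f \<in> degree_le d"
  unfolding mpoly_eval_def
proof (rule degree_le_sum)
  fix m assume "m \<in> Poly_Mapping.keys f"
  then have "mono_degree m \<le> d"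
    using assms(2) by (auto simp: degree_le_def)
  then show "mconst (c (Poly_Mapping.lookup f m)) * mono_eval \<sigma> m \<in> degree_le d"
    by (intro degree_le_mono[OF degree_le_mult[OF degree_le_mconst[of _ 0]
      degree_le_mono_eval[OF assms(1)]]]) simp
qed

lemma polys_in_mpoly_eval:
  assumes "\<And>i. \<sigma> i \<in> polys_in n"
  shows "mpoly_eval (\<lambda>a. mconst (c a)) \<sigma> f \<in> polys_in n"
  unfolding mpoly_eval_def mono_eval_def
  using assms by (intro polys_in_sum polys_in_mult polys_in_prod polys_in_power polys_in_mconst)

section \<open>Linear forms and matrix substitutions\<close>

definition linear_forms :: "nat \<Rightarrow> 'f :: field mpoly set" where
  "linear_forms n = {\<Sum>j<n. mconst (c j) * mvar j | c. True}"

lemma linear_forms_polys_in: "v \<in> linear_forms n \<Longrightarrow> v \<in> polys_in n"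
  by (auto simp: linear_forms_def intro!: polys_in_sum polys_in_mult polys_in_mvar)

lemma linear_forms_degree_le: "v \<in> linear_forms n \<Longrightarrow> v \<in> degree_le 1"
  using degree_le_mult[OF degree_le_mconst[of _ 0] degree_le_mvar]
  by (auto simp: linear_forms_def intro!: degree_le_sum)

lemma linear_forms_add:
  assumes "v \<in> linear_forms n" "w \<in> linear_forms n"
  shows "v + w \<in> linear_forms n"
proof -
  obtain c d where "v = (\<Sum>j<n. mconst (c j) * mvar j)" "w = (\<Sum>j<n. mconst (d j) * mvar j)"
    using assms by (auto simp: linear_forms_def)
  then have "v + w = (\<Sum>j<n. mconst (c j + d j) * mvar j)"
    by (simp add: distrib_right sum.distrib)
  then show ?thesis
    unfolding linear_forms_def by (intro CollectI exI[of _ "\<lambda>j. c j + d j"]) simp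
qed

lemma linear_forms_scale:
  assumes "v \<in> linear_forms n"
  shows "mconst a * v \<in> linear_forms n"
proof -
  obtain c where "v = (\<Sum>j<n. mconst (c j) * mvar j)"
    using assms by (auto simp: linear_forms_def)
  then have "mconst a * v = (\<Sum>j<n. mconst (a * c j) * mvar j)"
    by (simp add: sum_distrib_left mult_ac)
  then show ?thesis
    unfolding linear_forms_def by (intro CollectI exI[of _ "\<lambda>j. a * c j"]) simp
qed

lemma linear_forms_zero [simp]: "0 \<in> linear_forms n"
  unfolding linear_forms_def by (intro CollectI exI[of _ "\<lambda>_. 0"]) simp

lemma linear_forms_sum: "(\<And>i. i \<in> I \<Longrightarrow> u i \<in> linear_forms n) \<Longrightarrow> sum u I \<in> linear_forms n"
  by (induction I rule: infinite_finite_induct) (auto intro: linear_forms_add)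

lemma linear_forms_mvar:
  assumes "i < n"
  shows "mvar i \<in> linear_forms n"
proof -
  have "mvar i = (\<Sum>j<n. mconst (if j = i then 1 else 0) * mvar j)"
    using assms by (simp add: if_distrib[of mconst] if_distrib[of "\<lambda>x. x * _"] cong: if_cong)
  then show ?thesis
    unfolding linear_forms_def by (intro CollectI exI[of _ "\<lambda>j. if j = i then 1 else 0"]) simp
qed

lemma mat_act_unital_hom: "unital_hom (mat_act n M)"
  unfolding mat_act_def msubst_eq_mpoly_eval by (rule mpoly_eval_unital_hom[OF mconst_unital_hom])

lemma mat_act_mconst [simp]: "mat_act n M (mconst a) = mconst a"
  unfolding mat_act_def msubst_eq_mpoly_eval by (simp add: mconst_unital_hom)

lemma mat_act_mvar: "mat_act n M (mvar i) = (\<Sum>j<n. mconst (M $$ (i, j)) * mvar j)"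
  unfolding mat_act_def msubst_eq_mpoly_eval by (simp add: mconst_unital_hom)

lemma mat_act_polys_in: "mat_act n M f \<in> polys_in n"
  unfolding mat_act_def msubst_eq_mpoly_eval
  by (intro polys_in_mpoly_eval[where c = "\<lambda>a. a"] linear_forms_polys_in) (auto simp: linear_forms_def)

lemma mat_act_degree_le: "f \<in> degree_le d \<Longrightarrow> mat_act n M f \<in> degree_le d"
  unfolding mat_act_def msubst_eq_mpoly_eval
  by (intro degree_le_mpoly_eval[where c = "\<lambda>a. a"] linear_forms_degree_le[where n = n])
    (auto simp: linear_forms_def)

lemma mat_act_linear_forms: "v \<in> linear_forms n \<Longrightarrow> mat_act n M v \<in> linear_forms n"
proof -
  interpret unital_hom "mat_act n M" by (rule mat_act_unital_hom)
  assume "v \<in> linear_forms n"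
  then obtain c where "v = (\<Sum>j<n. mconst (c j) * mvar j)"
    by (auto simp: linear_forms_def)
  then have "mat_act n M v = (\<Sum>j<n. mconst (c j) * (\<Sum>k<n. mconst (M $$ (j, k)) * mvar k))"
    by (simp add: hom_sum mat_act_mvar)
  also have "\<dots> \<in> linear_forms n"
    by (intro linear_forms_sum linear_forms_scale linear_forms_mvar) simp
  finally show ?thesis .
qed

text \<open>Substitution is contravariant: composing \<open>f\<close> with \<open>N\<close> and the
  result with \<open>M\<close> evaluates \<open>f\<close> at N(Mv). Hence the order of the factors,
  and hence a right action.\<close>

lemma mat_act_mult:
  assumes "M \<in> carrier_mat n n" "N \<in> carrier_mat n n" "f \<in> polys_in n"
  shows "mat_act n M (mat_act n N f) = mat_act n (N * M) f"
proof -
  interpret M: unital_hom "mat_act n M" by (rule mat_act_unital_hom)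
  show ?thesis
  proof (rule unital_hom_eq_on_polys_in[OF _ _ _ _ assms(3)])
    show "unital_hom (\<lambda>f. mat_act n M (mat_act n N f))"
      by (rule unital_hom_comp[OF mat_act_unital_hom mat_act_unital_hom])
    fix i assume i: "i < n"
    have "mat_act n M (mat_act n N (mvar i)) =
        (\<Sum>j<n. mconst (N $$ (i, j)) * (\<Sum>k<n. mconst (M $$ (j, k)) * mvar k))"
      by (simp add: mat_act_mvar M.hom_sum)
    also have "\<dots> = (\<Sum>k<n. \<Sum>j<n. mconst (N $$ (i, j) * M $$ (j, k)) * mvar k)"
      unfolding sum_distrib_left by (subst sum.swap) (simp add: mult_ac)
    also have "\<dots> = (\<Sum>k<n. mconst ((N * M) $$ (i, k)) * mvar k)"
      using assms(1,2) i
      by (intro sum.cong refl) (auto simp: scalar_prod_def mconst.hom_sum sum_distrib_right atLeast0LessThan)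
    finally show "mat_act n M (mat_act n N (mvar i)) = mat_act n (N * M) (mvar i)"
      by (simp add: mat_act_mvar)
  qed (auto intro: mat_act_unital_hom)
qed

lemma mat_act_one:
  assumes "f \<in> polys_in n"
  shows "mat_act n (1\<^sub>m n) f = f"
proof (rule unital_hom_eq_on_polys_in[OF _ _ _ _ assms])
  fix i assume i: "i < n"
  have "mat_act n (1\<^sub>m n) (mvar i) = (\<Sum>j<n. if j = i then mvar j else 0)"
    unfolding mat_act_mvar using i by (intro sum.cong) auto
  then show "mat_act n (1\<^sub>m n) (mvar i) = mvar i"
    using i by simp
qed (auto intro: mat_act_unital_hom unital_hom_ident)

lemma matrix_modules_carrier:
  "\<rho> \<in> matrix_modules G n \<Longrightarrow> g \<in> carrier G \<Longrightarrow> \<rho> g \<in> carrier_mat n n"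
  by (auto simp: matrix_modules_def hom_def general_linear_def units_of_def Units_def ring_mat_def)

lemma matrix_modules_mult:
  "\<rho> \<in> matrix_modules G n \<Longrightarrow> g \<in> carrier G \<Longrightarrow> h \<in> carrier G \<Longrightarrow> \<rho> (g \<otimes>\<^bsub>G\<^esub> h) = \<rho> g * \<rho> h"
  by (auto simp: matrix_modules_def hom_def general_linear_def units_of_def ring_mat_def)

lemma matrix_modulesI:
  fixes G :: "('g, 'x) monoid_scheme" and \<rho> :: "'g \<Rightarrow> 'f :: field mat"
  assumes "group G" "\<And>g. g \<in> carrier G \<Longrightarrow> \<rho> g \<in> carrier_mat n n"
    "\<And>g h. g \<in> carrier G \<Longrightarrow> h \<in> carrier G \<Longrightarrow> \<rho> (g \<otimes>\<^bsub>G\<^esub> h) = \<rho> g * \<rho> h"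
    "\<rho> \<one>\<^bsub>G\<^esub> = 1\<^sub>m n"
  shows "\<rho> \<in> matrix_modules G n"
proof -
  interpret group G by fact
  have "\<rho> g \<in> Units (ring_mat TYPE('f) n ())" if "g \<in> carrier G" for g
    unfolding Units_def using that assms(2) assms(3)[of "inv\<^bsub>G\<^esub> g" g] assms(3)[of g "inv\<^bsub>G\<^esub> g"] assms(4)
    by (auto simp: ring_mat_def intro!: bexI[of _ "\<rho> (inv\<^bsub>G\<^esub> g)"])
  then show ?thesis
    using assms(3)
    by (auto simp: matrix_modules_def hom_def general_linear_def units_of_def ring_mat_def)
qed

lemma matrix_modules_one:
  fixes G :: "('g, 'x) monoid_scheme" and \<rho> :: "'g \<Rightarrow> 'f :: field mat"
  assumes "group G" "\<rho> \<in> matrix_modules G n"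
  shows "\<rho> \<one>\<^bsub>G\<^esub> = 1\<^sub>m n"
proof -
  interpret group G by fact
  interpret R: ring "ring_mat TYPE('f) n ()" by (rule ring_mat)
  interpret U: group "general_linear TYPE('f) n"
    unfolding general_linear_def by (rule R.units_group)
  interpret group_hom G "general_linear TYPE('f) n" \<rho>
    using assms(2) by unfold_locales (simp add: matrix_modules_def)
  show ?thesis
    using hom_one by (simp add: general_linear_def units_of_def ring_mat_def)
qed

section \<open>Invariants and averaging over the group\<close>

locale matrix_module = group G for G :: "('g, 'x) monoid_scheme" (structure) +
  fixes n :: nat and \<rho> :: "'g \<Rightarrow> 'f :: field mat"
  assumes finite_G: "finite (carrier G)" and order_nonzero: "of_nat (order G) \<noteq> (0 :: 'f)"
    and module: "\<rho> \<in> matrix_modules G n"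
begin

definition act :: "'g \<Rightarrow> 'f mpoly \<Rightarrow> 'f mpoly" where
  "act g = mat_act n (\<rho> g)"

lemma act_unital_hom: "unital_hom (act g)"
  by (simp add: act_def mat_act_unital_hom)

lemma act_mconst [simp]: "act g (mconst a) = mconst a"
  by (simp add: act_def)

lemma act_polys_in: "act g f \<in> polys_in n"
  by (simp add: act_def mat_act_polys_in)

lemma act_degree_le: "f \<in> degree_le d \<Longrightarrow> act g f \<in> degree_le d"
  by (simp add: act_def mat_act_degree_le)

lemma act_linear_forms: "v \<in> linear_forms n \<Longrightarrow> act g v \<in> linear_forms n"
  by (simp add: act_def mat_act_linear_forms)

lemma act_act:
  "g \<in> carrier G \<Longrightarrow> h \<in> carrier G \<Longrightarrow> f \<in> polys_in n \<Longrightarrow> act h (act g f) = act (g \<otimes> h) f"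
  using module unfolding act_def
  by (subst mat_act_mult) (auto simp: matrix_modules_carrier matrix_modules_mult)

lemma act_one: "f \<in> polys_in n \<Longrightarrow> act \<one> f = f"
  using matrix_modules_one[OF is_group module] by (simp add: act_def mat_act_one)

abbreviation "Inv \<equiv> invariants G n \<rho>"

lemma invariants_iff: "f \<in> Inv \<longleftrightarrow> f \<in> polys_in n \<and> (\<forall>g\<in>carrier G. act g f = f)"
  by (simp add: invariants_def act_def)

lemma generated_algebra_invariants:
  assumes "B \<subseteq> Inv"
  shows "generated_algebra B \<subseteq> Inv"
proof
  fix f assume "f \<in> generated_algebra B"
  then show "f \<in> Inv"
  proof induction
    case (add f g)
    then show ?case
      using act_unital_hom by (auto simp: invariants_iff polys_in_add unital_hom_def)
  next
    case (mult f g)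
    then show ?case
      using act_unital_hom by (auto simp: invariants_iff polys_in_mult unital_hom_def)
  qed (use assms in \<open>auto simp: invariants_iff\<close>)
qed

definition reynolds :: "'f mpoly \<Rightarrow> 'f mpoly" where
  "reynolds f = mconst (1 / of_nat (order G)) * (\<Sum>g\<in>carrier G. act g f)"

lemma sum_act_invariant:
  assumes "f \<in> polys_in n"
  shows "(\<Sum>g\<in>carrier G. act g f) \<in> Inv"
proof -
  have "act h (\<Sum>g\<in>carrier G. act g f) = (\<Sum>g\<in>carrier G. act g f)" if h: "h \<in> carrier G" for h
  proof -
    have "act h (\<Sum>g\<in>carrier G. act g f) = (\<Sum>g\<in>carrier G. act (g \<otimes> h) f)"
      using assms h by (simp add: unital_hom.hom_sum[OF act_unital_hom] act_act)
    also have "\<dots> = (\<Sum>g\<in>carrier G. act g f)"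
      using h by (intro sum.reindex_bij_witness[of _ "\<lambda>g. g \<otimes> inv h" "\<lambda>g. g \<otimes> h"]) (auto simp: m_assoc)
    finally show ?thesis .
  qed
  then show ?thesis
    by (auto simp: invariants_iff intro: polys_in_sum act_polys_in)
qed

lemma reynolds_invariant: "f \<in> polys_in n \<Longrightarrow> reynolds f \<in> Inv"
  using sum_act_invariant[of f] act_unital_hom unfolding reynolds_def
  by (auto simp: invariants_iff unital_hom_def intro!: polys_in_mult)

lemma reynolds_degree_le: "f \<in> degree_le d \<Longrightarrow> reynolds f \<in> degree_le d"
  using degree_le_mult[OF degree_le_mconst[of _ 0], of "\<Sum>g\<in>carrier G. act g f" d]
  by (auto simp: reynolds_def intro: degree_le_sum act_degree_le)

text \<open>Invariants behave like scalars under averaging; this is what later replaces arbitrary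
  cofactors by invariant ones.\<close>

lemma reynolds_invariant_mult:
  assumes "b \<in> Inv"
  shows "reynolds (b * s) = b * reynolds s"
proof -
  have "(\<Sum>g\<in>carrier G. act g (b * s)) = (\<Sum>g\<in>carrier G. b * act g s)"
    using assms act_unital_hom by (intro sum.cong) (auto simp: invariants_iff unital_hom_def)
  then show ?thesis
    by (simp add: reynolds_def mult.left_commute flip: sum_distrib_left)
qed

lemma reynolds_one: "reynolds 1 = 1"
proof -
  have "reynolds 1 = mconst (1 / of_nat (order G)) * of_nat (order G)"
    by (simp add: reynolds_def Coset.order_def unital_hom.hom_one[OF act_unital_hom])
  also have "\<dots> = mconst (1 / of_nat (order G) * of_nat (order G))"
    by (simp only: mconst.hom_mult mconst.hom_of_nat)
  also have "\<dots> = 1"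
    using order_nonzero by simp
  finally show ?thesis .
qed

lemma reynolds_id: "b \<in> Inv \<Longrightarrow> reynolds b = b"
  using reynolds_invariant_mult[of b 1] by (simp add: reynolds_one)

lemma reynolds_add: "reynolds (f + g) = reynolds f + reynolds g"
  using act_unital_hom by (simp add: reynolds_def unital_hom_def sum.distrib distrib_left)

lemma reynolds_scale: "reynolds (mconst a * f) = mconst a * reynolds f"
  by (rule reynolds_invariant_mult) (simp add: invariants_iff)

lemma reynolds_sum: "reynolds (sum u I) = (\<Sum>i\<in>I. reynolds (u i))"
proof -
  have "reynolds 0 = 0"
    using reynolds_scale[of 0 0] by simp
  then show ?thesis
    by (induction I rule: infinite_finite_induct) (auto simp: reynolds_add)
qed

end


section \<open>Degree bound for invariants over a splitting field\<close>

text \<open>Modulo \<open>Q\<close>, flipping a product-one subset \<open>U\<close> of the weights changes the sign of the product.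
  After flipping \<open>U\<close>, flip a product-one subset \<open>T\<close> that avoids some \<open>i \<in> U\<close>; the result is also
  reached from the start by flipping the symmetric difference of \<open>U\<close> and \<open>T\<close> once. So the product
  is congruent to its own negative.\<close>

lemma (in comm_group) prod_mem_of_flips:
  fixes v :: "'i \<Rightarrow> 'r :: comm_ring_1"
  assumes I: "finite I" "small_davenport G < enat (card I - 1)"
    and c: "c \<in> I \<rightarrow> carrier G" and v: "\<And>i. i \<in> I \<Longrightarrow> v i \<in> V (c i)"
    and H_V: "\<And>a w. a \<in> carrier G \<Longrightarrow> w \<in> V a \<Longrightarrow> H w \<in> V (inv a)"
    and H_H: "\<And>a w. a \<in> carrier G \<Longrightarrow> w \<in> V a \<Longrightarrow> H (H w) = w"
    and Q_add: "\<And>p q. p \<in> Q \<Longrightarrow> q \<in> Q \<Longrightarrow> p + q \<in> Q" and Q_minus: "\<And>p. p \<in> Q \<Longrightarrow> - p \<in> Q"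
    and Q_half: "\<And>p. p + p \<in> Q \<Longrightarrow> p \<in> Q"
    and Q: "\<And>c v U. c \<in> I \<rightarrow> carrier G \<Longrightarrow> (\<And>i. i \<in> I \<Longrightarrow> v i \<in> V (c i)) \<Longrightarrow> U \<subseteq> I \<Longrightarrow> U \<noteq> {} \<Longrightarrow>
      finprod G c U = \<one> \<Longrightarrow> ((\<Prod>i\<in>U. v i) + (\<Prod>i\<in>U. H (v i))) * (\<Prod>i\<in>I - U. v i) \<in> Q"
  shows "(\<Prod>i\<in>I. v i) \<in> Q"
proof -
  define flip where "flip U w i = (if i \<in> U then H (w i) else w i)" for U :: "'i set" and w i
  define flip_c where "flip_c U b i = (if i \<in> U then inv (b i) else b i)" for U :: "'i set" and b :: "'i \<Rightarrow> 'a" and i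
  have flip: "(\<Prod>i\<in>I. w i) + (\<Prod>i\<in>I. flip U w i) \<in> Q"
    if "b \<in> I \<rightarrow> carrier G" "\<And>i. i \<in> I \<Longrightarrow> w i \<in> V (b i)" "U \<subseteq> I" "U \<noteq> {}" "finprod G b U = \<one>" for b w U
  proof -
    have split: "(\<Prod>i\<in>I. u i) = (\<Prod>i\<in>U. u i) * (\<Prod>i\<in>I - U. u i)" for u :: "'i \<Rightarrow> 'r"
      using prod.subset_diff[OF that(3) I(1)] by (simp add: mult.commute)
    have "(\<Prod>i\<in>U. flip U w i) = (\<Prod>i\<in>U. H (w i))" "(\<Prod>i\<in>I - U. flip U w i) = (\<Prod>i\<in>I - U. w i)"
      by (simp_all add: flip_def)
    then have "(\<Prod>i\<in>I. w i) + (\<Prod>i\<in>I. flip U w i) =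
        ((\<Prod>i\<in>U. w i) + (\<Prod>i\<in>U. H (w i))) * (\<Prod>i\<in>I - U. w i)"
      by (simp add: split distrib_right)
    then show ?thesis
      using Q[OF that] by simp
  qed
  have "small_davenport G < enat (card I)"
    using I(2) by (rule less_le_trans) simp
  then obtain U where U: "U \<subseteq> I" "U \<noteq> {}" "finprod G c U = \<one>"
    using finprod_one_subset[OF I(1) c] by blast
  \<comment> \<open>\<open>T\<close> will be chosen inside \<open>I - {i}\<close>, which still has
    more than d(A) elements. So \<open>i\<close> survives in the symmetric difference
    \<open>Z\<close>, which is therefore nonempty.\<close>
  then obtain i where i: "i \<in> U" by blast
  have c': "flip_c U c \<in> I \<rightarrow> carrier G"
    using c by (auto simp: flip_c_def Pi_iff)
  have v': "flip U v j \<in> V (flip_c U c j)" if "j \<in> I" for j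
    using that v H_V c by (auto simp: flip_def flip_c_def Pi_iff)
  have "card (I - {i}) = card I - 1"
    using i U(1) I(1) by (simp add: card_Diff_singleton subset_iff)
  moreover have "flip_c U c \<in> I - {i} \<rightarrow> carrier G"
    using c' by auto
  ultimately obtain T where T: "T \<subseteq> I - {i}" "T \<noteq> {}" "finprod G (flip_c U c) T = \<one>"
    using finprod_one_subset[of "I - {i}" "flip_c U c"] I by auto
  define Z where "Z = (U - T) \<union> (T - U)"
  have Z: "Z \<subseteq> I" "Z \<noteq> {}"
    using U T i by (auto simp: Z_def)
  have closed: "finprod G c Y \<in> carrier G" if "Y \<subseteq> I" for Y
    using c that by (intro finprod_closed) (auto simp: Pi_iff)
  have fin: "finite U" "finite T"
    using U(1) T(1) I(1) by (auto intro: finite_subset)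
  \<comment> \<open>On \<open>U \<inter> T\<close> the second flip meets inverted weights. So
    \<open>T\<close> having product one after the first flip means that \<open>c\<close> has equal
    products over \<open>T - U\<close> and \<open>U \<inter> T\<close>, and the product over
    \<open>Z\<close> becomes the product over \<open>U\<close>.\<close>
  have "finprod G c Z = \<one>"
  proof -
    have 1: "finprod G c Z = finprod G c (U - T) \<otimes> finprod G c (T - U)"
      unfolding Z_def using fin U(1) T(1) c by (intro finprod_Un_disjoint) (auto simp: Pi_iff)
    have "finprod G c ((U - T) \<union> (U \<inter> T)) = finprod G c (U - T) \<otimes> finprod G c (U \<inter> T)"
      using fin U(1) c by (intro finprod_Un_disjoint) (auto simp: Pi_iff)
    moreover have "(U - T) \<union> (U \<inter> T) = U" by blast
    ultimately have 2: "finprod G c (U - T) \<otimes> finprod G c (U \<inter> T) = \<one>"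
      using U(3) by simp
    have "finprod G (flip_c U c) ((T - U) \<union> (U \<inter> T)) =
        finprod G (flip_c U c) (T - U) \<otimes> finprod G (flip_c U c) (U \<inter> T)"
      using fin U(1) T(1) c' by (intro finprod_Un_disjoint) (auto simp: Pi_iff)
    moreover have "(T - U) \<union> (U \<inter> T) = T" by blast
    moreover have "finprod G (flip_c U c) (T - U) = finprod G c (T - U)"
      using T(1) c by (intro finprod_cong') (auto simp: flip_c_def Pi_iff)
    ultimately have 3: "finprod G c (T - U) \<otimes> finprod G (flip_c U c) (U \<inter> T) = \<one>"
      using T(3) by simp
    have "finprod G (flip_c U c) (U \<inter> T) \<otimes> finprod G c (U \<inter> T) =
        finprod G (\<lambda>j. flip_c U c j \<otimes> c j) (U \<inter> T)"
      using U(1) c c' by (intro finprod_multf[symmetric]) (auto simp: Pi_iff)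
    also have "\<dots> = finprod G (\<lambda>j. \<one>) (U \<inter> T)"
      using U(1) c by (intro finprod_cong') (auto simp: flip_c_def Pi_iff)
    finally have 4: "finprod G (flip_c U c) (U \<inter> T) \<otimes> finprod G c (U \<inter> T) = \<one>"
      by simp
    have fc: "finprod G (flip_c U c) (U \<inter> T) \<in> carrier G"
      using c' U(1) by (intro finprod_closed) (auto simp: Pi_iff)
    have sub: "U - T \<subseteq> I" "T - U \<subseteq> I" "U \<inter> T \<subseteq> I"
      using U(1) T(1) by auto
    have "finprod G c (T - U) = finprod G c (U \<inter> T)"
      using inv_equality[OF 3 fc closed[OF sub(2)]]
        inv_equality[OF 4[unfolded m_comm[OF fc closed[OF sub(3)]]] fc closed[OF sub(3)]] by simp
    then show ?thesis
      using 1 2 by simp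
  qed
  have "flip T (flip U v) j = flip Z v j" if "j \<in> I" for j
    using that H_H v c by (auto simp: flip_def Z_def Pi_iff)
  then have eq: "(\<Prod>j\<in>I. flip T (flip U v) j) = (\<Prod>j\<in>I. flip Z v j)"
    by (intro prod.cong) auto
  have "(\<Prod>j\<in>I. v j) + (\<Prod>j\<in>I. flip U v j) \<in> Q" (is "?p \<in> Q")
    by (rule flip[OF c v U])
  moreover have "(\<Prod>j\<in>I. flip U v j) + (\<Prod>j\<in>I. flip T (flip U v) j) \<in> Q" (is "?q \<in> Q")
    using T by (intro flip[OF c' v']) auto
  moreover have "(\<Prod>j\<in>I. v j) + (\<Prod>j\<in>I. flip Z v j) \<in> Q" (is "?r \<in> Q")
    by (rule flip[OF c v Z \<open>finprod G c Z = \<one>\<close>])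
  \<comment> \<open>The once-flipped product cancels between \<open>?p\<close> and
    \<open>?q\<close>, the final one between \<open>?q\<close> and \<open>?r\<close>; twice the
    original product remains.\<close>
  ultimately have "?p + - ?q + ?r \<in> Q"
    by (rule Q_add[OF Q_add[OF _ Q_minus]])
  then have "(\<Prod>j\<in>I. v j) + (\<Prod>j\<in>I. v j) \<in> Q"
    by (simp add: eq algebra_simps)
  then show ?thesis
    by (rule Q_half)
qed

section \<open>Low-degree invariants with control of the cofactors\<close>

text \<open>An ideal would lose track of the cofactors; here they stay in the prescribed set
  \<open>S\<close>, so their degrees can be bounded. With constants as \<open>B\<close> the same
  notion serves as a linear span.\<close>

inductive_set product_span :: "'r :: comm_ring_1 set \<Rightarrow> 'r set \<Rightarrow> 'r set" for B S :: "'r set" where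
  product: "b \<in> B \<Longrightarrow> s \<in> S \<Longrightarrow> b * s \<in> product_span B S"
| add: "p \<in> product_span B S \<Longrightarrow> q \<in> product_span B S \<Longrightarrow> p + q \<in> product_span B S"

lemma product_span_mult:
  assumes "p \<in> product_span B S" "\<And>s. s \<in> S \<Longrightarrow> s * t \<in> S'"
  shows "p * t \<in> product_span B S'"
  using assms(1)
proof induction
  case (product b s)
  then show ?case
    using product_span.product[OF product(1) assms(2)[OF product(2)]] by (simp add: mult.assoc)
next
  case (add p q)
  then show ?case
    by (simp add: distrib_right product_span.add)
qed

lemma product_span_sum:
  assumes "0 \<in> product_span B S" "\<And>i. i \<in> I \<Longrightarrow> u i \<in> product_span B S"
  shows "sum u I \<in> product_span B S"
  using assms(2) by (induction I rule: infinite_finite_induct) (auto intro: assms(1) product_span.add)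

locale dihedral_module = comm_group A + M: matrix_module "gen_dihedral A" n \<rho>
  for A :: "('a, 'm) monoid_scheme" (structure) and n and \<rho> :: "'a \<times> int \<Rightarrow> 'k :: field mat" +
  fixes \<beta> :: "'a \<Rightarrow> 'a \<Rightarrow> 'k" and d :: nat
  assumes pairing: "perfect_pairing A \<beta>" and small_davenport: "small_davenport A = enat d"
begin

lemma finite_A: "finite (carrier A)"
  using M.finite_G by (auto simp: carrier_gen_dihedral finite_cartesian_product_iff)

lemma order_A_nonzero: "of_nat (order A) \<noteq> (0 :: 'k)" and two_nonzero: "(2 :: 'k) \<noteq> 0"
  using M.order_nonzero by (auto simp: order_gen_dihedral)

lemmas pairing_mult = perfect_pairing_mult[OF comm_group_axioms pairing]
  and pairing_mult_right = perfect_pairing_mult_right[OF comm_group_axioms pairing]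
  and pairing_one = perfect_pairing_one[OF comm_group_axioms pairing]
  and pairing_finprod = perfect_pairing_finprod[OF comm_group_axioms pairing]
  and pairing_inv = perfect_pairing_inv[OF comm_group_axioms pairing]
  and pairing_orthogonality = perfect_pairing_orthogonality[OF comm_group_axioms pairing]

definition eigenforms :: "'a \<Rightarrow> 'k mpoly set" where
  "eigenforms c = {v \<in> linear_forms n. \<forall>a\<in>carrier A. M.act (a, 0) v = mconst (\<beta> c a) * v}"

abbreviation "H \<equiv> M.act (\<one>, 1)"

sublocale act: unital_hom "M.act g" for g
  by (rule M.act_unital_hom)

lemma rotation_in_DG: "a \<in> carrier A \<Longrightarrow> (a, 0) \<in> carrier (gen_dihedral A)"
  and reflection_in_DG: "a \<in> carrier A \<Longrightarrow> (a, 1) \<in> carrier (gen_dihedral A)"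
  by (auto simp: carrier_gen_dihedral)

lemma H_H: "f \<in> polys_in n \<Longrightarrow> H (H f) = f"
  using M.act_one by (simp add: M.act_act reflection_in_DG mult_gen_dihedral one_gen_dihedral)

lemma rotation_H:
  "a \<in> carrier A \<Longrightarrow> f \<in> polys_in n \<Longrightarrow> M.act (a, 0) (H f) = H (M.act (inv a, 0) f)"
  by (simp add: M.act_act reflection_in_DG rotation_in_DG mult_gen_dihedral)

lemma reflection_eq: "a \<in> carrier A \<Longrightarrow> f \<in> polys_in n \<Longrightarrow> M.act (a, 1) f = H (M.act (a, 0) f)"
  by (simp add: M.act_act reflection_in_DG rotation_in_DG mult_gen_dihedral)

lemma H_eigenforms:
  assumes "c \<in> carrier A" "v \<in> eigenforms c"
  shows "H v \<in> eigenforms (inv c)"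
proof -
  have "M.act (a, 0) (H v) = mconst (\<beta> (inv c) a) * H v" if "a \<in> carrier A" for a
    using that assms by (simp add: rotation_H eigenforms_def linear_forms_polys_in pairing_inv)
  then show ?thesis
    using assms by (simp add: eigenforms_def M.act_linear_forms)
qed

lemma eigenform_decomposition:
  assumes v: "v \<in> linear_forms n"
  obtains p where "\<And>c. c \<in> carrier A \<Longrightarrow> p c \<in> eigenforms c" "v = (\<Sum>c\<in>carrier A. p c)"
proof -
  let ?N = "of_nat (order A) :: 'k"
  \<comment> \<open>The usual projection onto the part of weight \<open>c\<close>, with
    \<open>\<beta> c (inv a)\<close> in the place that the complex conjugate of a character value
    takes over the complex numbers.\<close>
  define p where
    "p c = mconst (1 / ?N) * (\<Sum>a\<in>carrier A. mconst (\<beta> c (inv a)) * M.act (a, 0) v)" for c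
  have v_poly: "v \<in> polys_in n"
    using v by (rule linear_forms_polys_in)
  have "p c \<in> eigenforms c" if c: "c \<in> carrier A" for c
  proof -
    have "M.act (b, 0) (p c) = mconst (\<beta> c b) * p c" if b: "b \<in> carrier A" for b
    proof -
      have "(\<Sum>a\<in>carrier A. mconst (\<beta> c (inv a)) * M.act (a \<otimes> b, 0) v) =
          (\<Sum>a\<in>carrier A. mconst (\<beta> c (inv (a \<otimes> inv b))) * M.act (a, 0) v)"
        using b by (intro sum.reindex_bij_witness[of _ "\<lambda>a. a \<otimes> inv b" "\<lambda>a. a \<otimes> b"])
          (auto simp: m_assoc)
      also have "\<dots> = mconst (\<beta> c b) * (\<Sum>a\<in>carrier A. mconst (\<beta> c (inv a)) * M.act (a, 0) v)"
        unfolding sum_distrib_left using b c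
        by (intro sum.cong) (auto simp: inv_mult pairing_mult_right mult_ac)
      finally show ?thesis
        using b v_poly by (simp add: p_def act.hom_sum M.act_act rotation_in_DG mult_gen_dihedral mult_ac)
    qed
    moreover have "p c \<in> linear_forms n"
      using v unfolding p_def
      by (intro linear_forms_scale linear_forms_sum M.act_linear_forms)
    ultimately show ?thesis
      by (simp add: eigenforms_def)
  qed
  moreover have "v = (\<Sum>c\<in>carrier A. p c)"
  proof -
    \<comment> \<open>After the two sums are exchanged, orthogonality kills every rotation except
      the identity.\<close>
    have "(\<Sum>c\<in>carrier A. p c) =
        mconst (1 / ?N) * (\<Sum>a\<in>carrier A. (\<Sum>c\<in>carrier A. mconst (\<beta> c (inv a))) * M.act (a, 0) v)"
      unfolding p_def sum_distrib_left[symmetric] sum_distrib_right by (subst sum.swap) simp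
    also have "\<dots> = mconst (1 / ?N) *
        (\<Sum>a\<in>carrier A. if a = \<one> then mconst ?N * M.act (\<one>, 0) v else 0)"
      by (intro arg_cong[where f = "\<lambda>x. _ * x"] sum.cong)
        (auto simp: pairing_orthogonality simp flip: mconst.hom_sum)
    also have "\<dots> = mconst (1 / ?N) * (mconst ?N * v)"
      using finite_A M.act_one[OF v_poly] by (simp add: one_gen_dihedral)
    also have "\<dots> = mconst (1 / ?N * ?N) * v"
      by (simp only: mconst.hom_mult mult.assoc)
    finally show ?thesis
      using order_A_nonzero by simp
  qed
  ultimately show thesis
    using that by blast
qed

text \<open>A degree-bounded substitute for the ideal. The invariant 1 is among the generators, so
  every polynomial of degree at most \<open>e\<close> in the variables belongs trivially; the
  content lies in elements of higher degree that can be rewritten with cofactors of degree at most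
  \<open>e\<close>.\<close>

definition low_span :: "nat \<Rightarrow> 'k mpoly set" where
  "low_span e = product_span (M.Inv \<inter> degree_le (d + 2)) (polys_in n \<inter> degree_le e)"

lemma one_invariant: "1 \<in> M.Inv \<inter> degree_le k"
  by (simp add: M.invariants_iff)

lemma low_span_base: "s \<in> polys_in n \<Longrightarrow> s \<in> degree_le e \<Longrightarrow> s \<in> low_span e"
  using product_span.product[OF one_invariant, of s "polys_in n \<inter> degree_le e" "d + 2"]
  by (simp add: low_span_def)

lemma low_span_add: "p \<in> low_span e \<Longrightarrow> q \<in> low_span e \<Longrightarrow> p + q \<in> low_span e"
  unfolding low_span_def by (rule product_span.add)

lemma low_span_sum: "(\<And>i. i \<in> I \<Longrightarrow> u i \<in> low_span e) \<Longrightarrow> sum u I \<in> low_span e"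
  using low_span_base[of 0 e] unfolding low_span_def by (intro product_span_sum) auto

lemma low_span_mult:
  assumes "p \<in> low_span e" "t \<in> polys_in n" "t \<in> degree_le k"
  shows "p * t \<in> low_span (e + k)"
  using assms unfolding low_span_def
  by (elim product_span_mult) (auto intro: polys_in_mult degree_le_mult)

lemma low_span_scale: "p \<in> low_span e \<Longrightarrow> mconst a * p \<in> low_span e"
  using low_span_mult[of p e "mconst a" 0] by (simp add: mult.commute)

text \<open>A product-one set \<open>U\<close> gives an invariant of degree at most
  \<open>d + 2\<close>, and because \<open>U\<close> is nonempty at most \<open>d + 1\<close>
  factors are left as cofactor. So \<open>low_span (d + 1)\<close> can play the role of
  \<open>Q\<close> in the flipping argument.\<close>

lemma prod_eigenforms_low_span:
  assumes I: "finite I" "card I = d + 2" and c: "c \<in> I \<rightarrow> carrier A"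
    and v: "\<And>i. i \<in> I \<Longrightarrow> v i \<in> eigenforms (c i)"
  shows "(\<Prod>i\<in>I. v i) \<in> low_span (d + 1)"
proof (rule prod_mem_of_flips[where c = c and v = v and V = eigenforms and H = H])
  show "- p \<in> low_span (d + 1)" if "p \<in> low_span (d + 1)" for p
    using low_span_scale[OF that, of "- 1"] by simp
  show "p \<in> low_span (d + 1)" if "p + p \<in> low_span (d + 1)" for p
  proof -
    have "mconst (1 / 2) * (p + p) = mconst (1 / 2 + 1 / 2) * p"
      by (simp only: mconst.hom_add distrib_left distrib_right)
    also have "1 / 2 + 1 / 2 = (1 :: 'k)"
      using two_nonzero by (simp add: field_simps)
    finally have half: "mconst (1 / 2) * (p + p) = p"
      by simp
    show ?thesis
      using low_span_scale[OF that, of "1 / 2"] by (simp only: half)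
  qed
  show "H (H w) = w" if "w \<in> eigenforms a" for a w
    using that by (simp add: H_H eigenforms_def linear_forms_polys_in)
next
  fix c v U
  assume c: "c \<in> I \<rightarrow> carrier A" and v: "\<And>i. i \<in> I \<Longrightarrow> v i \<in> eigenforms (c i)"
    and U: "U \<subseteq> I" "U \<noteq> {}" "finprod A c U = \<one>"
  have fin: "finite U" "finite (I - U)"
    using U(1) I(1) by (auto intro: finite_subset)
  have lin: "v i \<in> linear_forms n" if "i \<in> I" for i
    using v[OF that] by (simp add: eigenforms_def)
  define u where "u = (\<Prod>i\<in>U. v i)"
  have u_poly: "u \<in> polys_in n"
    unfolding u_def using lin U(1) by (intro polys_in_prod linear_forms_polys_in) auto
  have H_u: "H u = (\<Prod>i\<in>U. H (v i))"
    by (simp add: u_def act.hom_prod)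
  have u_fixed: "M.act (a, 0) u = u" if a: "a \<in> carrier A" for a
  proof -
    have "M.act (a, 0) u = (\<Prod>i\<in>U. mconst (\<beta> (c i) a) * v i)"
      unfolding u_def act.hom_prod using v U(1) a by (intro prod.cong) (auto simp: eigenforms_def)
    also have "\<dots> = mconst (\<Prod>i\<in>U. \<beta> (c i) a) * u"
      by (simp add: prod.distrib u_def mconst.hom_prod)
    also have "(\<Prod>i\<in>U. \<beta> (c i) a) = \<beta> (finprod A c U) a"
      using c U(1) a fin by (subst pairing_finprod) auto
    finally show ?thesis
      using U(3) a by (simp add: pairing_one)
  qed
  \<comment> \<open>\<open>u\<close> has trivial weight, so rotations fix \<open>u\<close> and, by
    conjugation, \<open>H u\<close>; the reflection interchanges the two.\<close>
  have "u + H u \<in> M.Inv"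
    unfolding M.invariants_iff
  proof (intro conjI ballI)
    show "u + H u \<in> polys_in n"
      using u_poly by (intro polys_in_add M.act_polys_in)
    fix g assume "g \<in> carrier (gen_dihedral A)"
    then obtain a x where g: "g = (a, x)" "a \<in> carrier A" "x = 0 \<or> x = 1"
      by (auto simp: carrier_gen_dihedral)
    have rot: "M.act (b, 0) (u + H u) = u + H u" if "b \<in> carrier A" for b
      using that u_poly by (simp add: u_fixed rotation_H)
    have "H (u + H u) = u + H u"
      using u_poly by (simp add: H_H add.commute)
    then show "M.act g (u + H u) = u + H u"
      using g rot reflection_eq[of a "u + H u"] u_poly by (auto simp: polys_in_add M.act_polys_in)
  qed
  moreover have "u \<in> degree_le (d + 2)"
  proof -
    have "u \<in> degree_le (\<Sum>i\<in>U. 1)"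
      unfolding u_def using lin U(1) fin by (intro degree_le_prod linear_forms_degree_le) auto
    moreover have "card U \<le> d + 2"
      using card_mono[OF I(1) U(1)] I(2) by simp
    ultimately show ?thesis
      by (auto intro: degree_le_mono)
  qed
  then have "u + H u \<in> degree_le (d + 2)"
    by (intro degree_le_add M.act_degree_le)
  moreover have "(\<Prod>i\<in>I - U. v i) \<in> polys_in n"
    using lin by (intro polys_in_prod linear_forms_polys_in) auto
  moreover have "(\<Prod>i\<in>I - U. v i) \<in> degree_le (d + 1)"
  proof -
    have "(\<Prod>i\<in>I - U. v i) \<in> degree_le (\<Sum>i\<in>I - U. 1)"
      using lin fin by (intro degree_le_prod linear_forms_degree_le) auto
    moreover have "card (I - U) < card I"
      using U I(1) by (intro psubset_card_mono) auto
    ultimately show ?thesis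
      using I(2) by (auto intro: degree_le_mono)
  qed
  ultimately show "((\<Prod>i\<in>U. v i) + (\<Prod>i\<in>U. H (v i))) * (\<Prod>i\<in>I - U. v i) \<in> low_span (d + 1)"
    unfolding low_span_def H_u[symmetric] u_def[symmetric] by (intro product_span.product) auto
next
  show "small_davenport A < enat (card I - 1)"
    by (simp add: small_davenport I(2))
qed (fact I(1) c v H_eigenforms low_span_add)+

text \<open>Multilinear expansion, one factor at a time: \<open>W\<close> holds the factors not yet
  known to be eigenforms. The induction keeps \<open>v\<close> arbitrary because a factor is
  replaced by each of its components in turn.\<close>

lemma prod_linear_forms_low_span:
  assumes "finite I" "card I = d + 2" "\<And>i. i \<in> I \<Longrightarrow> v i \<in> linear_forms n"
  shows "(\<Prod>i\<in>I. v i) \<in> low_span (d + 1)"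
proof -
  have "(\<Prod>i\<in>I. v i) \<in> low_span (d + 1)"
    if "finite W" "W \<subseteq> I" "\<And>i. i \<in> W \<Longrightarrow> v i \<in> linear_forms n"
      "\<And>i. i \<in> I - W \<Longrightarrow> \<exists>c\<in>carrier A. v i \<in> eigenforms c" for W v
    using that
  proof (induction W arbitrary: v rule: finite_induct)
    case empty
    then obtain c where "\<And>i. i \<in> I \<Longrightarrow> c i \<in> carrier A \<and> v i \<in> eigenforms (c i)"
      unfolding Diff_empty by metis
    then show ?case
      using assms(1,2) by (intro prod_eigenforms_low_span[of I c]) auto
  next
    case (insert w W)
    obtain p where p: "\<And>c. c \<in> carrier A \<Longrightarrow> p c \<in> eigenforms c" "v w = (\<Sum>c\<in>carrier A. p c)"
      using eigenform_decomposition[of "v w"] insert.prems(2) by blast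
    have w: "w \<in> I"
      using insert.prems(1) by simp
    have split: "(\<Prod>i\<in>I. u i) = u w * (\<Prod>i\<in>I - {w}. u i)" for u :: "_ \<Rightarrow> 'k mpoly"
      using assms(1) w by (rule prod.remove)
    have "(\<Prod>i\<in>I. v i) = (\<Sum>c\<in>carrier A. \<Prod>i\<in>I. (v(w := p c)) i)"
      by (simp add: split p(2) sum_distrib_right)
    also have "\<dots> \<in> low_span (d + 1)"
    proof (rule low_span_sum, rule insert.IH)
      fix c assume "c \<in> carrier A"
      then show "\<exists>c'\<in>carrier A. (v(w := p c)) i \<in> eigenforms c'" if "i \<in> I - W" for i
        using that insert.prems(3) p(1) by (cases "i = w") auto
    qed (use insert in auto)
    finally show ?case .
  qed
  from this[of I v] show ?thesis
    using assms by auto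
qed

section \<open>From products of linear forms to all invariants\<close>

text \<open>In the only interesting degree, \<open>e + 1\<close>, the monomial is cut into
  \<open>d + 2\<close> variables and \<open>e - d - 1\<close> further ones. The first block has
  cofactors of degree at most \<open>d + 1\<close>, and the two bounds add up to
  \<open>e\<close>.\<close>

lemma monomial_low_span:
  assumes m: "Poly_Mapping.keys m \<subseteq> {..<n}" "mono_degree m \<le> Suc e" and e: "d + 1 \<le> e"
  shows "mono_eval mvar m \<in> low_span e"
proof (cases "mono_degree m \<le> e")
  case True
  have "mono_eval mvar m \<in> polys_in n"
    unfolding mono_eval_def using m(1) by (intro polys_in_prod polys_in_power polys_in_mvar) auto
  moreover have "mono_eval mvar m \<in> degree_le e"
    using degree_le_mono_eval[OF degree_le_mvar] True by (rule degree_le_mono)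
  ultimately show ?thesis
    by (rule low_span_base)
next
  case False
  have "\<exists>idx. length idx = mono_degree m \<and> set idx \<subseteq> Poly_Mapping.keys m \<and>
      prod_list (map mvar idx) = (mono_eval mvar m :: 'k mpoly)"
  proof (induction m rule: poly_mapping_singles_induct)
    case (single i k)
    then show ?case
      by (intro exI[of _ "replicate k i"]) (auto simp: prod_list_replicate)
  next
    case (add a b)
    then obtain idx js where "length idx = mono_degree a" "set idx \<subseteq> Poly_Mapping.keys a"
        "prod_list (map mvar idx) = (mono_eval mvar a :: 'k mpoly)"
        "length js = mono_degree b" "set js \<subseteq> Poly_Mapping.keys b"
        "prod_list (map mvar js) = (mono_eval mvar b :: 'k mpoly)"
      by blast
    moreover have "Poly_Mapping.keys a \<union> Poly_Mapping.keys b \<subseteq> Poly_Mapping.keys (a + b)"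
      by (auto simp: in_keys_iff lookup_add)
    ultimately show ?case
      by (intro exI[of _ "idx @ js"]) (auto simp: mono_degree_add mono_eval_add)
  qed
  then obtain idx' where idx': "length idx' = Suc e" "set idx' \<subseteq> {..<n}"
      "prod_list (map mvar idx') = (mono_eval mvar m :: 'k mpoly)"
    using m False by (metis le_SucE subset_trans)
  define js ks where "js = take (d + 2) idx'" and "ks = drop (d + 2) idx'"
  have len: "length js = d + 2" "length ks = e - d - 1"
    using idx'(1) e by (auto simp: js_def ks_def)
  have sub: "set js \<subseteq> {..<n}" "set ks \<subseteq> {..<n}"
    using idx'(2) set_take_subset set_drop_subset unfolding js_def ks_def by fastforce+
  have "prod_list (map mvar js) = (\<Prod>i\<in>{0..<d + 2}. mvar (js ! i) :: 'k mpoly)"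
    by (simp add: prod.list_conv_set_nth len)
  also have "\<dots> \<in> low_span (d + 1)"
  proof (intro prod_linear_forms_low_span linear_forms_mvar)
    fix i assume "i \<in> {0..<d + 2}"
    then have "js ! i \<in> set js"
      using len(1) by simp
    then show "js ! i < n"
      using sub(1) by blast
  qed simp_all
  finally have "prod_list (map mvar js) \<in> low_span (d + 1)" .
  moreover have "prod_list (map mvar ks) \<in> polys_in n" if "set ks \<subseteq> {..<n}" for ks
    using that by (induction ks) (auto intro: polys_in_mult polys_in_mvar)
  moreover have "prod_list (map mvar ks) \<in> degree_le (length ks)" for ks
    using degree_le_mult[OF degree_le_mvar] by (induction ks) auto
  ultimately have "prod_list (map mvar js) * prod_list (map mvar ks) \<in> low_span (d + 1 + (e - d - 1))"
    using sub len by (metis low_span_mult)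
  moreover have "prod_list (map mvar js) * prod_list (map mvar ks) = (mono_eval mvar m :: 'k mpoly)"
    unfolding idx'(3)[symmetric] js_def ks_def
    by (simp flip: prod_list.append map_append)
  ultimately show ?thesis
    using e by simp
qed

text \<open>An invariant equals its own average. Averaging its expression in
  \<open>low_span e\<close> leaves the low invariants in place and turns each cofactor into an
  invariant of degree at most \<open>e\<close>, to which the induction hypothesis applies.\<close>

lemma invariant_in_generated_algebra:
  assumes "f \<in> M.Inv" "f \<in> degree_le e"
  shows "f \<in> generated_algebra (M.Inv \<inter> degree_le (d + 2))"
  using assms
proof (induction e arbitrary: f)
  case 0
  then show ?case
    by (auto intro: generated_algebra.gen degree_le_mono)
next
  case (Suc e)
  show ?case
  proof (cases "Suc e \<le> d + 2")
    case True
    then show ?thesis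
      using Suc.prems by (auto intro: generated_algebra.gen degree_le_mono)
  next
    case False
    have "(\<Sum>m\<in>Poly_Mapping.keys f. mconst (Poly_Mapping.lookup f m) * mono_eval mvar m) \<in> low_span e"
    proof (intro low_span_sum low_span_scale monomial_low_span)
      fix m assume "m \<in> Poly_Mapping.keys f"
      then show "Poly_Mapping.keys m \<subseteq> {..<n}" "mono_degree m \<le> Suc e"
        using Suc.prems by (auto simp: M.invariants_iff polys_in_def degree_le_def)
    qed (use False in simp)
    then have "f \<in> low_span e"
      by (simp only: mpoly_sum_monomials)
    moreover have "M.reynolds q \<in> generated_algebra (M.Inv \<inter> degree_le (d + 2))" if "q \<in> low_span e" for q
      using that unfolding low_span_def
    proof induction
      case (product b s)
      then have "M.reynolds s \<in> generated_algebra (M.Inv \<inter> degree_le (d + 2))"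
        by (intro Suc.IH) (auto intro: M.reynolds_invariant M.reynolds_degree_le)
      then show ?case
        using product by (auto simp: M.reynolds_invariant_mult intro: generated_algebra.intros)
    next
      case (add p q)
      then show ?case
        by (simp add: M.reynolds_add generated_algebra.add)
    qed
    ultimately have "M.reynolds f \<in> generated_algebra (M.Inv \<inter> degree_le (d + 2))"
      by blast
    then show ?thesis
      using M.reynolds_id[OF Suc.prems(1)] by simp
  qed
qed

lemma invariants_subset_generated_algebra:
  "M.Inv \<subseteq> generated_algebra (M.Inv \<inter> degree_le (d + 2))"
proof
  fix f assume "f \<in> M.Inv"
  \<comment> \<open>A crude bound suffices, since it only has to start the induction.\<close>
  moreover have "f \<in> degree_le (\<Sum>m\<in>Poly_Mapping.keys f. mono_degree m)"
    unfolding degree_le_def by (auto intro: member_le_sum)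
  ultimately show "f \<in> generated_algebra (M.Inv \<inter> degree_le (d + 2))"
    by (rule invariant_in_generated_algebra)
qed

end


section \<open>An indecomposable invariant\<close>

text \<open>Monomial matrices: \<open>q\<close> permutes a basis indexed by \<open>S\<close> and
  \<open>s\<close> supplies the scalars. The right-action law for \<open>q\<close> and the cocycle
  law for \<open>s\<close> express that these matrices multiply correctly.\<close>

lemma signed_permutation_module:
  fixes G :: "('g, 'y) monoid_scheme" and s :: "'g \<Rightarrow> 'x \<Rightarrow> 'f :: field"
  assumes "group G" "finite S"
    and q: "\<And>g x. g \<in> carrier G \<Longrightarrow> x \<in> S \<Longrightarrow> q g x \<in> S"
    and q_one: "\<And>x. x \<in> S \<Longrightarrow> q \<one>\<^bsub>G\<^esub> x = x"
    and q_mult: "\<And>g h x. g \<in> carrier G \<Longrightarrow> h \<in> carrier G \<Longrightarrow> x \<in> S \<Longrightarrow> q (g \<otimes>\<^bsub>G\<^esub> h) x = q h (q g x)"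
    and s_one: "\<And>x. x \<in> S \<Longrightarrow> s \<one>\<^bsub>G\<^esub> x = 1"
    and s_mult: "\<And>g h x. g \<in> carrier G \<Longrightarrow> h \<in> carrier G \<Longrightarrow> x \<in> S \<Longrightarrow>
      s (g \<otimes>\<^bsub>G\<^esub> h) x = s g x * s h (q g x)"
  obtains n \<rho> vr where "\<rho> \<in> matrix_modules G n" "bij_betw vr S {..<n}"
    "\<And>g x. g \<in> carrier G \<Longrightarrow> x \<in> S \<Longrightarrow> mat_act n (\<rho> g) (mvar (vr x)) = mconst (s g x) * mvar (vr (q g x))"
proof -
  obtain vr where vr: "bij_betw vr S {0..<card S}"
    using ex_bij_betw_finite_nat[OF assms(2)] by blast
  define n where "n = card S"
  define ix where "ix = the_inv_into S vr"
  have vr': "bij_betw vr S {..<n}"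
    using vr by (simp add: n_def atLeast0LessThan)
  have ix: "ix i \<in> S" "vr (ix i) = i" if "i < n" for i
    using that vr' unfolding ix_def
    by (auto simp: bij_betw_def the_inv_into_into f_the_inv_into_f)
  have ix_var: "ix (vr x) = x" if "x \<in> S" for x
    using that vr' unfolding ix_def by (simp add: bij_betw_def the_inv_into_f_f)
  have var_n: "vr x < n" if "x \<in> S" for x
    using that vr' by (auto simp: bij_betw_def)
  define \<rho> where "\<rho> g = mat n n (\<lambda>(i, j). if j = vr (q g (ix i)) then s g (ix i) else 0)" for g
  have "\<rho> \<in> matrix_modules G n"
  proof (rule matrix_modulesI[OF assms(1)])
    fix g h assume gh: "g \<in> carrier G" "h \<in> carrier G"
    show "\<rho> (g \<otimes>\<^bsub>G\<^esub> h) = \<rho> g * \<rho> h"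
    proof (rule eq_matI)
      fix i j assume "i < dim_row (\<rho> g * \<rho> h)" "j < dim_col (\<rho> g * \<rho> h)"
      then have ij: "i < n" "j < n"
        by (simp_all add: \<rho>_def)
      let ?k = "vr (q g (ix i))"
      have k: "?k < n" "ix ?k = q g (ix i)"
        using ij ix q gh by (simp_all add: var_n ix_var)
      have "(\<rho> g * \<rho> h) $$ (i, j) = (\<Sum>k<n. (if k = ?k then s g (ix i) else 0) *
          (if j = vr (q h (ix k)) then s h (ix k) else 0))"
        using ij by (simp add: \<rho>_def scalar_prod_def atLeast0LessThan)
      also have "\<dots> = (\<Sum>k<n. if k = ?k then s g (ix i) *
          (if j = vr (q h (ix k)) then s h (ix k) else 0) else 0)"
        by (intro sum.cong) auto
      also have "\<dots> = s g (ix i) * (if j = vr (q h (ix ?k)) then s h (ix ?k) else 0)"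
        using k(1) by simp
      finally show "\<rho> (g \<otimes>\<^bsub>G\<^esub> h) $$ (i, j) = (\<rho> g * \<rho> h) $$ (i, j)"
        using ij gh ix by (simp add: \<rho>_def k q_mult s_mult)
    qed (simp_all add: \<rho>_def)
  next
    show "\<rho> \<one>\<^bsub>G\<^esub> = 1\<^sub>m n"
      using ix by (intro eq_matI) (auto simp: \<rho>_def q_one s_one)
  qed (simp add: \<rho>_def)
  moreover have "mat_act n (\<rho> g) (mvar (vr x)) = mconst (s g x) * mvar (vr (q g x))"
    if "g \<in> carrier G" "x \<in> S" for g x
  proof -
    have "mat_act n (\<rho> g) (mvar (vr x)) = (\<Sum>j<n. if j = vr (q g x) then mconst (s g x) * mvar j else 0)"
      unfolding mat_act_mvar using that var_n[of x]
      by (intro sum.cong) (auto simp: \<rho>_def ix_var)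
    then show ?thesis
      using that q var_n by simp
  qed
  ultimately show thesis
    using that vr' by blast
qed

text \<open>Every monomial is an eigenvector, so invariance under a diagonal substitution can be
  read off one coefficient at a time.\<close>

lemma lookup_diagonal_substitution:
  "Poly_Mapping.lookup (mpoly_eval mconst (\<lambda>i. mconst (u i) * mvar i) f) m =
    mono_eval u m * Poly_Mapping.lookup f m"
proof (induction f rule: poly_mapping_singles_induct)
  case (single m' a)
  have "mono_eval (\<lambda>i. mconst (u i) * mvar i) m' = mconst (mono_eval u m') * mono_eval mvar m'"
    by (simp add: mono_eval_def power_mult_distrib prod.distrib mconst.hom_prod)
  then show ?case
    by (simp add: mpoly_eval_unital_hom(2)[OF mconst_unital_hom] mono_eval_mvar lookup_single when_def)
next
  case (add f g)
  then show ?case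
    by (simp add: unital_hom.hom_add[OF mpoly_eval_unital_hom(1)[OF mconst_unital_hom]]
        lookup_add distrib_left)
qed

text \<open>Over \<open>K\<close>, the invariant \<open>\<Sum>\<^sub>g g (x\<^sub>0 \<cdots> x\<^sub>d z)\<close>, where \<open>x\<^sub>0, \<dots>, x\<^sub>d\<close> have the weights of a minimal
  product-one sequence and \<open>z\<close> spans the sign representation, is not a polynomial in invariants of
  smaller degree: the only candidate factor of its monomials, \<open>z\<close>, is not invariant. Over \<open>F\<close>,
  the weight vector \<open>x\<^sub>t\<close> is replaced by a copy of the regular representation, which the map
  \<open>\<Theta>\<close> below projects back to \<open>x\<^sub>t\<close>.\<close>

lemma noether_number_gen_dihedral_lower_bound:
  fixes A :: "('a, 'm) monoid_scheme" and \<beta> :: "'a \<Rightarrow> 'a \<Rightarrow> 'f :: field alg_closure"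
  assumes "comm_group A" "finite (carrier A)"
    and order_nonzero: "of_nat (order (gen_dihedral A)) \<noteq> (0 :: 'f)"
    and pairing: "perfect_pairing A \<beta>" and small_davenport: "small_davenport A = enat d"
  shows "enat (d + 2) \<le> noether_number TYPE('f) (gen_dihedral A)"
proof -
  interpret comm_group A by fact
  let ?G = "gen_dihedral A"
  interpret D: group ?G by (rule group_gen_dihedral) fact
  have "of_nat (order A) \<noteq> (0 :: 'f)" "(2 :: 'f) \<noteq> 0"
    using order_nonzero by (auto simp: order_gen_dihedral)
  then have order_A: "of_nat (order A) \<noteq> (0 :: 'f alg_closure)" and two: "(2 :: 'f alg_closure) \<noteq> 0"
    by (metis to_ac_eq_0_iff to_ac_of_nat, metis to_ac_eq_0_iff to_ac_numeral)
  obtain c where c: "c \<in> {..d} \<rightarrow> carrier A" "finprod A c {..d} = \<one>\<^bsub>A\<^esub>"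
    and minimal: "\<And>U. U \<subseteq> {..d} \<Longrightarrow> U \<noteq> {} \<Longrightarrow> finprod A c U = \<one>\<^bsub>A\<^esub> \<Longrightarrow> U = {..d}"
    using minimal_product_one_sequence[OF assms(2)] small_davenport
    by (metis enat.inject)
  \<comment> \<open>\<open>None\<close> indexes the variable of the sign representation, and
    \<open>Some (t, k)\<close> the basis vector \<open>k\<close> in the \<open>t\<close>-th copy of
    the regular representation.\<close>
  define S :: "(nat \<times> 'a \<times> int) option set" where "S = insert None (Some ` ({..d} \<times> carrier ?G))"
  define q :: "'a \<times> int \<Rightarrow> (nat \<times> 'a \<times> int) option \<Rightarrow> (nat \<times> 'a \<times> int) option"
    where "q g = map_option (map_prod id (\<lambda>k. k \<otimes>\<^bsub>?G\<^esub> g))" for g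
  define s :: "'a \<times> int \<Rightarrow> (nat \<times> 'a \<times> int) option \<Rightarrow> 'f"
    where "s g x = (if x = None \<and> snd g = 1 then - 1 else 1)" for g x
  have fin_G: "finite (carrier ?G)"
    using assms(2) by (simp add: carrier_gen_dihedral)
  obtain n \<rho> vr where \<rho>: "\<rho> \<in> matrix_modules ?G n" and vr: "bij_betw vr S {..<n}"
    and act_var: "\<And>g x. g \<in> carrier ?G \<Longrightarrow> x \<in> S \<Longrightarrow>
      mat_act n (\<rho> g) (mvar (vr x)) = mconst (s g x) * mvar (vr (q g x))"
  proof (rule signed_permutation_module[of ?G S q s])
    show "finite S"
      using fin_G by (simp add: S_def)
    show "s (g \<otimes>\<^bsub>?G\<^esub> h) x = s g x * s h (q g x)"
      if "g \<in> carrier ?G" "h \<in> carrier ?G" "x \<in> S" for g h x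
      using that by (auto simp: carrier_gen_dihedral mult_gen_dihedral s_def q_def)
    show "s \<one>\<^bsub>?G\<^esub> x = 1" for x
      by (simp add: s_def one_gen_dihedral)
    show "q \<one>\<^bsub>?G\<^esub> x = x" if "x \<in> S" for x
      using that by (auto simp: S_def q_def)
    show "q (g \<otimes>\<^bsub>?G\<^esub> h) x = q h (q g x)"
      if "g \<in> carrier ?G" "h \<in> carrier ?G" "x \<in> S" for g h x
      using that by (auto simp: S_def q_def D.m_assoc)
    show "q g x \<in> S" if "g \<in> carrier ?G" "x \<in> S" for g x
      using that by (auto simp: S_def q_def)
  qed (use D.is_group that in blast)+
  interpret M: matrix_module ?G n \<rho>
    by unfold_locales (use fin_G order_nonzero \<rho> in auto)
  define ix where "ix = the_inv_into S vr"
  have ix: "ix i \<in> S" "vr (ix i) = i" if "i < n" for i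
    using that vr unfolding ix_def by (auto simp: bij_betw_def the_inv_into_into f_the_inv_into_f)
  have ix_var: "ix (vr x) = x" if "x \<in> S" for x
    using that vr unfolding ix_def by (simp add: bij_betw_def the_inv_into_f_f)
  have var_n: "vr x < n" if "x \<in> S" for x
    using that vr by (auto simp: bij_betw_def)
  \<comment> \<open>Each regular copy is projected onto weight \<open>c t\<close> using its
    rotations only; basis vectors belonging to reflections go to 0. The target has one variable per
    weight, and \<open>mvar (d + 1)\<close> is the sign variable.\<close>
  define \<tau> :: "(nat \<times> 'a \<times> int) option \<Rightarrow> 'f alg_closure mpoly" where
    "\<tau> x = (case x of None \<Rightarrow> mvar (d + 1)
      | Some (t, b, e) \<Rightarrow> if e = 0 then mconst (\<beta> (c t) b) * mvar t else 0)" for x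
  define \<sigma> where "\<sigma> i = (if i < n then \<tau> (ix i) else 0)" for i
  have K: "unital_hom (\<lambda>a. mconst (to_ac a) :: 'f alg_closure mpoly)"
    by (simp add: unital_hom_def)
  define \<Theta> where "\<Theta> = mpoly_eval (\<lambda>a. mconst (to_ac a)) \<sigma>"
  have hom_\<Theta>: "unital_hom \<Theta>"
    unfolding \<Theta>_def by (rule mpoly_eval_unital_hom[OF K])
  interpret \<Theta>: unital_hom \<Theta> by (rule hom_\<Theta>)
  have \<Theta>_const [simp]: "\<Theta> (mconst a) = mconst (to_ac a)" for a
    by (simp add: \<Theta>_def K)
  have \<Theta>_var: "\<Theta> (mvar (vr x)) = \<tau> x" if "x \<in> S" for x
    using that by (simp add: \<Theta>_def K \<sigma>_def var_n ix_var)
  have \<Theta>_degree: "\<Theta> f \<in> degree_le k" if "f \<in> degree_le k" for f k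
    unfolding \<Theta>_def
  proof (rule degree_le_mpoly_eval[OF _ that])
    fix i
    have "\<tau> x \<in> degree_le 1" for x
      using degree_le_mult[OF degree_le_mconst[of _ 0] degree_le_mvar] degree_le_mvar
      by (auto simp: \<tau>_def split: option.split)
    then show "\<sigma> i \<in> degree_le 1"
      by (simp add: \<sigma>_def)
  qed
  define diag where "diag u = mpoly_eval mconst (\<lambda>i. mconst (u i) * mvar i)"
    for u :: "nat \<Rightarrow> 'f alg_closure"
  have hom_diag: "unital_hom (diag u)" for u
    unfolding diag_def by (rule mpoly_eval_unital_hom[OF mconst_unital_hom])
  have diag_simps [simp]: "diag u (mconst a) = mconst a" "diag u (mvar i) = mconst (u i) * mvar i"
    "diag u 0 = 0" "diag u (- f) = - diag u f" "diag u (f * g) = diag u f * diag u g" for u a i f g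
    by (simp_all add: diag_def mconst_unital_hom unital_hom.hom_zero[OF hom_diag, unfolded diag_def]
        unital_hom.hom_uminus[OF hom_diag, unfolded diag_def]
        unital_hom.hom_mult[OF hom_diag, unfolded diag_def])
  have lookup_diag: "Poly_Mapping.lookup (diag u f) m = mono_eval u m * Poly_Mapping.lookup f m" for u f m
    by (simp add: diag_def lookup_diagonal_substitution)
  define w where "w a i = (if i \<le> d then \<beta> (c i) a else 1)" for a i
  \<comment> \<open>Right multiplication by a rotation shifts the first component of the rotation
    basis vectors, and bimultiplicativity of \<open>\<beta>\<close> turns the shift into the scalar
    \<open>\<beta> (c t) a\<close>.\<close>
  have rotation: "\<Theta> (M.act (a, 0) f) = diag (w a) (\<Theta> f)" if a: "a \<in> carrier A" and f: "f \<in> polys_in n" for a f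
  proof (rule unital_hom_eq_on_polys_in[OF _ _ _ _ f])
    show "unital_hom (\<lambda>f. \<Theta> (M.act (a, 0) f))" "unital_hom (\<lambda>f. diag (w a) (\<Theta> f))"
      by (rule unital_hom_comp[OF hom_\<Theta> M.act_unital_hom], rule unital_hom_comp[OF hom_diag hom_\<Theta>])
    fix i assume "i < n"
    then obtain x where x: "x \<in> S" "i = vr x"
      using ix by metis
    have g: "(a, 0) \<in> carrier ?G"
      using a by (simp add: carrier_gen_dihedral)
    have "q (a, 0) x \<in> S"
      using x g by (auto simp: S_def q_def)
    then have "\<Theta> (M.act (a, 0) (mvar i)) = \<tau> (q (a, 0) x)"
      using x g by (simp add: M.act_def act_var \<Theta>_var s_def)
    also have "\<dots> = diag (w a) (\<tau> x)"
    proof (cases x)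
      case None
      then show ?thesis by (simp add: q_def \<tau>_def w_def)
    next
      case (Some y)
      then obtain t b e where y: "x = Some (t, b, e)" "t \<le> d" "b \<in> carrier A" "e = 0 \<or> e = 1"
        using x by (cases y) (auto simp: S_def carrier_gen_dihedral)
      have "c t \<in> carrier A"
        using c(1) y(2) by auto
      then have "\<beta> (c t) (b \<otimes>\<^bsub>A\<^esub> a) = \<beta> (c t) b * \<beta> (c t) a"
        using perfect_pairing_mult_right[OF assms(1) pairing] y(3) a by simp
      then show ?thesis
        using y by (auto simp: q_def \<tau>_def w_def mult_gen_dihedral mult_ac)
    qed
    finally show "\<Theta> (M.act (a, 0) (mvar i)) = diag (w a) (\<Theta> (mvar i))"
      using x by (simp add: \<Theta>_var)
  qed simp
  \<comment> \<open>\<open>\<Theta>\<close> does not intertwine the reflection, which exchanges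
    rotations and reflections in each regular copy. Once the variables up to index \<open>d\<close>
    are set to 0, only the sign variable remains, and there the reflection acts by -1.\<close>
  define z where "z e i = (if i \<le> d then 0 else e)" for e :: "'f alg_closure" and i :: nat
  have reflection: "diag (z 1) (\<Theta> (M.act (\<one>\<^bsub>A\<^esub>, 1) f)) = diag (z (- 1)) (\<Theta> f)" if f: "f \<in> polys_in n" for f
  proof (rule unital_hom_eq_on_polys_in[OF _ _ _ _ f])
    show "unital_hom (\<lambda>f. diag (z 1) (\<Theta> (M.act (\<one>\<^bsub>A\<^esub>, 1) f)))" "unital_hom (\<lambda>f. diag (z (- 1)) (\<Theta> f))"
      by (rule unital_hom_comp[OF hom_diag unital_hom_comp[OF hom_\<Theta> M.act_unital_hom]],
          rule unital_hom_comp[OF hom_diag hom_\<Theta>])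
    fix i assume "i < n"
    then obtain x where x: "x \<in> S" "i = vr x"
      using ix by metis
    have g: "(\<one>\<^bsub>A\<^esub>, 1) \<in> carrier ?G"
      by (simp add: carrier_gen_dihedral)
    have "q (\<one>\<^bsub>A\<^esub>, 1) x \<in> S"
      using x g by (auto simp: S_def q_def)
    then have "\<Theta> (M.act (\<one>\<^bsub>A\<^esub>, 1) (mvar i)) = mconst (to_ac (s (\<one>\<^bsub>A\<^esub>, 1) x)) * \<tau> (q (\<one>\<^bsub>A\<^esub>, 1) x)"
      using x g by (simp add: M.act_def act_var \<Theta>_var)
    moreover have "diag (z 1) (mconst (to_ac (s (\<one>\<^bsub>A\<^esub>, 1) x)) * \<tau> (q (\<one>\<^bsub>A\<^esub>, 1) x)) = diag (z (- 1)) (\<tau> x)"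
      using x by (cases x)
        (auto simp: S_def q_def \<tau>_def z_def s_def mult_gen_dihedral carrier_gen_dihedral)
    ultimately show "diag (z 1) (\<Theta> (M.act (\<one>\<^bsub>A\<^esub>, 1) (mvar i))) = diag (z (- 1)) (\<Theta> (mvar i))"
      using x by (simp add: \<Theta>_var)
  qed simp
  define m_z where "m_z = Poly_Mapping.single (d + 1) (1 :: nat)"
  define m_top where "m_top = (\<Sum>t\<le>d. Poly_Mapping.single t (1 :: nat)) + m_z"
  have lookup_top: "Poly_Mapping.lookup m_top i = (if i \<le> d + 1 then 1 else 0)" for i
    by (auto simp: m_top_def m_z_def lookup_add lookup_sum lookup_single when_def)
  have mono_degree_sum: "mono_degree (sum u I) = (\<Sum>i\<in>I. mono_degree (u i))"
    for u :: "nat \<Rightarrow> nat \<Rightarrow>\<^sub>0 nat" and I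
    by (induction I rule: infinite_finite_induct) (simp_all add: mono_degree_add)
  have degree_top: "mono_degree m_top = d + 2"
    by (simp add: m_top_def m_z_def mono_degree_add mono_degree_sum)
  \<comment> \<open>A set that catches the images of all polynomials in invariants of degree at most
    \<open>d + 1\<close>. Invariance under rotations gives trivial weight, and the sign of the
    reflection excludes \<open>m_z\<close>; excluding \<open>m_z\<close> keeps \<open>m_top\<close>
    from arising as a product.\<close>
  define T where "T = {P :: 'f alg_closure mpoly. \<forall>m\<in>Poly_Mapping.keys P.
    (\<forall>a\<in>carrier A. mono_eval (w a) m = 1) \<and> m \<noteq> m_z \<and> m \<noteq> m_top}"
  have small: "\<Theta> f \<in> T" if f: "f \<in> M.Inv" "f \<in> degree_le (d + 1)" for f
    unfolding T_def
  proof (intro CollectI ballI conjI)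
    fix m assume m: "m \<in> Poly_Mapping.keys (\<Theta> f)"
    have f_poly: "f \<in> polys_in n" and f_fixed: "\<And>g. g \<in> carrier ?G \<Longrightarrow> M.act g f = f"
      using f(1) by (auto simp: M.invariants_iff)
    show "m \<noteq> m_top"
      using \<Theta>_degree[OF f(2)] m degree_top by (auto simp: degree_le_def)
    show "mono_eval (w a) m = 1" if a: "a \<in> carrier A" for a
    proof -
      have "\<Theta> f = diag (w a) (\<Theta> f)"
        using rotation[OF a f_poly] f_fixed[of "(a, 0)"] a by (simp add: carrier_gen_dihedral)
      then have "Poly_Mapping.lookup (\<Theta> f) m = mono_eval (w a) m * Poly_Mapping.lookup (\<Theta> f) m"
        by (metis lookup_diag)
      then show ?thesis
        using m by (simp add: in_keys_iff)
    qed
    show "m \<noteq> m_z"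
    proof
      assume m_z: "m = m_z"
      have "diag (z 1) (\<Theta> f) = diag (z (- 1)) (\<Theta> f)"
        using reflection[OF f_poly] f_fixed[of "(\<one>\<^bsub>A\<^esub>, 1)"] by (simp add: carrier_gen_dihedral)
      then have "mono_eval (z 1) m * Poly_Mapping.lookup (\<Theta> f) m =
          mono_eval (z (- 1)) m * Poly_Mapping.lookup (\<Theta> f) m"
        by (metis lookup_diag)
      then have "2 * Poly_Mapping.lookup (\<Theta> f) m = 0"
        by (simp add: m_z m_z_def z_def eq_neg_iff_add_eq_0)
      then show False
        using two m by (simp add: in_keys_iff)
    qed
  qed
  \<comment> \<open>Trivial weight makes the indices up to \<open>d\<close> that occur in
    \<open>a\<close> a product-one subset of a minimal product-one sequence. So \<open>a\<close> or
    \<open>b\<close> contains none of these variables and is a power of the sign variable, with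
    exponent at most 1.\<close>
  have indecomposable: "a = 0 \<or> b = 0 \<or> a = m_z \<or> b = m_z"
    if ab: "a + b = m_top" and a_weight: "\<forall>x\<in>carrier A. mono_eval (w x) a = 1" for a b
  proof -
    have ab_lookup: "Poly_Mapping.lookup a i + Poly_Mapping.lookup b i = (if i \<le> d + 1 then 1 else 0)" for i
      using lookup_top[of i] by (simp add: lookup_add flip: ab)
    have le_one: "Poly_Mapping.lookup a i = 0 \<or> Poly_Mapping.lookup a i = 1" for i
      using ab_lookup[of i] by (auto split: if_splits)
    define U where "U = {t. t \<le> d \<and> Poly_Mapping.lookup a t = 1}"
    have U: "U \<subseteq> {..d}" "c \<in> U \<rightarrow> carrier A"
      using c(1) by (auto simp: U_def)
    have finprod_U: "finprod A c U \<in> carrier A"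
      using U by (intro finprod_closed)
    have "\<beta> (finprod A c U) x = 1" if x: "x \<in> carrier A" for x
    proof -
      have "Poly_Mapping.keys a \<subseteq> {..d + 1}"
        using ab_lookup by (force simp: in_keys_iff split: if_splits)
      then have "mono_eval (w x) a = (\<Prod>t\<le>d + 1. w x t ^ Poly_Mapping.lookup a t)"
        by (intro mono_eval_superset) auto
      also have "\<dots> = (\<Prod>t\<in>U. \<beta> (c t) x)"
      proof (intro prod.mono_neutral_cong_right ballI)
        show "w x t ^ Poly_Mapping.lookup a t = 1" if "t \<in> {..d + 1} - U" for t
          using that le_one[of t] by (auto simp: U_def w_def)
      qed (auto simp: U_def w_def)
      also have "\<dots> = \<beta> (finprod A c U) x"
        using U x finite_subset[OF U(1)]
        by (intro perfect_pairing_finprod[OF assms(1) pairing, symmetric]) auto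
      finally show ?thesis
        using a_weight x by simp
    qed
    then have "finprod A c U = \<one>\<^bsub>A\<^esub>"
      using perfect_pairing_nondegenerate[OF assms(1) pairing finprod_U] by metis
    then have "U = {} \<or> U = {..d}"
      using minimal[OF U(1)] by blast
    then show ?thesis
    proof
      assume "U = {}"
      then have "Poly_Mapping.lookup a t = 0" if "t \<noteq> d + 1" for t
        using that le_one[of t] ab_lookup[of t] by (cases "t \<le> d") (auto simp: U_def)
      then have "a = Poly_Mapping.single (d + 1) (Poly_Mapping.lookup a (d + 1))"
        by (intro poly_mapping_eqI) (auto simp: lookup_single when_def)
      then show ?thesis
        using le_one[of "d + 1"] unfolding m_z_def by (metis single_zero)
    next
      assume "U = {..d}"
      then have "Poly_Mapping.lookup a t = 1" if "t \<le> d" for t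
        using that by (auto simp: U_def)
      then have "Poly_Mapping.lookup b t = 0" if "t \<noteq> d + 1" for t
        using that ab_lookup[of t] by (cases "t \<le> d") auto
      then have "b = Poly_Mapping.single (d + 1) (Poly_Mapping.lookup b (d + 1))"
        by (intro poly_mapping_eqI) (auto simp: lookup_single when_def)
      moreover have "Poly_Mapping.lookup b (d + 1) = 0 \<or> Poly_Mapping.lookup b (d + 1) = 1"
        using ab_lookup[of "d + 1"] by auto
      ultimately show ?thesis
        unfolding m_z_def by (metis single_zero)
    qed
  qed
  have T_algebra: "\<Theta> f \<in> T"
    if "f \<in> generated_algebra B" "B \<subseteq> M.Inv \<inter> degree_le (d + 1)" for f B
    using that(1)
  proof induction
    case (gen f)
    then show ?case using small that(2) by auto
  next
    case (const a)
    have "Poly_Mapping.lookup m_z (d + 1) \<noteq> 0"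
      by (simp add: m_z_def)
    then have "m_z \<noteq> 0" "m_top \<noteq> 0"
      using lookup_top[of 0] by auto
    then show ?case
      using keys_mconst_subset[of "to_ac a"] by (fastforce simp: T_def)
  next
    case (add f g)
    then show ?case
      using keys_add[of "\<Theta> f" "\<Theta> g"] by (fastforce simp: T_def)
  next
    case (mult f g)
    show ?case
      unfolding T_def
    proof (intro CollectI ballI)
      fix m assume "m \<in> Poly_Mapping.keys (\<Theta> (f * g))"
      then obtain a b where ab: "m = a + b" "a \<in> Poly_Mapping.keys (\<Theta> f)" "b \<in> Poly_Mapping.keys (\<Theta> g)"
        using keys_mult[of "\<Theta> f" "\<Theta> g"] by auto
      have a: "\<forall>x\<in>carrier A. mono_eval (w x) a = 1" "a \<noteq> m_z" "a \<noteq> m_top"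
        and b: "\<forall>x\<in>carrier A. mono_eval (w x) b = 1" "b \<noteq> m_z" "b \<noteq> m_top"
        using mult.IH ab by (auto simp: T_def)
      have "m \<noteq> m_top"
        using indecomposable[of a b] a b ab(1) by auto
      \<comment> \<open>\<open>m_z\<close> is a single variable, so one factor would be 1 and the
        other \<open>m_z\<close> itself.\<close>
      moreover have "m \<noteq> m_z"
      proof
        assume "m = m_z"
        then have sum: "Poly_Mapping.lookup a i + Poly_Mapping.lookup b i = (if i = d + 1 then 1 else 0)" for i
          using arg_cong[OF ab(1), of "\<lambda>m. Poly_Mapping.lookup m i"]
          by (auto simp: m_z_def lookup_add lookup_single when_def)
        have "a = 0 \<or> b = 0"
        proof (cases "Poly_Mapping.lookup a (d + 1) = 0")
          case True
          then have "Poly_Mapping.lookup a i = 0" for i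
            using sum[of i] by (cases "i = d + 1") auto
          then show ?thesis by (simp add: poly_mapping_eqI)
        next
          case False
          then have "Poly_Mapping.lookup b i = 0" for i
            using sum[of i] by (cases "i = d + 1") auto
          then show ?thesis by (simp add: poly_mapping_eqI)
        qed
        then show False
          using \<open>m = m_z\<close> ab(1) a b by auto
      qed
      ultimately show "(\<forall>x\<in>carrier A. mono_eval (w x) m = 1) \<and> m \<noteq> m_z \<and> m \<noteq> m_top"
        using a b by (simp add: ab(1) mono_eval_add)
    qed
  qed
  define f where "f = (\<Sum>g\<in>carrier ?G. M.act g
    ((\<Prod>t\<le>d. mvar (vr (Some (t, \<one>\<^bsub>?G\<^esub>)))) * mvar (vr None)))"
  have S_mem: "Some (t, k) \<in> S" if "t \<le> d" "k \<in> carrier ?G" for t k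
    using that by (simp add: S_def)
  have None_mem: "None \<in> S"
    by (simp add: S_def)
  have f_Inv: "f \<in> M.Inv"
    unfolding f_def using S_mem None_mem D.one_closed
    by (intro M.sum_act_invariant polys_in_mult polys_in_prod polys_in_mvar var_n) auto
  \<comment> \<open>Each rotation contributes the top monomial with coefficient 1, because the
    weights multiply to the identity. Reflections, which would enter with sign -1, are killed by
    \<open>\<tau>\<close>, so nothing cancels.\<close>
  have \<Theta>_f: "\<Theta> f = of_nat (order A) * Poly_Mapping.single m_top 1"
  proof -
    have top_eq: "(\<Prod>t\<le>d. mvar t) * mvar (d + 1) = (Poly_Mapping.single m_top 1 :: 'f alg_closure mpoly)"
    proof -
      have "(\<Prod>t\<in>I. mvar t) = (Poly_Mapping.single (\<Sum>t\<in>I. Poly_Mapping.single t 1) 1 :: 'f alg_closure mpoly)"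
        if "finite I" for I
        using that by (induction I rule: finite_induct) (simp_all add: mvar_def mult_single)
      then show ?thesis
        by (simp add: m_top_def m_z_def mvar_def mult_single)
    qed
    have act_term: "\<Theta> (M.act g ((\<Prod>t\<le>d. mvar (vr (Some (t, \<one>\<^bsub>?G\<^esub>)))) * mvar (vr None))) =
        (\<Prod>t\<le>d. \<tau> (Some (t, g))) * (mconst (to_ac (s g None)) * mvar (d + 1))"
      if g: "g \<in> carrier ?G" for g
    proof -
      have "\<Theta> (M.act g (mvar (vr (Some (t, \<one>\<^bsub>?G\<^esub>))))) = \<tau> (Some (t, g))" if "t \<le> d" for t
        using act_var[OF g S_mem[OF that D.one_closed]] \<Theta>_var[OF S_mem[OF that g]] g
        by (simp add: M.act_def q_def s_def)
      moreover have "\<Theta> (M.act g (mvar (vr None))) = mconst (to_ac (s g None)) * mvar (d + 1)"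
        using act_var[OF g None_mem] \<Theta>_var[OF None_mem] by (simp add: M.act_def q_def \<tau>_def)
      ultimately show ?thesis
        by (simp add: unital_hom.hom_mult[OF M.act_unital_hom] unital_hom.hom_prod[OF M.act_unital_hom]
            \<Theta>.hom_prod)
    qed
    have "\<Theta> f = (\<Sum>g\<in>carrier ?G. (\<Prod>t\<le>d. \<tau> (Some (t, g))) * (mconst (to_ac (s g None)) * mvar (d + 1)))"
      unfolding f_def \<Theta>.hom_sum by (intro sum.cong refl act_term)
    also have "\<dots> = (\<Sum>a\<in>carrier A. \<Sum>e\<in>{0, 1}.
        (\<Prod>t\<le>d. \<tau> (Some (t, a, e))) * (mconst (to_ac (s (a, e) None)) * mvar (d + 1)))"
      by (simp only: carrier_gen_dihedral sum.cartesian_product[symmetric] case_prod_conv)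
        (simp only: sum.cartesian_product case_prod_conv split_def prod.collapse)
    also have "\<dots> = (\<Sum>a\<in>carrier A. Poly_Mapping.single m_top 1)"
    proof (intro sum.cong refl)
      fix a assume a: "a \<in> carrier A"
      have "(\<Prod>t\<le>d. \<tau> (Some (t, a, 0))) = mconst (\<Prod>t\<le>d. \<beta> (c t) a) * (\<Prod>t\<le>d. mvar t)"
        by (simp add: \<tau>_def prod.distrib mconst.hom_prod)
      also have "(\<Prod>t\<le>d. \<beta> (c t) a) = 1"
        using perfect_pairing_finprod[OF assms(1) pairing a, of "{..d}" c] c
          perfect_pairing_one[OF assms(1) pairing a] by simp
      finally have 0: "(\<Prod>t\<le>d. \<tau> (Some (t, a, 0))) = (\<Prod>t\<le>d. mvar t)" by simp
      have 1: "(\<Prod>t\<le>d. \<tau> (Some (t, a, 1))) = 0"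
        by (intro prod_zero) (auto simp: \<tau>_def)
      show "(\<Sum>e\<in>{0, 1}. (\<Prod>t\<le>d. \<tau> (Some (t, a, e))) * (mconst (to_ac (s (a, e) None)) * mvar (d + 1))) =
          Poly_Mapping.single m_top 1"
        using top_eq by (simp add: 0 1 s_def)
    qed
    finally show ?thesis
      by (simp add: Coset.order_def)
  qed
  have "Poly_Mapping.lookup (\<Theta> f) m_top \<noteq> 0"
  proof -
    have "\<Theta> f = mconst (of_nat (order A)) * Poly_Mapping.single m_top 1"
      by (simp only: \<Theta>_f mconst.hom_of_nat)
    then show ?thesis
      using order_A
      by (simp only: lookup_mconst_mult lookup_single_eq mult_1_right not_False_eq_True)
  qed
  then have f_T: "\<Theta> f \<notin> T"
    by (auto simp: T_def in_keys_iff)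
  have "enat (d + 2) \<le> module_noether_number ?G n \<rho>"
    unfolding module_noether_number_def
  proof (rule INF_greatest)
    fix k assume "k \<in> {k. k > 0 \<and> (\<exists>B \<subseteq> M.Inv \<inter> degree_le k. generated_algebra B = M.Inv)}"
    then obtain B where B: "B \<subseteq> M.Inv \<inter> degree_le k" "generated_algebra B = M.Inv"
      by blast
    show "enat (d + 2) \<le> enat k"
    proof (rule ccontr)
      assume "\<not> enat (d + 2) \<le> enat k"
      then have "B \<subseteq> M.Inv \<inter> degree_le (d + 1)"
        using B(1) by (auto intro: degree_le_mono)
      then show False
        using T_algebra[of f B] B(2) f_Inv f_T by simp
    qed
  qed
  also have "\<dots> \<le> noether_number TYPE('f) ?G"
    unfolding noether_number_def using \<rho> by (intro SUP_upper2[of "(n, \<rho>)"]) auto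
  finally show ?thesis .
qed


section \<open>Descent from the algebraic closure\<close>

definition extend_scalars :: "'f :: field mpoly \<Rightarrow> 'f alg_closure mpoly" where
  "extend_scalars = mpoly_eval (\<lambda>a. mconst (to_ac a)) mvar"

lemma mconst_to_ac_unital_hom: "unital_hom (\<lambda>a. mconst (to_ac a))"
  by (simp add: unital_hom_def)

lemma extend_scalars_unital_hom: "unital_hom extend_scalars"
  unfolding extend_scalars_def by (rule mpoly_eval_unital_hom(1)[OF mconst_to_ac_unital_hom])

global_interpretation extend_scalars: unital_hom extend_scalars
  by (rule extend_scalars_unital_hom)

lemma extend_scalars_mconst [simp]: "extend_scalars (mconst a) = mconst (to_ac a)"
  and extend_scalars_mvar [simp]: "extend_scalars (mvar i) = mvar i"
  by (simp_all add: extend_scalars_def mconst_to_ac_unital_hom)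

lemma lookup_extend_scalars [simp]:
  "Poly_Mapping.lookup (extend_scalars f) m = to_ac (Poly_Mapping.lookup f m)"
proof (induction f rule: poly_mapping_singles_induct)
  case (single m' a)
  have "extend_scalars (Poly_Mapping.single m' a) = Poly_Mapping.single m' (to_ac a)"
    by (simp add: extend_scalars_def mpoly_eval_unital_hom(2)[OF mconst_to_ac_unital_hom]
        mono_eval_mvar mconst_mult_single)
  then show ?case
    by (simp add: lookup_single when_def)
qed (simp add: lookup_add)

lemma keys_extend_scalars [simp]: "Poly_Mapping.keys (extend_scalars f) = Poly_Mapping.keys f"
  by (auto simp: in_keys_iff)

lemma extend_scalars_mat_act:
  assumes "M \<in> carrier_mat n n" "f \<in> polys_in n"
  shows "extend_scalars (mat_act n M f) = mat_act n (map_mat to_ac M) (extend_scalars f)"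
proof (rule unital_hom_eq_on_polys_in[OF _ _ _ _ assms(2)])
  show "unital_hom (\<lambda>f. extend_scalars (mat_act n M f))"
    by (rule unital_hom_comp[OF extend_scalars_unital_hom mat_act_unital_hom])
  show "unital_hom (\<lambda>f. mat_act n (map_mat to_ac M) (extend_scalars f))"
    by (rule unital_hom_comp[OF mat_act_unital_hom extend_scalars_unital_hom])
  show "extend_scalars (mat_act n M (mvar i)) = mat_act n (map_mat to_ac M) (extend_scalars (mvar i))"
    if "i < n" for i
    using that assms(1) by (simp add: mat_act_mvar extend_scalars.hom_sum)
qed simp

lemma matrix_modules_extend_scalars:
  assumes "group G" "\<rho> \<in> matrix_modules G n"
  shows "(\<lambda>g. map_mat to_ac (\<rho> g)) \<in> matrix_modules G n"
proof (rule matrix_modulesI[OF assms(1)])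
  fix g h assume gh: "g \<in> carrier G" "h \<in> carrier G"
  have "\<rho> g \<in> carrier_mat n n" "\<rho> h \<in> carrier_mat n n"
    using gh assms(2) by (auto intro: matrix_modules_carrier)
  then show "map_mat to_ac (\<rho> (g \<otimes>\<^bsub>G\<^esub> h)) = map_mat to_ac (\<rho> g) * map_mat to_ac (\<rho> h)"
    unfolding matrix_modules_mult[OF assms(2) gh]
    by (intro eq_matI) (auto simp: scalar_prod_def to_ac_sum)
next
  show "map_mat to_ac (\<rho> \<one>\<^bsub>G\<^esub>) = 1\<^sub>m n"
    by (intro eq_matI) (auto simp: matrix_modules_one[OF assms])
qed (simp add: matrix_modules_carrier[OF assms(2)])

text \<open>The set {1} is independent over F, so the functional sending 1 to 1 extends linearly to
  all of K. Linearity over F is what allows it to act on coefficients.\<close>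

lemma linear_retraction_of_alg_closure:
  obtains r :: "'f :: field alg_closure \<Rightarrow> 'f"
  where "\<And>x y. r (x + y) = r x + r y" "\<And>x a. r (x * to_ac a) = r x * a" "r 1 = 1"
proof -
  interpret K: vector_space "\<lambda>(a :: 'f) (x :: 'f alg_closure). to_ac a * x"
    by standard (simp_all add: algebra_simps)
  interpret F: vector_space "(*) :: 'f \<Rightarrow> 'f \<Rightarrow> 'f"
    by standard (simp_all add: algebra_simps)
  interpret vector_space_pair "\<lambda>(a :: 'f) (x :: 'f alg_closure). to_ac a * x" "(*) :: 'f \<Rightarrow> 'f \<Rightarrow> 'f"
    by standard
  have "K.independent {1}"
    by (simp add: K.independent_insert)
  then obtain g where g: "Vector_Spaces.linear (\<lambda>(a :: 'f) (x :: 'f alg_closure). to_ac a * x) (*) g" "g 1 = 1"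
    using linear_independent_extend[of "{1}" "\<lambda>_. 1"] by auto
  interpret g: Vector_Spaces.linear "\<lambda>(a :: 'f) (x :: 'f alg_closure). to_ac a * x" "(*) :: 'f \<Rightarrow> 'f \<Rightarrow> 'f" g
    by (rule g(1))
  show thesis
  proof (rule that[of g])
    show "g (x + y) = g x + g y" for x y
      by (rule g.add)
    show "g (x * to_ac a) = g x * a" for x a
      using g.scale[of a x] by (simp add: mult.commute)
  qed (rule g(2))
qed

text \<open>A module over \<open>F\<close> inherits its bound from \<open>K = F\<^sup>a\<^sup>l\<^sup>g\<close>: by averaging, the invariants over \<open>K\<close> are
  spanned by invariants over \<open>F\<close>, and applying an \<open>F\<close>-linear retraction \<open>K \<rightarrow> F\<close> to the coefficients
  brings an expression of an invariant over \<open>F\<close> back to \<open>F\<close>.\<close>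

lemma module_noether_number_descent:
  fixes G :: "('g, 'y) monoid_scheme" and \<rho> :: "'g \<Rightarrow> 'f :: field mat"
  assumes "matrix_module G n \<rho>"
    and "invariants G n (\<lambda>g. map_mat to_ac (\<rho> g)) \<subseteq>
      generated_algebra (invariants G n (\<lambda>g. map_mat to_ac (\<rho> g)) \<inter> degree_le e)"
    and "e > 0"
  shows "module_noether_number G n \<rho> \<le> enat e"
proof -
  interpret F: matrix_module G n \<rho> by fact
  interpret K: matrix_module G n "\<lambda>g. map_mat to_ac (\<rho> g)"
  proof
    show "of_nat (order G) \<noteq> (0 :: 'f alg_closure)"
      using F.order_nonzero by (metis to_ac_eq_0_iff to_ac_of_nat)
    show "(\<lambda>g. map_mat to_ac (\<rho> g)) \<in> matrix_modules G n"
      by (rule matrix_modules_extend_scalars[OF F.is_group F.module])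
  qed (rule F.finite_G)
  let ?B = "F.Inv \<inter> degree_le e"
  \<comment> \<open>The K-linear span of the F-algebra generated by low invariants over F, inside
    the polynomials over K.\<close>
  let ?E = "product_span (range mconst) (extend_scalars ` generated_algebra ?B)"
  have act: "extend_scalars (F.act g f) = K.act g (extend_scalars f)"
    if "g \<in> carrier G" "f \<in> polys_in n" for g f
    unfolding F.act_def K.act_def using that
    by (intro extend_scalars_mat_act matrix_modules_carrier[OF F.module])
  have reynolds: "extend_scalars (F.reynolds f) = K.reynolds (extend_scalars f)" if "f \<in> polys_in n" for f
    using that by (simp add: F.reynolds_def K.reynolds_def extend_scalars.hom_sum act)
  have E_mult: "p * q \<in> ?E" if "p \<in> ?E" "q \<in> ?E" for p q
    using that
  proof induction
    case (product b s)
    then obtain k f where bs: "b = mconst k" "s = extend_scalars f" "f \<in> generated_algebra ?B"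
      by auto
    from product(3) show ?case
    proof induction
      case (product b' s')
      then obtain k' f' where bs': "b' = mconst k'" "s' = extend_scalars f'" "f' \<in> generated_algebra ?B"
        by auto
      have "mconst (k * k') * extend_scalars (f * f') \<in> ?E"
        using bs bs' by (intro product_span.product imageI generated_algebra.mult) auto
      then show ?case
        by (simp add: bs bs' mult_ac)
    next
      case (add p q)
      then show ?case
        by (simp add: distrib_left product_span.add)
    qed
  next
    case (add p q)
    then show ?case
      by (simp add: distrib_right product_span.add)
  qed
  have E_zero: "0 \<in> ?E"
  proof -
    have "mconst 0 * extend_scalars (mconst 0) \<in> ?E"
      by (intro product_span.product imageI generated_algebra.const) simp
    then show ?thesis by simp
  qed
  have B_E: "K.Inv \<inter> degree_le e \<subseteq> ?E"
  proof
    fix b assume b: "b \<in> K.Inv \<inter> degree_le e"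
    \<comment> \<open>Averaging a monomial takes place over F. So \<open>b\<close> is a combination,
      with coefficients in K, of averaged monomials, and these are invariants over F of degree at
      most \<open>e\<close>.\<close>
    have "b = K.reynolds (\<Sum>m\<in>Poly_Mapping.keys b. mconst (Poly_Mapping.lookup b m) * mono_eval mvar m)"
      using b by (simp only: mpoly_sum_monomials K.reynolds_id Int_iff)
    also have "\<dots> = (\<Sum>m\<in>Poly_Mapping.keys b. mconst (Poly_Mapping.lookup b m) * K.reynolds (mono_eval mvar m))"
      by (simp add: K.reynolds_sum K.reynolds_scale)
    also have "\<dots> \<in> ?E"
    proof (rule product_span_sum[OF E_zero], rule product_span.product)
      fix m assume m: "m \<in> Poly_Mapping.keys b"
      have m_poly: "mono_eval mvar m \<in> (polys_in n :: 'f mpoly set)"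
        using b m unfolding mono_eval_def
        by (intro polys_in_prod polys_in_power polys_in_mvar) (auto simp: K.invariants_iff polys_in_def)
      have "mono_degree m \<le> e"
        using b m by (auto simp: degree_le_def)
      then have "mono_eval mvar m \<in> (degree_le e :: 'f mpoly set)"
        by (rule degree_le_mono[OF degree_le_mono_eval[OF degree_le_mvar]])
      then have "F.reynolds (mono_eval mvar m) \<in> generated_algebra ?B"
        using m_poly by (intro generated_algebra.gen IntI F.reynolds_invariant F.reynolds_degree_le)
      moreover have "K.reynolds (mono_eval mvar m) = extend_scalars (F.reynolds (mono_eval mvar m))"
        by (simp add: reynolds[OF m_poly] extend_scalars.hom_mono_eval)
      ultimately show "K.reynolds (mono_eval mvar m) \<in> extend_scalars ` generated_algebra ?B"
        by blast
    qed simp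
    finally show "b \<in> ?E" .
  qed
  have E: "f \<in> ?E" if "f \<in> generated_algebra (K.Inv \<inter> degree_le e)" for f
    using that
  proof induction
    case (const a)
    have "mconst a * extend_scalars (mconst 1) \<in> ?E"
      by (intro product_span.product imageI generated_algebra.const) simp
    then show ?case by simp
  qed (use B_E in \<open>auto intro: product_span.add E_mult\<close>)
  obtain r :: "'f alg_closure \<Rightarrow> 'f" where r: "\<And>x y. r (x + y) = r x + r y"
      "\<And>x a. r (x * to_ac a) = r x * a" "r 1 = 1"
    using linear_retraction_of_alg_closure by blast
  have r_zero: "r 0 = 0"
    using r(2)[of 0 0] by simp
  have lookup_map: "Poly_Mapping.lookup (Poly_Mapping.map r P) m = r (Poly_Mapping.lookup P m)" for P m
    by (simp add: Poly_Mapping.map.rep_eq when_def r_zero)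
  \<comment> \<open>On \<open>mconst k * extend_scalars f\<close> the retraction touches only the
    scalar: the coefficients of \<open>f\<close> lie in F and come out by linearity.\<close>
  have retract: "Poly_Mapping.map r P \<in> generated_algebra ?B" if "P \<in> ?E" for P
    using that
  proof induction
    case (product b s)
    then obtain k f where bs: "b = mconst k" "s = extend_scalars f" "f \<in> generated_algebra ?B"
      by auto
    have "Poly_Mapping.map r (b * s) = mconst (r k) * f"
      by (intro poly_mapping_eqI) (simp add: bs lookup_map r(2))
    then show ?case
      using bs(3) by (simp add: generated_algebra.const generated_algebra.mult)
  next
    case (add p q)
    have "Poly_Mapping.map r (p + q) = Poly_Mapping.map r p + Poly_Mapping.map r q"
      by (intro poly_mapping_eqI) (simp add: lookup_map lookup_add r(1))
    then show ?case
      using add.IH by (simp add: generated_algebra.add)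
  qed
  have "f \<in> generated_algebra ?B" if f: "f \<in> F.Inv" for f
  proof -
    have f_poly: "f \<in> polys_in n"
      using f by (simp add: F.invariants_iff)
    have "extend_scalars f \<in> K.Inv"
      unfolding K.invariants_iff
    proof (intro conjI ballI)
      show "extend_scalars f \<in> polys_in n"
        using f_poly by (simp add: polys_in_def)
      show "K.act g (extend_scalars f) = extend_scalars f" if "g \<in> carrier G" for g
        using f that act[OF that f_poly] by (simp add: F.invariants_iff)
    qed
    then have "Poly_Mapping.map r (extend_scalars f) \<in> generated_algebra ?B"
      using assms(2) E retract by blast
    moreover have "Poly_Mapping.map r (extend_scalars f) = f"
      using r(2)[of 1] r(3) by (intro poly_mapping_eqI) (simp add: lookup_map)
    ultimately show ?thesis by simp
  qed
  then have "generated_algebra ?B = F.Inv"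
    using F.generated_algebra_invariants[of ?B] by blast
  then show ?thesis
    unfolding module_noether_number_def using assms(3) by (intro INF_lower) auto
qed

section \<open>Combining the bounds\<close>

lemma noether_number_gen_dihedral_upper_bound:
  fixes A :: "('a, 'm) monoid_scheme" and \<beta> :: "'a \<Rightarrow> 'a \<Rightarrow> 'f :: field alg_closure"
  assumes "comm_group A" "finite (carrier A)"
    and order_nonzero: "of_nat (order (gen_dihedral A)) \<noteq> (0 :: 'f)"
    and pairing: "perfect_pairing A \<beta>" and small_davenport: "small_davenport A = enat d"
  shows "noether_number TYPE('f) (gen_dihedral A) \<le> enat (d + 2)"
  unfolding noether_number_def
proof (rule SUP_least, clarify)
  interpret comm_group A by fact
  fix n and \<rho> :: "'a \<times> int \<Rightarrow> 'f mat"
  assume \<rho>: "\<rho> \<in> matrix_modules (gen_dihedral A) n"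
  have G: "group (gen_dihedral A)"
    by (rule group_gen_dihedral) fact
  have fin: "finite (carrier (gen_dihedral A))"
    using assms(2) by (simp add: carrier_gen_dihedral)
  have F: "matrix_module (gen_dihedral A) n \<rho>"
    using G fin order_nonzero \<rho> by (simp add: matrix_module_def matrix_module_axioms_def)
  have "of_nat (order (gen_dihedral A)) \<noteq> (0 :: 'f alg_closure)"
    using order_nonzero by (metis to_ac_eq_0_iff to_ac_of_nat)
  then have K: "matrix_module (gen_dihedral A) n (\<lambda>g. map_mat to_ac (\<rho> g))"
    using G fin matrix_modules_extend_scalars[OF G \<rho>]
    by (simp add: matrix_module_def matrix_module_axioms_def)
  interpret K: dihedral_module A n "\<lambda>g. map_mat to_ac (\<rho> g)" \<beta> d
    using assms(1) K pairing small_davenport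
    by (simp add: dihedral_module_def dihedral_module_axioms_def)
  show "module_noether_number (gen_dihedral A) n \<rho> \<le> enat (d + 2)"
    by (rule module_noether_number_descent[OF F K.invariants_subset_generated_algebra]) simp
qed

theorem theorem1p1:
  fixes A :: "('a, 'm) monoid_scheme"
  assumes "comm_group A" and "finite (carrier A)"
  shows "ordered_davenport (gen_dihedral A) = small_davenport (gen_dihedral A) + 1
    \<and> small_davenport (gen_dihedral A) + 1 = small_davenport A + 2
    \<and> (\<not> CHAR('f::field) dvd order (gen_dihedral A)
        \<longrightarrow> ordered_davenport (gen_dihedral A) = noether_number TYPE('f) (gen_dihedral A))"
proof (intro conjI impI)
  interpret comm_group A by fact
  note davenport = davenport_gen_dihedral[OF assms(2)]
  show "ordered_davenport (gen_dihedral A) = small_davenport (gen_dihedral A) + 1"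
    and "small_davenport (gen_dihedral A) + 1 = small_davenport A + 2"
    by (fact davenport)+
  assume char: "\<not> CHAR('f) dvd order (gen_dihedral A)"
  obtain d where d: "small_davenport A = enat d"
    using small_davenport_attained[OF assms(2)] by metis
  have order_nonzero: "of_nat (order (gen_dihedral A)) \<noteq> (0 :: 'f)"
    using char by (simp add: of_nat_eq_0_iff_char_dvd)
  then have "of_nat (order A) \<noteq> (0 :: 'f)"
    by (auto simp: order_gen_dihedral)
  then have "of_nat (order A) \<noteq> (0 :: 'f alg_closure)"
    by (metis to_ac_eq_0_iff to_ac_of_nat)
  then obtain \<beta> :: "'a \<Rightarrow> 'a \<Rightarrow> 'f alg_closure" where \<beta>: "perfect_pairing A \<beta>"
    using perfect_pairing_exists[OF assms] by blast
  have "ordered_davenport (gen_dihedral A) = enat (d + 2)"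
    using davenport by (simp add: d numeral_eq_enat)
  also have "\<dots> = noether_number TYPE('f) (gen_dihedral A)"
    by (intro antisym noether_number_gen_dihedral_lower_bound[OF assms order_nonzero \<beta> d]
      noether_number_gen_dihedral_upper_bound[OF assms order_nonzero \<beta> d])
  finally show "ordered_davenport (gen_dihedral A) = noether_number TYPE('f) (gen_dihedral A)" .
qed

end
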